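(* Assume $-F'(\bar u)\in\partial G_3(\bar u)\cap L^\infty(\Omega_T)$. For all $v\in C_{\bar u}$ we have $$G_3''(\bar u,-F'(\bar u);v)=\begin{cases}\displaystyle\int_{\Omega_{\bar u}}\frac{\mu}{\|\bar u(x)\|_{L^2(0,T)}}\Big[\int_0^Tv^2\,\mathrm dt-\Big(\int_0^T\frac{\bar u v}{\|\bar u(x)\|_{L^2(0,T)}}\,\mathrm dt\Big)^2\Big]\mathrm dx,&\bar u\ne0,\\[2mm]0,&\bar u=0\end{cases}$$ (where the value $+\infty$ is possible if $\bar u\neq 0$). Moreover, $G_3$ is strongly twice epi-differentiable at $\bar u$ for $-F'(\bar u)$.
   Context: Setting: $\Omega\subset\mathbb R^d$ is non-empty, open and bounded, $T>0$, $\Omega_T:=\Omega\times(0,T)$; $\alpha<\beta$ are real constants, $\mu>0$; $U_{\mathrm{ad}}:=\{u\in L^2(\Omega_T):\alpha\le u\le\beta\text{ a.e.}\}$, with indicator function $\delta_{U_{\mathrm{ad}}}\colon L^2(\Omega_T)\to\{0,\infty\}$; $\bar u\in U_{\mathrm{ad}}$ is fixed. $j_3(u):=\int_\Omega\|u(x,\cdot)\|_{L^2(0,T)}\,\mathrm dx$ and $G_3:=\delta_{U_{\mathrm{ad}}}+\mu j_3$, a convex function on $L^2(\Omega_T)$ with convex subdifferential $\partial G_3$. $\bar u(x):=\bar u(x,\cdot)$ and $\Omega_{\bar u}:=\{x\in\Omega:\|\bar u(x)\|_{L^2(0,T)}\ne0\}$. $F\colon U_{\mathrm{ad}}\to\mathbb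 R$ is such that there are $F'(\bar u)\in L^2(\Omega_T)$ and a bounded bilinear form $F''(\bar u)$ on $L^2(\Omega_T)$ with $\lim_{k\to\infty}t_k^{-2}\big(F(\bar u+t_kv_k)-F(\bar u)-t_kF'(\bar u)v_k-\frac12t_k^2F''(\bar u)v_k^2\big)=0$ for all $t_k\searrow0$ ($t_k>0$), $v_k\rightharpoonup v$ in $L^2(\Omega_T)$ with $\bar u+t_kv_k\in U_{\mathrm{ad}}$. Here $F'(\bar u)v=\int_{\Omega_T}F'(\bar u)v$. Tangent cone: $\mathcal T_{U_{\mathrm{ad}}}(\bar u)=\{v\in L^2(\Omega_T): v\ge0\text{ a.e. where }\bar u=\alpha,\ v\le0\text{ a.e. where }\bar u=\beta\}$. Critical cone: $C_{\bar u}:=\{v\in\mathcal T_{U_{\mathrm{ad}}}(\bar u):F'(\bar u)v+\mu j_3'(\bar u;v)=0\}$, where $j_3'(\bar u;v)$ is the directional derivative. Weak second subderivative: for $w,v\in L^2(\Omega_T)$, $$G_3''(\bar u,w;v):=\inf\Big\{\liminf_{k\to\infty}\frac{G_3(\bar u+t_kv_k)-G_3(\bar u)-t_k\langle w,v_k\rangle}{t_k^2/2}: t_k\searrow0,\ v_k\rightharpoonup v\text{ in }L^2(\Omega_T)\Big\}.$$ $G_3$ is strongly twice epi-differentiable at $\bar u$ for $w$ if for every $v\in L^2(\Omega_T)$ and every $(t_k)\subset(0,\infty)$ with $t_k\searrow0$ there is $v_k\to v$ (strongly in $L^2(\Omega_T)$) such that the quotients $\frac{G_3(\bar u+t_kv_k)-G_3(\bar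 u)-t_k\langle w,v_k\rangle}{t_k^2/2}$ converge to $G_3''(\bar u,w;v)$. *)

theory Defs
  imports "HOL-Analysis.Analysis"
begin

text \<open>Elements of \<open>L\<^sup>2\<close> are represented by square-integrable functions, not by
  equivalence classes; equality in \<open>L\<^sup>2\<close> is equality almost everywhere.\<close>

definition L2 :: "'b measure \<Rightarrow> ('b \<Rightarrow> real) set" where
  "L2 M = {f \<in> borel_measurable M. integrable M (\<lambda>z. (f z)\<^sup>2)}"

definition Linfty :: "'b measure \<Rightarrow> ('b \<Rightarrow> real) set" where
  "Linfty M = {f \<in> borel_measurable M. \<exists>C. AE z in M. \<bar>f z\<bar> \<le> C}"

definition L2_inner :: "'b measure \<Rightarrow> ('b \<Rightarrow> real) \<Rightarrow> ('b \<Rightarrow> real) \<Rightarrow> real" where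
  "L2_inner M f g = (LINT z|M. f z * g z)"

definition L2_norm :: "'b measure \<Rightarrow> ('b \<Rightarrow> real) \<Rightarrow> real" where
  "L2_norm M f = sqrt (LINT z|M. (f z)\<^sup>2)"

definition L2_strong_conv :: "'b measure \<Rightarrow> (nat \<Rightarrow> 'b \<Rightarrow> real) \<Rightarrow> ('b \<Rightarrow> real) \<Rightarrow> bool" where
  "L2_strong_conv M vs v \<longleftrightarrow> (\<forall>k. vs k \<in> L2 M) \<and> v \<in> L2 M \<and>
     (\<lambda>k. L2_norm M (\<lambda>z. vs k z - v z)) \<longlonglongrightarrow> 0"

text \<open>The dual of \<open>L\<^sup>2\<close> is identified with \<open>L\<^sup>2\<close> through the inner product.\<close>

definition L2_weak_conv :: "'b measure \<Rightarrow> (nat \<Rightarrow> 'b \<Rightarrow> real) \<Rightarrow> ('b \<Rightarrow> real) \<Rightarrow> bool" where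
  "L2_weak_conv M vs v \<longleftrightarrow> (\<forall>k. vs k \<in> L2 M) \<and> v \<in> L2 M \<and>
     (\<forall>w\<in>L2 M. (\<lambda>k. L2_inner M w (vs k)) \<longlonglongrightarrow> L2_inner M w v)"

text \<open>Positive null sequences; monotonicity is not required.\<close>

definition pos_null_seq :: "(nat \<Rightarrow> real) \<Rightarrow> bool" where
  "pos_null_seq t \<longleftrightarrow> (\<forall>k. 0 < t k) \<and> t \<longlonglongrightarrow> 0"

definition bounded_bilinear_form_L2 ::
  "'b measure \<Rightarrow> (('b \<Rightarrow> real) \<Rightarrow> ('b \<Rightarrow> real) \<Rightarrow> real) \<Rightarrow> bool" where
  "bounded_bilinear_form_L2 M B \<longleftrightarrow>
     (\<forall>u\<in>L2 M. \<forall>v\<in>L2 M. \<forall>w\<in>L2 M. \<forall>a b.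
        B (\<lambda>z. a * u z + b * v z) w = a * B u w + b * B v w \<and>
        B w (\<lambda>z. a * u z + b * v z) = a * B w u + b * B w v) \<and>
     (\<exists>C. \<forall>u\<in>L2 M. \<forall>v\<in>L2 M. \<bar>B u v\<bar> \<le> C * L2_norm M u * L2_norm M v)"

definition second_order_expansion ::
  "'b measure \<Rightarrow> ('b \<Rightarrow> real) set \<Rightarrow> (('b \<Rightarrow> real) \<Rightarrow> real) \<Rightarrow> ('b \<Rightarrow> real) \<Rightarrow>
   ('b \<Rightarrow> real) \<Rightarrow> (('b \<Rightarrow> real) \<Rightarrow> ('b \<Rightarrow> real) \<Rightarrow> real) \<Rightarrow> bool" where
  "second_order_expansion M U F u dF d2F \<longleftrightarrow>
     (\<forall>t vs v. pos_null_seq t \<longrightarrow> L2_weak_conv M vs v \<longrightarrow>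
        (\<forall>k. (\<lambda>z. u z + t k * vs k z) \<in> U) \<longrightarrow>
        (\<lambda>k. (F (\<lambda>z. u z + t k * vs k z) - F u - t k * L2_inner M dF (vs k)
                - 1/2 * (t k)\<^sup>2 * d2F (vs k) (vs k)) / (t k)\<^sup>2) \<longlonglongrightarrow> 0)"

definition convex_subdiff ::
  "'b measure \<Rightarrow> (('b \<Rightarrow> real) \<Rightarrow> ereal) \<Rightarrow> ('b \<Rightarrow> real) \<Rightarrow> ('b \<Rightarrow> real) set" where
  "convex_subdiff M G u =
     {w \<in> L2 M. \<forall>y\<in>L2 M. G u + ereal (L2_inner M w (\<lambda>z. y z - u z)) \<le> G y}"

definition has_dir_deriv ::
  "(('b \<Rightarrow> real) \<Rightarrow> real) \<Rightarrow> ('b \<Rightarrow> real) \<Rightarrow> ('b \<Rightarrow> real) \<Rightarrow> real \<Rightarrow> bool" where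
  "has_dir_deriv J u v D \<longleftrightarrow>
     ((\<lambda>h. (J (\<lambda>z. u z + h * v z) - J u) / h) \<longlongrightarrow> D) (at_right 0)"

definition second_diff_quot ::
  "'b measure \<Rightarrow> (('b \<Rightarrow> real) \<Rightarrow> ereal) \<Rightarrow> ('b \<Rightarrow> real) \<Rightarrow> ('b \<Rightarrow> real) \<Rightarrow> real \<Rightarrow>
   ('b \<Rightarrow> real) \<Rightarrow> ereal" where
  "second_diff_quot M G u w t v =
     (G (\<lambda>z. u z + t * v z) - G u - ereal (t * L2_inner M w v)) / ereal (t\<^sup>2 / 2)"

definition weak_second_subderiv ::
  "'b measure \<Rightarrow> (('b \<Rightarrow> real) \<Rightarrow> ereal) \<Rightarrow> ('b \<Rightarrow> real) \<Rightarrow> ('b \<Rightarrow> real) \<Rightarrow>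
   ('b \<Rightarrow> real) \<Rightarrow> ereal" where
  "weak_second_subderiv M G u w v =
     Inf {liminf (\<lambda>k. second_diff_quot M G u w (t k) (vs k)) | t vs.
            pos_null_seq t \<and> L2_weak_conv M vs v}"

definition strongly_twice_epi_diff ::
  "'b measure \<Rightarrow> (('b \<Rightarrow> real) \<Rightarrow> ereal) \<Rightarrow> ('b \<Rightarrow> real) \<Rightarrow> ('b \<Rightarrow> real) \<Rightarrow> bool" where
  "strongly_twice_epi_diff M G u w \<longleftrightarrow>
     (\<forall>v\<in>L2 M. \<forall>t. pos_null_seq t \<longrightarrow>
        (\<exists>vs. L2_strong_conv M vs v \<and>
           (\<lambda>k. second_diff_quot M G u w (t k) (vs k)) \<longlonglongrightarrow> weak_second_subderiv M G u w v))"

text \<open>Representatives are taken Borel measurable, so that all time slices are measurable;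
  every class of Lebesgue measurable functions contains such a representative.\<close>

definition cyl_measure :: "'a::euclidean_space set \<Rightarrow> real \<Rightarrow> ('a \<times> real) measure" where
  "cyl_measure \<Omega> T = restrict_space lborel (\<Omega> \<times> {0<..<T})"

definition slice_norm :: "real \<Rightarrow> ('a \<times> real \<Rightarrow> real) \<Rightarrow> 'a \<Rightarrow> real" where
  "slice_norm T u x = L2_norm (restrict_space lborel {0<..<T}) (\<lambda>t. u (x, t))"

definition Uad ::
  "'a::euclidean_space set \<Rightarrow> real \<Rightarrow> real \<Rightarrow> real \<Rightarrow> ('a \<times> real \<Rightarrow> real) set" where
  "Uad \<Omega> T \<alpha> \<beta> =
     {u \<in> L2 (cyl_measure \<Omega> T). AE z in cyl_measure \<Omega> T. \<alpha> \<le> u z \<and> u z \<le> \<beta>}"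

definition j3 :: "'a::euclidean_space set \<Rightarrow> real \<Rightarrow> ('a \<times> real \<Rightarrow> real) \<Rightarrow> real" where
  "j3 \<Omega> T u = (LINT x:\<Omega>|lborel. slice_norm T u x)"

definition indicator_fun :: "'b set \<Rightarrow> 'b \<Rightarrow> ereal" where
  "indicator_fun U u = (if u \<in> U then 0 else \<infinity>)"

definition G3 ::
  "'a::euclidean_space set \<Rightarrow> real \<Rightarrow> real \<Rightarrow> real \<Rightarrow> real \<Rightarrow> ('a \<times> real \<Rightarrow> real) \<Rightarrow> ereal" where
  "G3 \<Omega> T \<alpha> \<beta> \<mu> u = indicator_fun (Uad \<Omega> T \<alpha> \<beta>) u + ereal (\<mu> * j3 \<Omega> T u)"

definition tangent_cone ::
  "'a::euclidean_space set \<Rightarrow> real \<Rightarrow> real \<Rightarrow> real \<Rightarrow> ('a \<times> real \<Rightarrow> real) \<Rightarrow>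
   ('a \<times> real \<Rightarrow> real) set" where
  "tangent_cone \<Omega> T \<alpha> \<beta> u =
     {v \<in> L2 (cyl_measure \<Omega> T).
        AE z in cyl_measure \<Omega> T. (u z = \<alpha> \<longrightarrow> 0 \<le> v z) \<and> (u z = \<beta> \<longrightarrow> v z \<le> 0)}"

definition critical_cone ::
  "'a::euclidean_space set \<Rightarrow> real \<Rightarrow> real \<Rightarrow> real \<Rightarrow> real \<Rightarrow> ('a \<times> real \<Rightarrow> real) \<Rightarrow>
   ('a \<times> real \<Rightarrow> real) \<Rightarrow> ('a \<times> real \<Rightarrow> real) set" where
  "critical_cone \<Omega> T \<alpha> \<beta> \<mu> u dF =
     {v \<in> tangent_cone \<Omega> T \<alpha> \<beta> u.
        \<exists>D. has_dir_deriv (j3 \<Omega> T) u v D \<and> L2_inner (cyl_measure \<Omega> T) dF v + \<mu> * D = 0}"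

definition nonzero_slices ::
  "'a::euclidean_space set \<Rightarrow> real \<Rightarrow> ('a \<times> real \<Rightarrow> real) \<Rightarrow> 'a set" where
  "nonzero_slices \<Omega> T u = {x \<in> \<Omega>. slice_norm T u x \<noteq> 0}"

text \<open>By the Cauchy--Schwarz inequality the integrand below is nonnegative for almost every
  \<open>x\<close>, so the integral always exists in \<open>[0,\<infinity>]\<close> and the coercion
  \<open>ennreal\<close> truncates only on a null set.\<close>

definition curvature_j3 ::
  "'a::euclidean_space set \<Rightarrow> real \<Rightarrow> real \<Rightarrow> ('a \<times> real \<Rightarrow> real) \<Rightarrow>
   ('a \<times> real \<Rightarrow> real) \<Rightarrow> ennreal" where
  "curvature_j3 \<Omega> T \<mu> u v =
     (\<integral>\<^sup>+x\<in>nonzero_slices \<Omega> T u.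
        ennreal (\<mu> / slice_norm T u x *
          ((LINT t:{0<..<T}|lborel. (v (x, t))\<^sup>2)
           - (LINT t:{0<..<T}|lborel. u (x, t) * v (x, t) / slice_norm T u x)\<^sup>2)) \<partial>lborel)"

end

theory Submission
  imports Defs
begin

text \<open>Write \<open>w = - F'(u)\<close> for the multiplier, \<open>u\<close> for the control \<open>ubar\<close>, and work on a product of two
  finite measure spaces. Testing the subgradient inequality with truncated tangent directions
  gives \<open>(w, v) \<le> \<mu> j'(u; v)\<close> for every tangent \<open>v\<close>, with equality exactly on the critical cone.
  Hence the second-order difference quotient of \<open>G\<close> dominates that of \<open>\<mu> j\<close>, which is an integral
  over the slices of difference quotients of a Hilbert norm,
  \<open>\<parallel>u + t v\<parallel> - \<parallel>u\<parallel> - t b = t\<^sup>2 (\<parallel>v\<parallel>\<^sup>2 - b\<^sup>2) / (\<parallel>u + t v\<parallel> + \<parallel>u\<parallel> + t b)\<close> with \<open>b = (u, v) / \<parallel>u\<parallel>\<close>.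
  Bounding the numerator below by an affine function of \<open>v\<close> on slices where \<open>\<parallel>u\<parallel>\<close> is bounded
  away from \<open>0\<close> yields the lower bound under weak convergence. For the recovery sequence,
  criticality and \<open>w \<in> L\<^sup>\<infinity>\<close> force \<open>v\<close> to be bounded on every slice with \<open>u = 0\<close>, so that such
  slices are feasible as a whole and contribute nothing; on the other slices one truncates.\<close>

text \<open>The norm is not differentiable at \<open>0\<close>, and this decides how directions may
  be cut. On a slice with \<open>u = 0\<close> the derivative of the norm is the norm itself, which
  is not additive, so cutting a critical direction in the middle of such a slice can open a gap
  between \<open>(w, v)\<close> and \<open>\<mu> j'(u; v)\<close>. In the second-order quotient such
  a gap is divided by \<open>t / 2\<close>, so it has to vanish exactly. Hence these slices may only
  be kept or dropped as a whole, and feasibility there must come from a pointwise bound on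
  \<open>v\<close>. The bound is therefore carried by one fixed element of \<open>L2\<close> of the
  product, and the error is \<open>t\<close> times a quantity that stays bounded because weakly
  convergent sequences are bounded. For epi-differentiability, non-critical directions have the
  value infinity, which every strongly convergent sequence attains, the constant one
  included.\<close>

section \<open>Sequences and a quotient estimate\<close>

text \<open>A finite \<open>liminf\<close> bounds difference quotients only along a subsequence.
  Stating the limit comparison with a frequent inequality makes it unnecessary to extract that
  subsequence.\<close>

lemma frequently_le_imp_lim_le:
  fixes f g :: "'i \<Rightarrow> real"
  assumes "(f \<longlongrightarrow> a) F" "(g \<longlongrightarrow> b) F" "\<exists>\<^sub>F k in F. f k \<le> g k"
  shows "a \<le> b"
proof (rule ccontr)
  assume "\<not> a \<le> b"
  then have "0 < a - b" by simp
  have "((\<lambda>k. f k - g k) \<longlongrightarrow> a - b) F" using assms(1,2) by (rule tendsto_diff)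
  from order_tendstoD(1)[OF this \<open>0 < a - b\<close>] have "\<forall>\<^sub>F k in F. \<not> f k \<le> g k"
    by eventually_elim simp
  then show False using assms(3) by (simp add: frequently_def)
qed

text \<open>\<open>\<sigma> k\<close> is the largest level whose threshold \<open>k\<close> has
  passed. The cap \<open>n \<le> k\<close> keeps the candidates finite, so that the maximum
  exists.\<close>

lemma eventually_sequentially_diagonal:
  fixes P :: "nat \<Rightarrow> nat \<Rightarrow> bool"
  assumes "\<And>n. eventually (P n) sequentially"
  shows "\<exists>\<sigma>. filterlim \<sigma> at_top sequentially \<and> (\<forall>\<^sub>F k in sequentially. P (\<sigma> k) k)"
proof -
  have "\<exists>K. \<forall>k\<ge>K. P n k" for n
    using assms[of n] by (simp add: eventually_sequentially)
  then obtain K where K: "\<And>n k. K n \<le> k \<Longrightarrow> P n k" by metis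
  define A where "A k = {n. n \<le> k \<and> K n \<le> k}" for k
  have fin: "finite (A k)" for k by (simp add: A_def)
  define \<sigma> where "\<sigma> k = (if A k = {} then 0 else Max (A k))" for k
  have ge: "m \<le> \<sigma> k" if "m \<le> k" "K m \<le> k" for m k
  proof -
    have "m \<in> A k" using that by (simp add: A_def)
    then show ?thesis using fin[of k] by (auto simp: \<sigma>_def)
  qed
  have "filterlim \<sigma> at_top sequentially"
    unfolding filterlim_at_top eventually_sequentially
    by (metis ge max.cobounded1 max.cobounded2 order_trans)
  moreover have "P (\<sigma> k) k" if "K 0 \<le> k" for k
  proof -
    have "0 \<in> A k" using that by (simp add: A_def)
    then have "\<sigma> k \<in> A k" using fin[of k] by (auto simp: \<sigma>_def intro: Max_in)
    then show ?thesis using K by (simp add: A_def)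
  qed
  ultimately show ?thesis by (auto simp: eventually_sequentially)
qed

text \<open>Read on one slice, \<open>a\<close>, \<open>cy\<close>, \<open>cv\<close> are the norms
  of \<open>u\<close>, \<open>y\<close>, \<open>v\<close>, \<open>i\<close> is
  \<open>(y, v)\<close>, and \<open>b\<close>, \<open>b'\<close> are \<open>(u, v) / a\<close>,
  \<open>(u, y) / a\<close>. With denominator \<open>a\<close> the quotient is affine in
  \<open>y\<close>, which suits weak convergence; with \<open>a + t * cy\<close> it bounds the true
  difference quotient. The exchange costs \<open>m * t * cy / (a * (a + t * cy))\<close>, where
  \<open>m\<close> is linear in \<open>cy\<close> up to a constant. The factor
  \<open>1 + cy\<^sup>2\<close> absorbs both \<open>cy\<close> and \<open>cy\<^sup>2\<close> and is
  integrable over the slices.\<close>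

lemma affine_quotient_perturbation:
  fixes a cy cv b b' i t r g :: real
  assumes "0 < r" "inverse r \<le> a" "cv \<le> r" "0 \<le> cy" "0 \<le> cv" "0 < t"
    and "\<bar>i\<bar> \<le> cy * cv" "\<bar>b\<bar> \<le> cv" "\<bar>b'\<bar> \<le> cy" "0 \<le> g" "g \<le> cv\<^sup>2"
  shows "(2 * (i - b' * b) - g) / a - t * (r\<^sup>2 * (4 * r + r\<^sup>2)) * (1 + cy\<^sup>2)
    \<le> (2 * (i - b' * b) - g) / (a + t * cy)"
proof -
  define m where "m = 2 * (i - b' * b) - g"
  have a: "0 < a" using assms(1,2) by (meson inverse_positive_iff_positive less_le_trans)
  have "\<bar>b' * b\<bar> \<le> cy * cv"
    unfolding abs_mult using assms by (intro mult_mono) auto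
  then have "\<bar>m\<bar> \<le> 4 * (cy * cv) + cv\<^sup>2"
    using assms(7,10,11) unfolding m_def right_diff_distrib by linarith
  also have "\<dots> \<le> 4 * (cy * r) + r\<^sup>2"
    using assms by (intro add_mono mult_left_mono power_mono) auto
  finally have m: "\<bar>m\<bar> \<le> 4 * (cy * r) + r\<^sup>2" .
  have inv: "inverse (a * (a + t * cy)) \<le> r\<^sup>2"
  proof -
    have "inverse r * inverse r \<le> a * (a + t * cy)"
      using assms a by (intro mult_mono) (auto intro: order_trans)
    then have "inverse (a * (a + t * cy)) \<le> inverse (inverse r * inverse r)"
      using assms(1) by (intro le_imp_inverse_le) auto
    then show ?thesis by (simp add: power2_eq_square)
  qed
  have cy: "cy \<le> 1 + cy\<^sup>2"
    using sum_squares_bound[of cy 1] assms(4) by simp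
  have diff: "m / a - m / q = m * (q - a) * inverse (a * q)" if "0 < q" for q
    using that a by (simp add: field_simps)
  have "m / a - m / (a + t * cy) = m * (t * cy) * inverse (a * (a + t * cy))"
    using diff[of "a + t * cy"] a assms by (simp add: add_pos_nonneg)
  also have "\<dots> \<le> \<bar>m\<bar> * (t * cy) * inverse (a * (a + t * cy))"
    using a assms by (intro mult_right_mono) auto
  also have "\<dots> \<le> \<bar>m\<bar> * (t * cy) * r\<^sup>2"
    using assms by (intro mult_left_mono inv) auto
  also have "\<dots> \<le> (4 * (cy * r) + r\<^sup>2) * (t * cy) * r\<^sup>2"
    using assms by (intro mult_right_mono m) auto
  also have "\<dots> = t * r\<^sup>2 * (4 * r * cy\<^sup>2 + r\<^sup>2 * cy)"
    by (simp add: power2_eq_square algebra_simps)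
  also have "\<dots> \<le> t * r\<^sup>2 * (4 * r * (1 + cy\<^sup>2) + r\<^sup>2 * (1 + cy\<^sup>2))"
    using assms cy by (intro mult_left_mono add_mono) auto
  also have "\<dots> = t * (r\<^sup>2 * (4 * r + r\<^sup>2)) * (1 + cy\<^sup>2)"
    by (simp add: algebra_simps)
  finally show ?thesis by (simp add: m_def)
qed

section \<open>Square-integrable functions\<close>

lemma L2_measurable[measurable_dest]: "f \<in> L2 M \<Longrightarrow> f \<in> borel_measurable M"
  by (simp add: L2_def)

lemma L2_square_integrable: "f \<in> L2 M \<Longrightarrow> integrable M (\<lambda>z. (f z)\<^sup>2)"
  by (simp add: L2_def)

lemma L2_mult_integrable:
  assumes "f \<in> L2 M" "g \<in> L2 M"
  shows "integrable M (\<lambda>z. f z * g z)"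
proof (rule Bochner_Integration.integrable_bound)
  show "integrable M (\<lambda>z. (f z)\<^sup>2 + (g z)\<^sup>2)"
    using assms by (simp add: L2_square_integrable)
  show "(\<lambda>z. f z * g z) \<in> borel_measurable M"
    using assms by (auto dest: L2_measurable)
  show "AE z in M. norm (f z * g z) \<le> norm ((f z)\<^sup>2 + (g z)\<^sup>2)"
  proof (intro AE_I2)
    fix z
    have "2 * \<bar>f z\<bar> * \<bar>g z\<bar> \<le> \<bar>f z\<bar>\<^sup>2 + \<bar>g z\<bar>\<^sup>2" by (rule sum_squares_bound)
    moreover have "0 \<le> \<bar>f z\<bar> * \<bar>g z\<bar>" by simp
    ultimately have "\<bar>f z\<bar> * \<bar>g z\<bar> \<le> \<bar>f z\<bar>\<^sup>2 + \<bar>g z\<bar>\<^sup>2" by linarith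
    then show "norm (f z * g z) \<le> norm ((f z)\<^sup>2 + (g z)\<^sup>2)"
      by (simp add: abs_mult)
  qed
qed

lemma L2_bound:
  assumes "g \<in> L2 M" "f \<in> borel_measurable M" "AE z in M. \<bar>f z\<bar> \<le> \<bar>g z\<bar>"
  shows "f \<in> L2 M"
proof -
  have "integrable M (\<lambda>z. (f z)\<^sup>2)"
    by (rule Bochner_Integration.integrable_bound[OF L2_square_integrable[OF assms(1)]])
       (use assms in \<open>auto simp: abs_le_square_iff\<close>)
  then show ?thesis using assms by (simp add: L2_def)
qed

lemma L2_scale: "f \<in> L2 M \<Longrightarrow> (\<lambda>z. c * f z) \<in> L2 M"
  by (auto simp: L2_def power_mult_distrib)

lemma L2_uminus: "f \<in> L2 M \<Longrightarrow> (\<lambda>z. - f z) \<in> L2 M"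
  by (auto simp: L2_def)

lemma L2_add:
  assumes "f \<in> L2 M" "g \<in> L2 M"
  shows "(\<lambda>z. f z + g z) \<in> L2 M"
proof -
  have "integrable M (\<lambda>z. (f z)\<^sup>2 + (g z)\<^sup>2 + 2 * (f z * g z))"
    using assms by (simp add: L2_square_integrable L2_mult_integrable)
  then show ?thesis using assms by (auto simp: L2_def power2_sum mult.assoc)
qed

lemma L2_diff: "f \<in> L2 M \<Longrightarrow> g \<in> L2 M \<Longrightarrow> (\<lambda>z. f z - g z) \<in> L2 M"
  using L2_add[of f M "\<lambda>z. - g z"] by (simp add: L2_uminus)

lemma L2_add_scale: "f \<in> L2 M \<Longrightarrow> g \<in> L2 M \<Longrightarrow> (\<lambda>z. f z + t * g z) \<in> L2 M"
  by (intro L2_add L2_scale)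

lemma L2_zero: "(\<lambda>z. 0) \<in> L2 M"
  by (simp add: L2_def)

lemma L2_indicator_mult:
  assumes "f \<in> L2 M" "E \<in> sets M"
  shows "(\<lambda>z. indicator E z * f z) \<in> L2 M"
  using assms by (intro L2_bound[OF assms(1)]) (auto dest: L2_measurable simp: indicator_def)

section \<open>Inner product, norm and the Cauchy-Schwarz inequality\<close>

lemma L2_inner_commute: "L2_inner M f g = L2_inner M g f"
  by (simp add: L2_inner_def mult.commute)

lemma L2_inner_add_right:
  assumes "f \<in> L2 M" "g \<in> L2 M" "h \<in> L2 M"
  shows "L2_inner M f (\<lambda>z. g z + h z) = L2_inner M f g + L2_inner M f h"
  using assms by (simp add: L2_inner_def distrib_left L2_mult_integrable)

lemma L2_inner_scale_right: "L2_inner M f (\<lambda>z. c * g z) = c * L2_inner M f g"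
  by (simp add: L2_inner_def mult.left_commute)

lemma L2_inner_diff_right:
  assumes "f \<in> L2 M" "g \<in> L2 M" "h \<in> L2 M"
  shows "L2_inner M f (\<lambda>z. g z - h z) = L2_inner M f g - L2_inner M f h"
  using assms by (simp add: L2_inner_def right_diff_distrib L2_mult_integrable)

lemma L2_norm_nonneg[simp]: "0 \<le> L2_norm M f"
  by (simp add: L2_norm_def)

lemma L2_norm_power2: "(L2_norm M f)\<^sup>2 = (LINT z|M. (f z)\<^sup>2)"
  by (simp add: L2_norm_def)

lemma L2_inner_self: "L2_inner M f f = (L2_norm M f)\<^sup>2"
  by (simp add: L2_norm_power2 L2_inner_def flip: power2_eq_square)

lemma L2_norm_scale: "L2_norm M (\<lambda>z. c * f z) = \<bar>c\<bar> * L2_norm M f"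
  by (simp add: L2_norm_def power_mult_distrib real_sqrt_mult)

lemma L2_norm_add_scale_power2:
  assumes "u \<in> L2 M" "v \<in> L2 M"
  shows "(L2_norm M (\<lambda>z. u z + t * v z))\<^sup>2 =
    (L2_norm M u)\<^sup>2 + 2 * t * L2_inner M u v + t\<^sup>2 * (L2_norm M v)\<^sup>2"
proof -
  have "(LINT z|M. (u z + t * v z)\<^sup>2) =
      (LINT z|M. (u z)\<^sup>2 + (2 * t) * (u z * v z) + t\<^sup>2 * (v z)\<^sup>2)"
    by (intro Bochner_Integration.integral_cong) (auto simp: power2_eq_square algebra_simps)
  then show ?thesis
    using assms by (simp add: L2_norm_power2 L2_inner_def L2_square_integrable L2_mult_integrable)
qed

lemma L2_Cauchy_Schwarz:
  assumes f: "f \<in> L2 M" and g: "g \<in> L2 M"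
  shows "\<bar>L2_inner M f g\<bar> \<le> L2_norm M f * L2_norm M g"
proof -
  define a b i where "a = L2_norm M f" and "b = L2_norm M g" and "i = L2_inner M f g"
  have quad: "0 \<le> b\<^sup>2 + 2 * s * i + s\<^sup>2 * a\<^sup>2" for s
    using L2_norm_add_scale_power2[OF g f, of s]
    by (metis L2_inner_commute a_def b_def i_def zero_le_power2)
  have "i\<^sup>2 \<le> a\<^sup>2 * b\<^sup>2"
  proof (cases "a = 0")
    case True
    have "i = 0"
    proof (rule ccontr)
      assume "i \<noteq> 0"
      \<comment> \<open>For \<open>a = 0\<close> the form is affine in \<open>s\<close>, and this
        choice of \<open>s\<close> gives it the value \<open>-1\<close>.\<close>
      then show False
        using quad[of "- (b\<^sup>2 + 1) / (2 * i)"] True by (simp add: field_simps)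
    qed
    then show ?thesis by simp
  next
    case False
    have "0 \<le> b\<^sup>2 - i\<^sup>2 / a\<^sup>2"
      using quad[of "- i / a\<^sup>2"] False by (simp add: field_simps power2_eq_square)
    then show ?thesis using False by (simp add: field_simps)
  qed
  then have "\<bar>i\<bar>\<^sup>2 \<le> (a * b)\<^sup>2" by (simp add: power_mult_distrib)
  then show ?thesis
    unfolding a_def[symmetric] b_def[symmetric] i_def[symmetric]
    by (rule power2_le_imp_le) (simp add: a_def b_def)
qed

lemma L2_norm_add_scale_bounds:
  assumes u: "u \<in> L2 M" and v: "v \<in> L2 M"
  shows "L2_norm M (\<lambda>z. u z + t * v z) \<le> L2_norm M u + \<bar>t\<bar> * L2_norm M v"
    and "L2_norm M u - \<bar>t\<bar> * L2_norm M v \<le> L2_norm M (\<lambda>z. u z + t * v z)"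
proof -
  define a c where "a = L2_norm M u" and "c = L2_norm M v"
  have le: "\<bar>t * L2_inner M u v\<bar> \<le> \<bar>t\<bar> * (a * c)"
    using L2_Cauchy_Schwarz[OF u v] by (simp add: abs_mult mult_left_mono a_def c_def)
  have "(L2_norm M (\<lambda>z. u z + t * v z))\<^sup>2 \<le> (a + \<bar>t\<bar> * c)\<^sup>2"
    unfolding L2_norm_add_scale_power2[OF u v] a_def[symmetric] c_def[symmetric]
    using le by (simp add: power2_sum power_mult_distrib) (simp add: mult_ac)
  then show "L2_norm M (\<lambda>z. u z + t * v z) \<le> L2_norm M u + \<bar>t\<bar> * L2_norm M v"
    unfolding a_def c_def by (rule power2_le_imp_le) simp
  have sq: "(a - \<bar>t\<bar> * c)\<^sup>2 \<le> (L2_norm M (\<lambda>z. u z + t * v z))\<^sup>2"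
    unfolding L2_norm_add_scale_power2[OF u v] a_def[symmetric] c_def[symmetric]
    using le by (simp add: power2_diff power_mult_distrib) (simp add: mult_ac abs_le_iff)
  show "L2_norm M u - \<bar>t\<bar> * L2_norm M v \<le> L2_norm M (\<lambda>z. u z + t * v z)"
    using power2_le_imp_le[OF sq] by (simp add: a_def c_def)
qed

section \<open>Strong and weak convergence\<close>

lemma L2_strong_imp_weak_conv:
  assumes "L2_strong_conv M vs v"
  shows "L2_weak_conv M vs v"
proof -
  have vs: "\<And>k. vs k \<in> L2 M" and v: "v \<in> L2 M"
    and lim: "(\<lambda>k. L2_norm M (\<lambda>z. vs k z - v z)) \<longlonglongrightarrow> 0"
    using assms by (auto simp: L2_strong_conv_def)
  have "(\<lambda>k. L2_inner M w (vs k)) \<longlonglongrightarrow> L2_inner M w v" if w: "w \<in> L2 M" for w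
  proof (rule Lim_null[THEN iffD2], rule Lim_null_comparison)
    show "\<forall>\<^sub>F k in sequentially. norm (L2_inner M w (vs k) - L2_inner M w v)
        \<le> L2_norm M w * L2_norm M (\<lambda>z. vs k z - v z)"
      using L2_Cauchy_Schwarz[OF w L2_diff[OF vs v]]
      by (simp add: L2_inner_diff_right[OF w vs v])
    show "(\<lambda>k. L2_norm M w * L2_norm M (\<lambda>z. vs k z - v z)) \<longlonglongrightarrow> 0"
      using tendsto_mult_right_zero[OF lim] by simp
  qed
  then show ?thesis using vs v by (auto simp: L2_weak_conv_def)
qed

lemma L2_strong_conv_const: "v \<in> L2 M \<Longrightarrow> L2_strong_conv M (\<lambda>_. v) v"
  by (simp add: L2_strong_conv_def L2_norm_def)

text \<open>Splitting \<open>(1/4)^j\<close> as \<open>(1/2)^j * (1/2)^j\<close> and applying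
  Cauchy-Schwarz to the partial sums bounds \<open>(W z)\<^sup>2\<close> by \<open>4/3\<close> times
  the series of \<open>(1/4)^j * (e j z)\<^sup>2\<close>, whose integral is at most that of the
  geometric series. The result supplies the test function of the gliding hump argument
  below.\<close>

lemma L2_geometric_series:
  assumes e: "\<And>j. e j \<in> L2 M" and le1: "\<And>j. L2_norm M (e j) \<le> 1"
  defines "W \<equiv> \<lambda>z. \<Sum>j. (1/4)^j * e j z"
  shows "W \<in> L2 M"
    and "v \<in> L2 M \<Longrightarrow> (\<lambda>j. (1/4)^j * L2_inner M (e j) v) sums L2_inner M W v"
proof -
  have [measurable]: "e j \<in> borel_measurable M" for j
    using e by (auto dest: L2_measurable)
  have int_e2: "(LINT z|M. (e j z)\<^sup>2) \<le> 1" for j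
    using power_mono[OF le1[of j], of 2] by (simp add: L2_norm_power2)
  have geo: "summable (\<lambda>j. (1/4::real)^j)" by (intro summable_geometric) simp
  have AE_sq: "AE z in M. summable (\<lambda>j. (1/4)^j * (e j z)\<^sup>2)"
  proof -
    have "(\<integral>\<^sup>+ z. (\<Sum>j. ennreal ((1/4)^j * (e j z)\<^sup>2)) \<partial>M)
        = (\<Sum>j. \<integral>\<^sup>+ z. ennreal ((1/4)^j * (e j z)\<^sup>2) \<partial>M)"
      by (intro nn_integral_suminf) simp
    also have "\<dots> = (\<Sum>j. ennreal ((1/4)^j * (LINT z|M. (e j z)\<^sup>2)))"
      using e by (subst nn_integral_eq_integral) (auto simp: L2_square_integrable)
    also have "\<dots> \<le> (\<Sum>j. ennreal ((1/4)^j))"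
      using int_e2 by (intro suminf_le ennreal_leI summableI) (simp add: mult_left_le)
    also have "\<dots> = ennreal (\<Sum>j. (1/4)^j)"
      by (rule suminf_ennreal2[OF _ geo]) simp
    finally have "(\<integral>\<^sup>+ z. (\<Sum>j. ennreal ((1/4)^j * (e j z)\<^sup>2)) \<partial>M) \<noteq> \<infinity>"
      by (auto simp: top_unique)
    then have "AE z in M. (\<Sum>j. ennreal ((1/4)^j * (e j z)\<^sup>2)) \<noteq> \<infinity>"
      by (intro nn_integral_PInf_AE) auto
    then show ?thesis
      by eventually_elim (intro summable_suminf_not_top, auto)
  qed
  have sq_int: "integrable M (\<lambda>z. (1/4)^j * (e j z)\<^sup>2)" for j
    using e by (simp add: L2_square_integrable)
  have H: "integrable M (\<lambda>z. \<Sum>j. (1/4)^j * (e j z)\<^sup>2)"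
  proof (rule integrable_suminf[OF sq_int])
    show "AE z in M. summable (\<lambda>j. norm ((1/4)^j * (e j z)\<^sup>2))"
      using AE_sq by simp
    have "summable (\<lambda>j. (1/4)^j * (LINT z|M. (e j z)\<^sup>2))"
      by (rule summable_comparison_test[OF _ geo]) (use int_e2 in \<open>auto simp: mult_left_le\<close>)
    then show "summable (\<lambda>j. LINT z|M. norm ((1/4)^j * (e j z)\<^sup>2))"
      by simp
  qed
  have [measurable]: "W \<in> borel_measurable M" unfolding W_def by measurable
  have AE_abs: "AE z in M. summable (\<lambda>j. (1/4)^j * \<bar>e j z\<bar>)"
    using AE_sq
  proof eventually_elim
    case (elim z)
    show ?case
    proof (rule summable_comparison_test[OF _ summable_add[OF elim geo]], intro exI allI impI)
      fix j
      have "2 * \<bar>e j z\<bar> * 1 \<le> \<bar>e j z\<bar>\<^sup>2 + 1\<^sup>2" by (rule sum_squares_bound)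
      then have "\<bar>e j z\<bar> \<le> (e j z)\<^sup>2 + 1" by simp
      from mult_left_mono[OF this, of "(1/4)^j"]
      show "norm ((1/4)^j * \<bar>e j z\<bar>) \<le> (1/4)^j * (e j z)\<^sup>2 + (1/4)^j"
        by (simp add: algebra_simps)
    qed
  qed
  have "integrable M (\<lambda>z. (W z)\<^sup>2)"
  proof (rule Bochner_Integration.integrable_bound)
    show "integrable M (\<lambda>z. (4/3) * (\<Sum>j. (1/4)^j * (e j z)\<^sup>2))"
      using H by simp
    show "AE z in M. norm ((W z)\<^sup>2) \<le> norm ((4/3) * (\<Sum>j. (1/4)^j * (e j z)\<^sup>2))"
      using AE_abs AE_sq
    proof eventually_elim
      case (elim z)
      have summ: "summable (\<lambda>j. (1/4)^j * e j z)"
        by (rule summable_norm_cancel) (use elim in \<open>simp add: abs_mult\<close>)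
      have "(\<lambda>n. (\<Sum>j<n. (1/4)^j * e j z)\<^sup>2) \<longlonglongrightarrow> (W z)\<^sup>2"
        unfolding W_def by (intro tendsto_power summable_LIMSEQ summ)
      moreover have "(\<Sum>j<n. (1/4)^j * e j z)\<^sup>2 \<le> (4/3) * (\<Sum>j. (1/4)^j * (e j z)\<^sup>2)" for n
      proof -
        have half: "(1/4::real)^j = (1/2)^j * (1/2)^j" for j
          by (simp flip: power_mult_distrib)
        have "(\<Sum>j<n. (1/4)^j * e j z)\<^sup>2 = (\<Sum>j<n. (1/2)^j * ((1/2)^j * e j z))\<^sup>2"
          by (simp add: half mult.assoc)
        also have "\<dots> \<le> (\<Sum>j<n. ((1/2)^j)\<^sup>2) * (\<Sum>j<n. ((1/2)^j * e j z)\<^sup>2)"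
          by (rule Cauchy_Schwarz_ineq_sum)
        also have "\<dots> = (\<Sum>j<n. (1/4)^j) * (\<Sum>j<n. (1/4)^j * (e j z)\<^sup>2)"
          by (simp add: half power_mult_distrib power2_eq_square mult_ac)
        also have "\<dots> \<le> (4/3) * (\<Sum>j. (1/4)^j * (e j z)\<^sup>2)"
        proof (intro mult_mono sum_nonneg)
          have "(\<Sum>j<n. (1/4::real)^j) \<le> (\<Sum>j. (1/4)^j)"
            by (intro sum_le_suminf geo) auto
          then show "(\<Sum>j<n. (1/4::real)^j) \<le> 4/3" by (simp add: suminf_geometric)
          show "(\<Sum>j<n. (1/4)^j * (e j z)\<^sup>2) \<le> (\<Sum>j. (1/4)^j * (e j z)\<^sup>2)"
            by (intro sum_le_suminf elim) auto
        qed auto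
        finally show ?thesis .
      qed
      ultimately have "(W z)\<^sup>2 \<le> (4/3) * (\<Sum>j. (1/4)^j * (e j z)\<^sup>2)"
        by (intro LIMSEQ_le_const2) auto
      then show ?case by simp
    qed
  qed simp
  then show W: "W \<in> L2 M" by (simp add: L2_def)
  show "(\<lambda>j. (1/4)^j * L2_inner M (e j) v) sums L2_inner M W v" if v: "v \<in> L2 M"
  proof -
    have [measurable]: "v \<in> borel_measurable M" using v by (auto dest: L2_measurable)
    have "(\<lambda>j. LINT z|M. (1/4)^j * (e j z * v z)) sums (LINT z|M. (\<Sum>j. (1/4)^j * (e j z * v z)))"
    proof (rule sums_integral)
      show "integrable M (\<lambda>z. (1/4)^j * (e j z * v z))" for j
        using e v by (simp add: L2_mult_integrable)
      show "AE z in M. summable (\<lambda>j. norm ((1/4)^j * (e j z * v z)))"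
        using AE_abs
      proof eventually_elim
        case (elim z)
        show ?case using summable_mult2[OF elim, of "\<bar>v z\<bar>"] by (simp add: abs_mult mult.assoc)
      qed
      have "norm (LINT z|M. norm ((1/4)^j * (e j z * v z))) \<le> L2_norm M v * (1/4)^j" for j
      proof -
        have "(LINT z|M. \<bar>e j z\<bar> * \<bar>v z\<bar>) \<le> L2_norm M (\<lambda>z. \<bar>e j z\<bar>) * L2_norm M (\<lambda>z. \<bar>v z\<bar>)"
          using L2_Cauchy_Schwarz[of "\<lambda>z. \<bar>e j z\<bar>" M "\<lambda>z. \<bar>v z\<bar>"] e[of j] v
          by (simp add: L2_inner_def L2_def)
        also have "\<dots> \<le> 1 * L2_norm M v"
          using le1[of j] by (intro mult_mono) (auto simp: L2_norm_def)
        finally show ?thesis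
          by (simp add: abs_mult mult.commute)
      qed
      then show "summable (\<lambda>j. LINT z|M. norm ((1/4)^j * (e j z * v z)))"
        by (intro summable_comparison_test[OF _ summable_mult[OF geo, of "L2_norm M v"]]) blast
    qed
    also have "(LINT z|M. (\<Sum>j. (1/4)^j * (e j z * v z))) = L2_inner M W v"
      unfolding L2_inner_def
    proof (rule integral_cong_AE)
      show "AE z in M. (\<Sum>j. (1/4)^j * (e j z * v z)) = W z * v z"
        using AE_abs
      proof eventually_elim
        case (elim z)
        have "summable (\<lambda>j. (1/4)^j * e j z)"
          by (rule summable_norm_cancel) (use elim in \<open>simp add: abs_mult\<close>)
        from suminf_mult2[OF this, of "v z"] show ?case by (simp add: W_def mult.assoc)
      qed
    qed simp_all
    finally show ?thesis by (simp add: L2_inner_def)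
  qed
qed

text \<open>Gliding hump.\<close>

lemma L2_weak_conv_bounded:
  assumes "L2_weak_conv M vs v"
  shows "\<exists>B. \<forall>k. L2_norm M (vs k) \<le> B"
proof (rule ccontr)
  assume "\<not> ?thesis"
  then have unbdd: "\<exists>k. B < L2_norm M (vs k)" for B by (meson not_le)
  have vs: "vs k \<in> L2 M" for k using assms by (simp add: L2_weak_conv_def)
  have ptw: "\<exists>B. \<forall>k. \<bar>L2_inner M w (vs k)\<bar> \<le> B" if "w \<in> L2 M" for w
  proof -
    have "convergent (\<lambda>k. L2_inner M w (vs k))"
      using assms that by (auto simp: L2_weak_conv_def convergent_def)
    then show ?thesis using convergent_imp_Bseq by (fastforce simp: Bseq_def)
  qed
  \<comment> \<open>A state holds the partial sum built so far and the index of the next hump.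
    Paired with \<open>vs k\<close>, the new hump contributes \<open>(1/4)^n\<close> times the norm
    of \<open>vs k\<close>; all later humps together take away at most one third of this, hence the
    factor \<open>2/3\<close>. What is left must beat the bound \<open>B\<close> for the earlier
    humps by \<open>n + 1\<close>.\<close>
  define P where "P n x \<longleftrightarrow> fst x \<in> L2 M \<and> (\<exists>B. (\<forall>k. \<bar>L2_inner M (fst x) (vs k)\<bar> \<le> B)
      \<and> B + real n + 1 \<le> (1/4)^n * (2/3) * L2_norm M (vs (snd x)))"
    for n and x :: "('a \<Rightarrow> real) \<times> nat"
  define e where "e k z = inverse (L2_norm M (vs k)) * vs k z" for k z
  have e: "e k \<in> L2 M" for k
    unfolding e_def[abs_def] by (intro L2_scale vs)
  have ex: "\<exists>k. P n (S, k)" if S: "S \<in> L2 M" for S n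
  proof -
    obtain B where B: "\<forall>k. \<bar>L2_inner M S (vs k)\<bar> \<le> B" using ptw[OF S] by blast
    obtain k where "(B + real n + 1) / ((1/4)^n * (2/3)) < L2_norm M (vs k)"
      using unbdd by blast
    then have "B + real n + 1 \<le> (1/4)^n * (2/3) * L2_norm M (vs k)"
      by (simp add: field_simps)
    then show ?thesis using S B by (auto simp: P_def)
  qed
  have "\<exists>f. f 0 \<in> {x. P 0 x \<and> fst x = (\<lambda>z. 0)} \<and> (\<forall>n. P n (f n) \<and>
      fst (f (Suc n)) = (\<lambda>z. fst (f n) z + (1/4)^n * e (snd (f n)) z))"
    (is "\<exists>f. ?init f \<and> _")
  proof -
    obtain k0 where k0: "P 0 (\<lambda>z. 0, k0)" using ex[OF L2_zero] by blast
    have "\<exists>f. \<forall>n. (P n (f n) \<and> (n = 0 \<longrightarrow> fst (f n) = (\<lambda>z. 0))) \<and>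
        fst (f (Suc n)) = (\<lambda>z. fst (f n) z + (1/4)^n * e (snd (f n)) z)"
    proof (rule dependent_nat_choice)
      show "\<exists>x. P 0 x \<and> (0 = (0::nat) \<longrightarrow> fst x = (\<lambda>z. 0))" using k0 by force
    next
      fix x n assume "P n x \<and> (n = 0 \<longrightarrow> fst x = (\<lambda>z. 0))"
      then have "(\<lambda>z. fst x z + (1/4)^n * e (snd x) z) \<in> L2 M"
        by (intro L2_add_scale e) (simp add: P_def)
      from ex[OF this] obtain k where "P (Suc n) (\<lambda>z. fst x z + (1/4)^n * e (snd x) z, k)" by blast
      then show "\<exists>y. (P (Suc n) y \<and> (Suc n = 0 \<longrightarrow> fst y = (\<lambda>z. 0))) \<and>
          fst y = (\<lambda>z. fst x z + (1/4)^n * e (snd x) z)" by force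
    qed
    then show ?thesis by auto
  qed
  then obtain f where f0: "fst (f 0) = (\<lambda>z. 0)" and P: "\<And>n. P n (f n)"
    and fSuc: "\<And>n. fst (f (Suc n)) = (\<lambda>z. fst (f n) z + (1/4)^n * e (snd (f n)) z)"
    by blast
  define k where "k n = snd (f n)" for n
  define W where "W z = (\<Sum>j. (1/4)^j * e (k j) z)" for z
  have ek: "L2_norm M (e j) \<le> 1" for j
    unfolding e_def[abs_def] L2_norm_scale by (cases "L2_norm M (vs j) = 0") auto
  have W: "W \<in> L2 M"
    unfolding W_def[abs_def] by (rule L2_geometric_series(1)[OF e ek])
  have sums: "(\<lambda>j. (1/4)^j * L2_inner M (e (k j)) v) sums L2_inner M W v" if "v \<in> L2 M" for v
    unfolding W_def[abs_def] by (rule L2_geometric_series(2)[OF e ek that])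
  have partial: "L2_inner M (fst (f n)) v = (\<Sum>j<n. (1/4)^j * L2_inner M (e (k j)) v)"
    if v: "v \<in> L2 M" for n v
  proof (induction n)
    case 0
    then show ?case by (simp add: f0 L2_inner_def)
  next
    case (Suc n)
    have "fst (f n) \<in> L2 M" using P by (simp add: P_def)
    then have "L2_inner M v (fst (f (Suc n))) =
        L2_inner M v (fst (f n)) + (1/4)^n * L2_inner M v (e (k n))"
      using v e by (simp add: fSuc k_def L2_inner_add_right L2_scale L2_inner_scale_right)
    then show ?case using Suc by (simp add: L2_inner_commute)
  qed
  have large: "real n + 1 \<le> \<bar>L2_inner M W (vs (k n))\<bar>" for n
  proof -
    define v where "v = vs (k n)"
    define r where "r = L2_norm M v"
    define c where "c j = (1/4)^j * L2_inner M (e (k j)) v" for j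
    have v: "v \<in> L2 M" by (simp add: v_def vs)
    obtain B where B: "\<bar>L2_inner M (fst (f n)) v\<bar> \<le> B"
        "B + real n + 1 \<le> (1/4)^n * (2/3) * r"
      using P[of n] by (auto simp: P_def k_def v_def r_def)
    have "0 < (1/4)^n * (2/3) * r" using B by linarith
    then have r: "0 < r" by (simp add: zero_less_mult_iff)
    have c_sums: "c sums L2_inner M W v"
      unfolding c_def by (rule sums[OF v])
    have cn: "c n = (1/4)^n * r"
    proof -
      have "L2_inner M (e (k n)) v = inverse r * r\<^sup>2"
        using L2_inner_scale_right[of M v "inverse r" v] L2_inner_commute[of M "e (k n)" v]
        by (simp add: e_def[abs_def] v_def[symmetric] r_def L2_inner_self)
      then show ?thesis using r by (simp add: c_def power2_eq_square)
    qed
    have tail: "\<bar>\<Sum>j. c (j + Suc n)\<bar> \<le> (1/4)^n * r / 3"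
    proof -
      have bd: "norm (c (j + Suc n)) \<le> (1/4)^j * ((1/4)^Suc n * r)" for j
      proof -
        have "\<bar>L2_inner M (e (k (j + Suc n))) v\<bar> \<le> L2_norm M (e (k (j + Suc n))) * r"
          using L2_Cauchy_Schwarz[OF e v] by (simp add: r_def)
        also have "\<dots> \<le> 1 * r" using ek r by (intro mult_right_mono) auto
        finally show ?thesis
          unfolding c_def by (simp add: abs_mult power_add mult_left_mono mult.assoc)
      qed
      have g: "summable (\<lambda>j. (1/4::real)^j * ((1/4)^Suc n * r))"
        by (intro summable_mult2 summable_geometric) simp
      have "norm (\<Sum>j. c (j + Suc n)) \<le> (\<Sum>j. (1/4)^j * ((1/4)^Suc n * r))"
        by (rule norm_suminf_le[OF bd g])
      also have "\<dots> = (1/4)^n * r / 3"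
        by (subst suminf_mult2[symmetric]) (auto simp: suminf_geometric summable_geometric)
      finally show ?thesis by simp
    qed
    have "L2_inner M W v = (\<Sum>j<Suc n. c j) + (\<Sum>j. c (j + Suc n))"
      using suminf_split_initial_segment[of c "Suc n"] c_sums by (simp add: sums_iff)
    also have "(\<Sum>j<Suc n. c j) = L2_inner M (fst (f n)) v + (1/4)^n * r"
      using partial[OF v, of n] cn by (simp add: c_def)
    finally have "(1/4)^n * r * (2/3) - B \<le> L2_inner M W v"
      using tail B(1) by linarith
    then show ?thesis using B(2) by (simp add: v_def algebra_simps)
  qed
  obtain B where "\<forall>k. \<bar>L2_inner M W (vs k)\<bar> \<le> B" using ptw[OF W] by blast
  with large have "real n + 1 \<le> B" for n by (meson order_trans)
  then show False using reals_Archimedean2[of B] by (metis add.commute le_less_trans less_add_one not_less order.asym)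
qed

lemma L2_bounded_mult:
  assumes f: "f \<in> L2 M" and g: "g \<in> borel_measurable M" "\<And>z. z \<in> space M \<Longrightarrow> \<bar>g z\<bar> \<le> C"
  shows "(\<lambda>z. g z * f z) \<in> L2 M"
proof (rule L2_bound[OF L2_scale[OF f, of C]])
  show "(\<lambda>z. g z * f z) \<in> borel_measurable M"
    using f g by (auto dest: L2_measurable)
  show "AE z in M. \<bar>g z * f z\<bar> \<le> \<bar>C * f z\<bar>"
  proof (rule AE_I2)
    fix z assume "z \<in> space M"
    with g(2) have "\<bar>g z\<bar> \<le> \<bar>C\<bar>" by fastforce
    then show "\<bar>g z * f z\<bar> \<le> \<bar>C * f z\<bar>"
      unfolding abs_mult by (intro mult_right_mono) auto
  qed
qed

lemma L2_inner_scale_left: "L2_inner M (\<lambda>z. c * f z) g = c * L2_inner M f g"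
  by (simp add: L2_inner_def mult.assoc)

lemma L2_norm_const_zero[simp]: "L2_norm M (\<lambda>z. 0) = 0"
  by (simp add: L2_norm_def)

lemma L2_inner_const_zero[simp]: "L2_inner M (\<lambda>z. 0) g = 0" "L2_inner M g (\<lambda>z. 0) = 0"
  by (simp_all add: L2_inner_def)

lemma L2_strong_conv_indicator:
  assumes v: "v \<in> L2 M" and E: "\<And>n. E n \<in> sets M"
    and ev: "AE z in M. \<forall>\<^sub>F n in sequentially. z \<in> E n"
  shows "L2_strong_conv M (\<lambda>n z. indicator (E n) z * v z) v"
proof -
  have [measurable]: "v \<in> borel_measurable M" "E n \<in> sets M" for n
    using v E by (auto dest: L2_measurable)
  have "(\<lambda>n. LINT z|M. (indicator (E n) z * v z - v z)\<^sup>2) \<longlonglongrightarrow> (LINT z|M. 0)"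
  proof (rule integral_dominated_convergence[OF _ _ L2_square_integrable[OF v]])
    show "AE z in M. (\<lambda>n. (indicator (E n) z * v z - v z)\<^sup>2) \<longlonglongrightarrow> 0"
      using ev
    proof eventually_elim
      case (elim z)
      from elim have "\<forall>\<^sub>F n in sequentially. (indicator (E n) z * v z - v z)\<^sup>2 = 0"
        by eventually_elim simp
      then show ?case by (rule tendsto_eventually)
    qed
    show "AE z in M. norm ((indicator (E n) z * v z - v z)\<^sup>2) \<le> (v z)\<^sup>2" for n
      by (intro AE_I2) (auto simp: indicator_def)
  qed simp_all
  from tendsto_real_sqrt[OF this]
  have "(\<lambda>n. L2_norm M (\<lambda>z. indicator (E n) z * v z - v z)) \<longlonglongrightarrow> 0"
    by (simp add: L2_norm_def)
  then show ?thesis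
    using v L2_indicator_mult[OF v E] by (simp add: L2_strong_conv_def)
qed

lemma L2_norm_triangle_diff:
  assumes "f \<in> L2 M" "g \<in> L2 M" "h \<in> L2 M"
  shows "L2_norm M (\<lambda>z. f z - h z) \<le> L2_norm M (\<lambda>z. f z - g z) + L2_norm M (\<lambda>z. g z - h z)"
  using L2_norm_add_scale_bounds(1)[OF L2_diff[OF assms(1,2)] L2_diff[OF assms(2,3)], of 1] by simp

lemma L2_strong_conv_norm:
  assumes "L2_strong_conv M vs v"
  shows "(\<lambda>k. L2_norm M (vs k)) \<longlonglongrightarrow> L2_norm M v"
proof (rule Lim_null[THEN iffD2], rule Lim_null_comparison)
  have vs: "vs k \<in> L2 M" and v: "v \<in> L2 M" for k
    using assms by (auto simp: L2_strong_conv_def)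
  have "\<bar>L2_norm M (vs k) - L2_norm M v\<bar> \<le> L2_norm M (\<lambda>z. vs k z - v z)" for k
    using L2_norm_add_scale_bounds[OF v L2_diff[OF vs[of k] v], of 1] by (simp add: abs_le_iff)
  then show "\<forall>\<^sub>F k in sequentially.
      norm (L2_norm M (vs k) - L2_norm M v) \<le> L2_norm M (\<lambda>z. vs k z - v z)"
    by simp
  show "(\<lambda>k. L2_norm M (\<lambda>z. vs k z - v z)) \<longlonglongrightarrow> 0"
    using assms by (simp add: L2_strong_conv_def)
qed

lemma L2_norm_zero_imp_AE:
  assumes "f \<in> L2 M" "L2_norm M f = 0"
  shows "AE z in M. f z = 0"
proof -
  have "(LINT z|M. (f z)\<^sup>2) = 0" using assms(2) by (simp flip: L2_norm_power2)
  then show ?thesis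
    using integral_nonneg_eq_0_iff_AE[OF L2_square_integrable[OF assms(1)]] by simp
qed

text \<open>The test function is \<open>s\<close> times the indicator of the part of
  \<open>E\<close> where the limit has the wrong sign; it is square-integrable because the measure
  is finite. The factor \<open>s\<close> serves both bounds of the box.\<close>

lemma (in finite_measure) L2_weak_conv_sign:
  assumes weak: "L2_weak_conv M vs v" and E[measurable]: "E \<in> sets M"
    and freq: "\<exists>\<^sub>F k in sequentially. AE z in M. z \<in> E \<longrightarrow> 0 \<le> s * vs k z"
  shows "AE z in M. z \<in> E \<longrightarrow> 0 \<le> s * v z"
proof -
  have vs: "\<And>k. vs k \<in> L2 M" and v: "v \<in> L2 M"
    and inner: "\<And>f. f \<in> L2 M \<Longrightarrow> (\<lambda>k. L2_inner M f (vs k)) \<longlonglongrightarrow> L2_inner M f v"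
    using weak by (auto simp: L2_weak_conv_def)
  have [measurable]: "v \<in> borel_measurable M" using v by (rule L2_measurable)
  define A where "A = {z \<in> space M. z \<in> E \<and> s * v z < 0}"
  have [measurable]: "A \<in> sets M" unfolding A_def by measurable
  define f :: "'a \<Rightarrow> real" where "f z = s * indicator A z" for z
  have f: "f \<in> L2 M"
    using L2_scale[OF L2_indicator_mult[of "\<lambda>_. 1" M A], of s]
    by (simp add: f_def[abs_def] L2_def)
  have "0 \<le> L2_inner M f v"
  proof (rule frequently_le_imp_lim_le[OF tendsto_const inner[OF f]])
    show "\<exists>\<^sub>F k in sequentially. 0 \<le> L2_inner M f (vs k)"
      using freq
    proof (rule frequently_elim1)
      fix k assume "AE z in M. z \<in> E \<longrightarrow> 0 \<le> s * vs k z"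
      then have "AE z in M. 0 \<le> f z * vs k z"
        by eventually_elim (auto simp: f_def A_def indicator_def)
      then show "0 \<le> L2_inner M f (vs k)"
        unfolding L2_inner_def by (rule integral_nonneg_AE)
    qed
  qed
  moreover have nonneg: "0 \<le> - (f z * v z)" for z
    by (auto simp: f_def A_def indicator_def)
  moreover have "0 \<le> (LINT z|M. - (f z * v z))"
    by (rule integral_nonneg_AE) (use nonneg in simp)
  ultimately have "(LINT z|M. - (f z * v z)) = 0"
    by (simp add: L2_inner_def)
  then have "AE z in M. - (f z * v z) = 0"
    using integral_nonneg_eq_0_iff_AE[of M "\<lambda>z. - (f z * v z)"] L2_mult_integrable[OF f v] nonneg by simp
  with AE_space show ?thesis
    by eventually_elim (force simp: f_def A_def indicator_def split: if_splits)
qed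

section \<open>Second-order behaviour of the Hilbert norm\<close>

text \<open>The one-sided directional derivative of the norm. It is linear in \<open>v\<close> when
  \<open>u\<close> has nonzero norm, and only sublinear otherwise.\<close>

definition L2_norm_deriv :: "'b measure \<Rightarrow> ('b \<Rightarrow> real) \<Rightarrow> ('b \<Rightarrow> real) \<Rightarrow> real" where
  "L2_norm_deriv M u v =
     (if L2_norm M u \<noteq> 0 then L2_inner M u v / L2_norm M u else L2_norm M v)"

text \<open>For \<open>u = 0\<close> the value of the curvature is \<open>0\<close> because of \<open>x / 0 = 0\<close>; this agrees with
  the second-order behaviour of the norm at \<open>0\<close>, which is positively homogeneous.\<close>

definition L2_norm_curv :: "'b measure \<Rightarrow> ('b \<Rightarrow> real) \<Rightarrow> ('b \<Rightarrow> real) \<Rightarrow> real" where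
  "L2_norm_curv M u v =
     ((L2_norm M v)\<^sup>2 - (L2_inner M u v / L2_norm M u)\<^sup>2) / L2_norm M u"

definition L2_norm_quot2 ::
  "'b measure \<Rightarrow> ('b \<Rightarrow> real) \<Rightarrow> real \<Rightarrow> ('b \<Rightarrow> real) \<Rightarrow> real" where
  "L2_norm_quot2 M u t v =
     (L2_norm M (\<lambda>z. u z + t * v z) - L2_norm M u - t * L2_norm_deriv M u v) / (t\<^sup>2 / 2)"

lemma L2_inner_norm_zero:
  assumes "u \<in> L2 M" "v \<in> L2 M" "L2_norm M u = 0"
  shows "L2_inner M u v = 0"
  using L2_Cauchy_Schwarz[OF assms(1,2)] assms(3) by simp

lemma L2_norm_add_scale_of_norm_zero:
  assumes "u \<in> L2 M" "v \<in> L2 M" "L2_norm M u = 0" "0 \<le> t"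
  shows "L2_norm M (\<lambda>z. u z + t * v z) = t * L2_norm M v"
proof -
  have "(L2_norm M (\<lambda>z. u z + t * v z))\<^sup>2 = (t * L2_norm M v)\<^sup>2"
    using L2_norm_add_scale_power2[OF assms(1,2)] L2_inner_norm_zero[OF assms(1-3)] assms(3)
    by (simp add: power_mult_distrib)
  then show ?thesis by (rule power2_eq_imp_eq) (use assms in auto)
qed

lemma L2_inner_div_norm_le:
  assumes "u \<in> L2 M" "v \<in> L2 M"
  shows "\<bar>L2_inner M u v / L2_norm M u\<bar> \<le> L2_norm M v"
proof (cases "L2_norm M u = 0")
  case False
  then have "0 < L2_norm M u" using L2_norm_nonneg[of M u] by linarith
  then show ?thesis using L2_Cauchy_Schwarz[OF assms] by (simp add: field_simps abs_mult)
qed simp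

lemma L2_norm_deriv_le:
  assumes "u \<in> L2 M" "v \<in> L2 M"
  shows "\<bar>L2_norm_deriv M u v\<bar> \<le> L2_norm M v"
  using L2_inner_div_norm_le[OF assms] by (simp add: L2_norm_deriv_def)

text \<open>Comparing squares with the tangent value cancels all terms up to first order in
  \<open>t\<close>. Every estimate of the second-order quotient factors the left-hand side as a
  difference of squares.\<close>

lemma L2_norm_square_defect:
  assumes u: "u \<in> L2 M" and v: "v \<in> L2 M" and a: "L2_norm M u \<noteq> 0"
  shows "(L2_norm M (\<lambda>z. u z + t * v z))\<^sup>2 - (L2_norm M u + t * (L2_inner M u v / L2_norm M u))\<^sup>2
    = t\<^sup>2 * (L2_norm M u * L2_norm_curv M u v)"
proof -
  define b where "b = L2_inner M u v / L2_norm M u"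
  have i: "L2_inner M u v = L2_norm M u * b" using a by (simp add: b_def)
  have c: "L2_norm M u * L2_norm_curv M u v = (L2_norm M v)\<^sup>2 - b\<^sup>2"
    using a by (simp add: L2_norm_curv_def b_def)
  show ?thesis
    unfolding L2_norm_add_scale_power2[OF u v] b_def[symmetric] i c
    using a by (simp add: power2_eq_square algebra_simps)
qed

lemma L2_norm_curv_nonneg:
  assumes "u \<in> L2 M" "v \<in> L2 M"
  shows "0 \<le> L2_norm_curv M u v"
  using L2_inner_div_norm_le[OF assms] unfolding L2_norm_curv_def
  by (intro divide_nonneg_nonneg) (simp_all add: abs_le_square_iff[symmetric] del: power_divide)

lemma L2_norm_curv_le: "L2_norm_curv M u v \<le> (L2_norm M v)\<^sup>2 / L2_norm M u"
  unfolding L2_norm_curv_def by (intro divide_right_mono) auto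

lemma L2_norm_ge_tangent:
  assumes u: "u \<in> L2 M" and v: "v \<in> L2 M" and t: "0 \<le> t"
  shows "L2_norm M u + t * L2_norm_deriv M u v \<le> L2_norm M (\<lambda>z. u z + t * v z)"
proof (cases "L2_norm M u = 0")
  case True
  then show ?thesis
    using L2_norm_add_scale_of_norm_zero[OF u v _ t] by (simp add: L2_norm_deriv_def)
next
  case False
  let ?d = "L2_norm M u + t * (L2_inner M u v / L2_norm M u)"
  have "0 \<le> t\<^sup>2 * (L2_norm M u * L2_norm_curv M u v)"
    using L2_norm_curv_nonneg[OF u v] by simp
  then have "?d\<^sup>2 \<le> (L2_norm M (\<lambda>z. u z + t * v z))\<^sup>2"
    using L2_norm_square_defect[OF u v False, of t] by linarith
  then have "?d \<le> L2_norm M (\<lambda>z. u z + t * v z)"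
    by (rule power2_le_imp_le) simp
  then show ?thesis using False by (simp add: L2_norm_deriv_def)
qed

lemma L2_norm_quot2_nonneg:
  assumes "u \<in> L2 M" "v \<in> L2 M" "0 \<le> t"
  shows "0 \<le> L2_norm_quot2 M u t v"
  using L2_norm_ge_tangent[OF assms] by (simp add: L2_norm_quot2_def)

lemma L2_norm_quot2_zero:
  assumes "u \<in> L2 M" "v \<in> L2 M" "0 \<le> t" "L2_norm M u = 0"
  shows "L2_norm_quot2 M u t v = 0"
  using L2_norm_add_scale_of_norm_zero[OF assms(1,2,4,3)] assms(4)
  by (simp add: L2_norm_quot2_def L2_norm_deriv_def)

text \<open>\<open>pos\<close> excludes steps beyond the origin: for \<open>v = - 2 * u / t\<close>
  the second factor of the difference of squares is \<open>0\<close>, while the quotient is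
  positive.\<close>

lemma L2_norm_quot2_eq:
  assumes u: "u \<in> L2 M" and v: "v \<in> L2 M" and a: "L2_norm M u \<noteq> 0" and t: "t \<noteq> 0"
    and pos: "0 < L2_norm M (\<lambda>z. u z + t * v z) + L2_norm M u + t * (L2_inner M u v / L2_norm M u)"
  shows "L2_norm_quot2 M u t v = 2 * (L2_norm M u * L2_norm_curv M u v) /
    (L2_norm M (\<lambda>z. u z + t * v z) + L2_norm M u + t * (L2_inner M u v / L2_norm M u))"
proof -
  define s r where "s = L2_norm M (\<lambda>z. u z + t * v z)"
    and "r = L2_norm M u + t * (L2_inner M u v / L2_norm M u)"
  have "(s - r) * (s + r) = t\<^sup>2 * (L2_norm M u * L2_norm_curv M u v)"
    using L2_norm_square_defect[OF u v a, of t]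
    by (simp add: s_def r_def power2_eq_square algebra_simps)
  then have "(s - r) / (t\<^sup>2 / 2) = 2 * (L2_norm M u * L2_norm_curv M u v) / (s + r)"
    using t pos unfolding s_def[symmetric] add.assoc r_def[symmetric]
    by (simp add: field_simps)
  then show ?thesis
    using a by (simp add: L2_norm_quot2_def L2_norm_deriv_def s_def r_def algebra_simps)
qed

text \<open>Both \<open>L2_norm M (\<lambda>z. u z + t * v z)\<close> and the tangent value are at
  most the denominator on the left, so their sum is at most twice that. No smallness of
  \<open>t * L2_norm M v\<close> enters, and none is available uniformly over the slices under weak
  convergence.\<close>

lemma L2_norm_quot2_ge:
  assumes u: "u \<in> L2 M" and v: "v \<in> L2 M" and a: "L2_norm M u \<noteq> 0" and t: "0 < t"
  shows "L2_norm M u * L2_norm_curv M u v / (L2_norm M u + t * L2_norm M v)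
    \<le> L2_norm_quot2 M u t v"
proof -
  define s r where "s = L2_norm M (\<lambda>z. u z + t * v z)"
    and "r = L2_norm M u + t * (L2_inner M u v / L2_norm M u)"
  define m where "m = L2_norm M u + t * L2_norm M v"
  have apos: "0 < L2_norm M u" using a L2_norm_nonneg[of M u] by linarith
  have m: "0 < m" using apos t by (simp add: m_def add_pos_nonneg)
  have le: "s \<le> m" using L2_norm_add_scale_bounds(1)[OF u v, of t] t by (simp add: s_def m_def)
  have "t * (L2_inner M u v / L2_norm M u) \<le> t * L2_norm M v"
    using t by (intro mult_left_mono abs_le_D1[OF L2_inner_div_norm_le[OF u v]]) simp
  then have rm: "r \<le> m" by (simp add: r_def m_def)
  have rs: "r \<le> s"
    using L2_norm_ge_tangent[OF u v, of t] t a by (simp add: L2_norm_deriv_def s_def r_def)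
  have "t\<^sup>2 * (L2_norm M u * L2_norm_curv M u v) = (s - r) * (s + r)"
    using L2_norm_square_defect[OF u v a, of t]
    by (simp add: s_def r_def power2_eq_square algebra_simps)
  also have "\<dots> \<le> (s - r) * (2 * m)"
    using le rm rs by (intro mult_left_mono) auto
  finally have "L2_norm M u * L2_norm_curv M u v / m \<le> (s - r) / (t\<^sup>2 / 2)"
    using m t by (simp add: field_simps)
  also have "\<dots> = L2_norm_quot2 M u t v"
    using a by (simp add: L2_norm_quot2_def L2_norm_deriv_def s_def r_def algebra_simps)
  finally show ?thesis by (simp add: m_def)
qed

text \<open>\<open>small\<close> keeps the sum in the denominator above half the norm of
  \<open>u\<close>. This is the majorant for dominated convergence along the recovery
  sequence.\<close>

lemma L2_norm_quot2_le:
  assumes u: "u \<in> L2 M" and v: "v \<in> L2 M" and t: "0 < t"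
    and small: "t * L2_norm M v \<le> L2_norm M u / 2"
  shows "L2_norm_quot2 M u t v \<le> 4 * (L2_norm M v)\<^sup>2 / L2_norm M u"
proof (cases "L2_norm M u = 0")
  case True
  then show ?thesis using L2_norm_quot2_zero[OF u v] t by simp
next
  case False
  then have apos: "0 < L2_norm M u" using L2_norm_nonneg[of M u] by linarith
  define S where
    "S = L2_norm M (\<lambda>z. u z + t * v z) + L2_norm M u + t * (L2_inner M u v / L2_norm M u)"
  have "- (t * L2_norm M v) \<le> t * (L2_inner M u v / L2_norm M u)"
    using mult_left_mono[OF abs_le_D2[OF L2_inner_div_norm_le[OF u v]], of t] t by simp
  then have "L2_norm M u - t * L2_norm M v \<le> S"
    unfolding S_def using L2_norm_nonneg[of M "\<lambda>z. u z + t * v z"] by linarith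
  then have S: "L2_norm M u / 2 \<le> S" using small by simp
  have ac: "L2_norm M u * L2_norm_curv M u v \<le> (L2_norm M v)\<^sup>2"
    using L2_norm_curv_le[of M u v] apos by (simp add: field_simps)
  have S0: "0 < S" using S apos by simp
  have "L2_norm_quot2 M u t v = 2 * (L2_norm M u * L2_norm_curv M u v) / S"
    using L2_norm_quot2_eq[OF u v False _ S0[unfolded S_def]] t by (simp add: S_def)
  also have "\<dots> \<le> 2 * (L2_norm M v)\<^sup>2 / (L2_norm M u / 2)"
    using S apos ac by (intro frac_le) auto
  finally show ?thesis by simp
qed

lemma L2_norm_quot2_tendsto:
  assumes u: "u \<in> L2 M" and vs: "\<And>k. vs k \<in> L2 M" and t: "\<And>k. 0 < t k" "t \<longlonglongrightarrow> 0"
    and norm: "(\<lambda>k. L2_norm M (vs k)) \<longlonglongrightarrow> L2_norm M v"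
    and inner: "(\<lambda>k. L2_inner M u (vs k)) \<longlonglongrightarrow> L2_inner M u v"
  shows "(\<lambda>k. L2_norm_quot2 M u (t k) (vs k)) \<longlonglongrightarrow> L2_norm_curv M u v"
proof (cases "L2_norm M u = 0")
  case True
  then show ?thesis
    using L2_norm_quot2_zero[OF u vs] t(1) by (simp add: L2_norm_curv_def less_imp_le)
next
  case False
  then have apos: "0 < L2_norm M u" using L2_norm_nonneg[of M u] by linarith
  define s where "s k = L2_norm M (\<lambda>z. u z + t k * vs k z)" for k
  have curv: "(\<lambda>k. L2_norm_curv M u (vs k)) \<longlonglongrightarrow> L2_norm_curv M u v"
    unfolding L2_norm_curv_def using False by (intro tendsto_intros norm inner) auto
  have "(\<lambda>k. sqrt ((s k)\<^sup>2)) \<longlonglongrightarrow> sqrt ((L2_norm M u)\<^sup>2 + 2 * 0 * L2_inner M u v + 0\<^sup>2 * (L2_norm M v)\<^sup>2)"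
    unfolding s_def L2_norm_add_scale_power2[OF u vs] by (intro tendsto_intros norm inner t)
  then have s: "s \<longlonglongrightarrow> L2_norm M u" by (simp add: s_def[abs_def])
  define S where "S k = s k + L2_norm M u + t k * (L2_inner M u (vs k) / L2_norm M u)" for k
  have "S \<longlonglongrightarrow> L2_norm M u + L2_norm M u + 0 * (L2_inner M u v / L2_norm M u)"
    unfolding S_def using False by (intro tendsto_intros s t inner) auto
  then have S: "S \<longlonglongrightarrow> 2 * L2_norm M u" by simp
  have "(\<lambda>k. 2 * (L2_norm M u * L2_norm_curv M u (vs k)) / S k)
      \<longlonglongrightarrow> 2 * (L2_norm M u * L2_norm_curv M u v) / (2 * L2_norm M u)"
    using False by (intro tendsto_intros curv S) auto
  then have lim: "(\<lambda>k. 2 * (L2_norm M u * L2_norm_curv M u (vs k)) / S k) \<longlonglongrightarrow> L2_norm_curv M u v"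
    using False by simp
  have "\<forall>\<^sub>F k in sequentially. 0 < S k"
    using order_tendstoD(1)[OF S, of 0] apos by simp
  then have "\<forall>\<^sub>F k in sequentially.
      2 * (L2_norm M u * L2_norm_curv M u (vs k)) / S k = L2_norm_quot2 M u (t k) (vs k)"
  proof eventually_elim
    case (elim k)
    then show ?case
      using L2_norm_quot2_eq[OF u vs False, of "t k" k] t(1)[of k] by (simp add: S_def s_def)
  qed
  with lim show ?thesis by (rule Lim_transform_eventually)
qed

text \<open>The first-order quotient is the derivative plus \<open>h k / 2\<close> times the
  second-order quotient, which converges.\<close>

lemma L2_norm_has_dir_deriv:
  assumes u: "u \<in> L2 M" and v: "v \<in> L2 M"
    and h: "\<And>k. 0 < h k" "h \<longlonglongrightarrow> 0"
  shows "(\<lambda>k. (L2_norm M (\<lambda>z. u z + h k * v z) - L2_norm M u) / h k) \<longlonglongrightarrow> L2_norm_deriv M u v"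
proof -
  have "(\<lambda>k. L2_norm_deriv M u v + h k / 2 * L2_norm_quot2 M u (h k) v)
      \<longlonglongrightarrow> L2_norm_deriv M u v + 0 / 2 * L2_norm_curv M u v"
    by (intro tendsto_intros h L2_norm_quot2_tendsto u v) simp
  moreover have "L2_norm_deriv M u v + h k / 2 * L2_norm_quot2 M u (h k) v =
      (L2_norm M (\<lambda>z. u z + h k * v z) - L2_norm M u) / h k" for k
    using h(1)[of k] by (simp add: L2_norm_quot2_def field_simps power2_eq_square)
  ultimately show ?thesis by simp
qed

text \<open>Nonnegativity of the quadratic form \<open>\<parallel>v\<parallel>\<^sup>2 - (u, v)\<^sup>2 / \<parallel>u\<parallel>\<^sup>2\<close> at \<open>y - v\<close>.\<close>

lemma L2_norm_curv_ge_affine: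
  assumes u: "u \<in> L2 M" and v: "v \<in> L2 M" and y: "y \<in> L2 M" and a: "L2_norm M u \<noteq> 0"
  shows "2 * (L2_inner M y v - (L2_inner M u y / L2_norm M u) * (L2_inner M u v / L2_norm M u))
      - L2_norm M u * L2_norm_curv M u v \<le> L2_norm M u * L2_norm_curv M u y"
proof -
  have "0 \<le> L2_norm M u * L2_norm_curv M u (\<lambda>z. y z - v z)"
    using L2_norm_curv_nonneg[OF u L2_diff[OF y v]] by simp
  also have "\<dots> = (L2_norm M (\<lambda>z. y z + (-1) * v z))\<^sup>2 -
      ((L2_inner M u y - L2_inner M u v) / L2_norm M u)\<^sup>2"
    using a by (simp add: L2_norm_curv_def L2_inner_diff_right[OF u y v])
  also have "(L2_norm M (\<lambda>z. y z + (-1) * v z))\<^sup>2 =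
      (L2_norm M y)\<^sup>2 - 2 * L2_inner M y v + (L2_norm M v)\<^sup>2"
    by (subst L2_norm_add_scale_power2[OF y v]) simp
  finally show ?thesis
    using a by (simp add: L2_norm_curv_def diff_divide_distrib power2_diff algebra_simps)
qed

lemma L2_norm_deriv_lipschitz:
  assumes u: "u \<in> L2 M" and f: "f \<in> L2 M" and g: "g \<in> L2 M"
  shows "L2_norm_deriv M u f \<le> L2_norm_deriv M u g + L2_norm M (\<lambda>z. f z - g z)"
proof (cases "L2_norm M u = 0")
  case True
  then show ?thesis
    using L2_norm_add_scale_bounds(1)[OF g L2_diff[OF f g], of 1] by (simp add: L2_norm_deriv_def)
next
  case False
  have "L2_inner M u (\<lambda>z. f z - g z) / L2_norm M u \<le> L2_norm M (\<lambda>z. f z - g z)"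
    by (intro abs_le_D1[OF L2_inner_div_norm_le] u L2_diff f g)
  then show ?thesis
    using False by (simp add: L2_norm_deriv_def L2_inner_diff_right[OF u f g] diff_divide_distrib)
qed

section \<open>The integral of the slice norms\<close>

locale finite_product = X: finite_measure X + Y: finite_measure Y
  for X :: "'a measure" and Y :: "'b measure"
begin

sublocale pair_sigma_finite X Y ..

sublocale XY: finite_measure "X \<Otimes>\<^sub>M Y"
  by (intro finite_measure_pair_measure X.finite_measure_axioms Y.finite_measure_axioms)

abbreviation M :: "('a \<times> 'b) measure" where "M \<equiv> X \<Otimes>\<^sub>M Y"

abbreviation slice :: "('a \<times> 'b \<Rightarrow> real) \<Rightarrow> 'a \<Rightarrow> 'b \<Rightarrow> real" where
  "slice f x \<equiv> \<lambda>y. f (x, y)"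

abbreviation snorm :: "('a \<times> 'b \<Rightarrow> real) \<Rightarrow> 'a \<Rightarrow> real" where
  "snorm f x \<equiv> L2_norm Y (slice f x)"

abbreviation sinner :: "('a \<times> 'b \<Rightarrow> real) \<Rightarrow> ('a \<times> 'b \<Rightarrow> real) \<Rightarrow> 'a \<Rightarrow> real" where
  "sinner f g x \<equiv> L2_inner Y (slice f x) (slice g x)"

abbreviation sderiv :: "('a \<times> 'b \<Rightarrow> real) \<Rightarrow> ('a \<times> 'b \<Rightarrow> real) \<Rightarrow> 'a \<Rightarrow> real" where
  "sderiv f g x \<equiv> L2_norm_deriv Y (slice f x) (slice g x)"

abbreviation scurv :: "('a \<times> 'b \<Rightarrow> real) \<Rightarrow> ('a \<times> 'b \<Rightarrow> real) \<Rightarrow> 'a \<Rightarrow> real" where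
  "scurv f g x \<equiv> L2_norm_curv Y (slice f x) (slice g x)"

abbreviation squot2 :: "('a \<times> 'b \<Rightarrow> real) \<Rightarrow> real \<Rightarrow> ('a \<times> 'b \<Rightarrow> real) \<Rightarrow> 'a \<Rightarrow> real" where
  "squot2 f t g x \<equiv> L2_norm_quot2 Y (slice f x) t (slice g x)"

lemma sinner_measurable[measurable]:
  assumes [measurable]: "f \<in> borel_measurable M" "g \<in> borel_measurable M"
  shows "sinner f g \<in> borel_measurable X"
  unfolding L2_inner_def by measurable

lemma snorm_measurable[measurable]:
  assumes [measurable]: "f \<in> borel_measurable M"
  shows "snorm f \<in> borel_measurable X"
  unfolding L2_norm_def by measurable

lemma sderiv_measurable[measurable]:
  assumes [measurable]: "f \<in> borel_measurable M" "g \<in> borel_measurable M"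
  shows "sderiv f g \<in> borel_measurable X"
  unfolding L2_norm_deriv_def by measurable

lemma scurv_measurable[measurable]:
  assumes [measurable]: "f \<in> borel_measurable M" "g \<in> borel_measurable M"
  shows "scurv f g \<in> borel_measurable X"
  unfolding L2_norm_curv_def by measurable

lemma squot2_measurable[measurable]:
  assumes [measurable]: "f \<in> borel_measurable M" "g \<in> borel_measurable M"
  shows "squot2 f t g \<in> borel_measurable X"
  unfolding L2_norm_quot2_def by measurable

lemma slice_L2:
  assumes "f \<in> L2 M"
  shows "AE x in X. slice f x \<in> L2 Y"
proof -
  have "AE x in X. integrable Y (\<lambda>y. (f (x, y))\<^sup>2)"
    using AE_integrable_fst'[OF L2_square_integrable[OF assms]] .
  moreover have "AE x in X. slice f x \<in> borel_measurable Y"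
    using L2_measurable[OF assms] by (intro AE_I2) (rule measurable_Pair2)
  ultimately show ?thesis by eventually_elim (simp add: L2_def)
qed

lemma
  assumes "f \<in> L2 M" "g \<in> L2 M"
  shows integrable_sinner: "integrable X (sinner f g)"
    and integral_sinner: "(LINT x|X. sinner f g x) = L2_inner M f g"
  using integrable_fst'[OF L2_mult_integrable[OF assms]]
    integral_fst'[OF L2_mult_integrable[OF assms]]
  by (simp_all add: L2_inner_def)

lemma
  assumes "f \<in> L2 M"
  shows snorm_L2: "snorm f \<in> L2 X"
    and integral_snorm_power2: "(LINT x|X. (snorm f x)\<^sup>2) = (L2_norm M f)\<^sup>2"
  using integrable_sinner[OF assms assms] integral_sinner[OF assms assms] assms
  by (auto simp: L2_inner_self L2_def)

lemma integrable_snorm: "f \<in> L2 M \<Longrightarrow> integrable X (snorm f)"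
  using snorm_L2 by (auto simp: L2_def intro: X.square_integrable_imp_integrable)

lemma L2_prodI:
  assumes f: "f \<in> borel_measurable M" and sl: "AE x in X. slice f x \<in> L2 Y"
    and g: "g \<in> L2 X" and le: "AE x in X. snorm f x \<le> g x"
  shows "f \<in> L2 M"
proof -
  have "integrable M (\<lambda>z. (f z)\<^sup>2)"
  proof (rule Fubini_integrable)
    show "(\<lambda>z. (f z)\<^sup>2) \<in> borel_measurable M" using f by simp
    show "AE x in X. integrable Y (\<lambda>y. (f (x, y))\<^sup>2)"
      using sl by eventually_elim (simp add: L2_def)
    have "snorm f \<in> L2 X"
    proof (rule L2_bound[OF g])
      show "snorm f \<in> borel_measurable X" using f by measurable
      show "AE x in X. \<bar>snorm f x\<bar> \<le> \<bar>g x\<bar>" using le by eventually_elim simp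
    qed
    then show "integrable X (\<lambda>x. LINT y|Y. norm ((f (x, y))\<^sup>2))"
      by (simp add: L2_square_integrable flip: L2_norm_power2)
  qed
  then show ?thesis using f by (simp add: L2_def)
qed

section \<open>The integral functional, its one-sided derivative and its second-order
  quotient\<close>

definition J :: "('a \<times> 'b \<Rightarrow> real) \<Rightarrow> real" where
  "J f = (LINT x|X. snorm f x)"

definition DJ :: "('a \<times> 'b \<Rightarrow> real) \<Rightarrow> ('a \<times> 'b \<Rightarrow> real) \<Rightarrow> real" where
  "DJ f g = (LINT x|X. sderiv f g x)"

lemma AE_sderiv_le:
  assumes "f \<in> L2 M" "g \<in> L2 M"
  shows "AE x in X. \<bar>sderiv f g x\<bar> \<le> snorm g x"
  using slice_L2[OF assms(1)] slice_L2[OF assms(2)]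
  by eventually_elim (rule L2_norm_deriv_le)

lemma integrable_sderiv:
  assumes "f \<in> L2 M" "g \<in> L2 M"
  shows "integrable X (sderiv f g)"
proof (rule Bochner_Integration.integrable_bound[OF integrable_snorm[OF assms(2)]])
  show "sderiv f g \<in> borel_measurable X" using assms by (auto dest: L2_measurable)
  show "AE x in X. norm (sderiv f g x) \<le> norm (snorm g x)"
    using AE_sderiv_le[OF assms] by simp
qed

text \<open>The slicewise derivatives pass through the integral by dominated convergence: the norm
  is 1-Lipschitz, so \<open>snorm g\<close> is a majorant, and it is integrable because
  \<open>X\<close> is finite.\<close>

lemma J_has_dir_deriv:
  assumes f: "f \<in> L2 M" and g: "g \<in> L2 M"
  shows "((\<lambda>h. (J (\<lambda>z. f z + h * g z) - J f) / h) \<longlongrightarrow> DJ f g) (at_right 0)"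
  unfolding tendsto_at_iff_sequentially comp_def
proof (intro allI impI)
  fix h :: "nat \<Rightarrow> real"
  assume "\<forall>k. h k \<in> {0<..} - {0}" and h0: "h \<longlonglongrightarrow> 0"
  then have h: "0 < h k" for k by auto
  have [measurable]: "f \<in> borel_measurable M" "g \<in> borel_measurable M"
    using f g by (auto dest: L2_measurable)
  have "(\<lambda>k. LINT x|X. (snorm (\<lambda>z. f z + h k * g z) x - snorm f x) / h k) \<longlonglongrightarrow> DJ f g"
    unfolding DJ_def
  proof (rule integral_dominated_convergence[OF _ _ integrable_snorm[OF g]])
    show "AE x in X. (\<lambda>k. (snorm (\<lambda>z. f z + h k * g z) x - snorm f x) / h k) \<longlonglongrightarrow> sderiv f g x"
      using slice_L2[OF f] slice_L2[OF g]
      by eventually_elim (rule L2_norm_has_dir_deriv[OF _ _ h h0])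
    show "AE x in X. norm ((snorm (\<lambda>z. f z + h k * g z) x - snorm f x) / h k) \<le> snorm g x" for k
      using slice_L2[OF f] slice_L2[OF g]
    proof eventually_elim
      case (elim x)
      have "\<bar>snorm (\<lambda>z. f z + h k * g z) x - snorm f x\<bar> \<le> h k * snorm g x"
        using L2_norm_add_scale_bounds[OF elim, of "h k"] h[of k] by (simp add: abs_le_iff)
      then show ?case using h[of k] by (simp add: abs_div field_simps)
    qed
  qed (measurable; simp)+
  also have "(\<lambda>k. LINT x|X. (snorm (\<lambda>z. f z + h k * g z) x - snorm f x) / h k) =
      (\<lambda>k. (J (\<lambda>z. f z + h k * g z) - J f) / h k)"
    using f g by (simp add: J_def integrable_snorm[OF L2_add_scale] integrable_snorm)
  finally show "(\<lambda>k. (J (\<lambda>z. f z + h k * g z) - J f) / h k) \<longlonglongrightarrow> DJ f g" .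
qed

lemma
  assumes "f \<in> L2 M" "g \<in> L2 M" and t: "t \<noteq> 0"
  shows integrable_squot2: "integrable X (squot2 f t g)"
    and J_quot2_eq: "(J (\<lambda>z. f z + t * g z) - J f - t * DJ f g) / (t\<^sup>2 / 2) = (LINT x|X. squot2 f t g x)"
  using assms unfolding L2_norm_quot2_def J_def DJ_def
  by (simp_all add: integrable_snorm[OF L2_add_scale] integrable_snorm integrable_sderiv)

lemma AE_squot2_nonneg:
  assumes "f \<in> L2 M" "g \<in> L2 M" "0 \<le> t"
  shows "AE x in X. 0 \<le> squot2 f t g x"
  using slice_L2[OF assms(1)] slice_L2[OF assms(2)]
  by eventually_elim (intro L2_norm_quot2_nonneg assms(3))

lemma J_ge_tangent:
  assumes "f \<in> L2 M" "g \<in> L2 M" and t: "0 < t"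
  shows "J f + t * DJ f g \<le> J (\<lambda>z. f z + t * g z)"
proof -
  have "0 \<le> (J (\<lambda>z. f z + t * g z) - J f - t * DJ f g) / (t\<^sup>2 / 2)"
    using integral_nonneg_AE[OF AE_squot2_nonneg[OF assms(1,2), of t]] t
    by (subst J_quot2_eq[OF assms(1,2)]) auto
  then show ?thesis using t by (simp add: zero_le_divide_iff)
qed

text \<open>A subgradient of \<open>J\<close> at \<open>f\<close> that attains the directional derivative in direction \<open>g\<close>.\<close>

definition subgrad :: "('a \<times> 'b \<Rightarrow> real) \<Rightarrow> ('a \<times> 'b \<Rightarrow> real) \<Rightarrow> 'a \<times> 'b \<Rightarrow> real" where
  "subgrad f g z = (if snorm f (fst z) \<noteq> 0 then inverse (snorm f (fst z)) * f z
     else inverse (snorm g (fst z)) * g z)"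

lemma slice_subgrad:
  "slice (subgrad f g) x = (if snorm f x \<noteq> 0 then (\<lambda>y. inverse (snorm f x) * f (x, y))
     else (\<lambda>y. inverse (snorm g x) * g (x, y)))"
  by (auto simp: subgrad_def fun_eq_iff)

lemma subgrad_L2:
  assumes f: "f \<in> L2 M" and g: "g \<in> L2 M"
  shows "subgrad f g \<in> L2 M"
proof (rule L2_prodI)
  have [measurable]: "f \<in> borel_measurable M" "g \<in> borel_measurable M"
    using f g by (auto dest: L2_measurable)
  show "subgrad f g \<in> borel_measurable M"
    unfolding subgrad_def[abs_def] by measurable
  show "AE x in X. slice (subgrad f g) x \<in> L2 Y"
    using slice_L2[OF f] slice_L2[OF g]
    by eventually_elim (auto simp: slice_subgrad L2_scale)
  show "(\<lambda>_. 1) \<in> L2 X" by (simp add: L2_def)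
  have "snorm (subgrad f g) x \<le> 1" for x
    by (cases "snorm g x = 0") (auto simp: slice_subgrad L2_norm_scale)
  then show "AE x in X. snorm (subgrad f g) x \<le> 1" by simp
qed

lemma inner_subgrad_le:
  assumes f: "f \<in> L2 M" and g: "g \<in> L2 M" and h: "h \<in> L2 M"
  shows "L2_inner M (subgrad f g) h \<le> DJ f h"
  unfolding DJ_def integral_sinner[OF subgrad_L2[OF f g] h, symmetric]
proof (rule integral_mono_AE[OF integrable_sinner[OF subgrad_L2[OF f g] h] integrable_sderiv[OF f h]])
  show "AE x in X. sinner (subgrad f g) h x \<le> sderiv f h x"
    using slice_L2[OF f] slice_L2[OF g] slice_L2[OF h]
  proof eventually_elim
    case (elim x)
    show ?case
    proof (cases "snorm f x = 0")
      case True
      have "sinner g h x / snorm g x \<le> snorm h x"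
        using L2_inner_div_norm_le[OF elim(2,3)] by (rule abs_le_D1)
      then show ?thesis
        using True
        by (simp add: slice_subgrad L2_norm_deriv_def L2_inner_scale_left divide_inverse_commute)
    next
      case False
      then show ?thesis
        by (simp add: slice_subgrad L2_norm_deriv_def L2_inner_scale_left divide_inverse_commute)
    qed
  qed
qed

lemma inner_subgrad_self:
  assumes f: "f \<in> L2 M" and g: "g \<in> L2 M"
  shows "L2_inner M (subgrad f g) g = DJ f g"
  unfolding DJ_def integral_sinner[OF subgrad_L2[OF f g] g, symmetric]
proof (rule Bochner_Integration.integral_cong[OF refl])
  fix x
  show "sinner (subgrad f g) g x = sderiv f g x"
    by (cases "snorm g x = 0")
      (auto simp: slice_subgrad L2_norm_deriv_def L2_inner_scale_left
        L2_inner_self power2_eq_square divide_inverse_commute)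
qed

lemma AE_fst:
  assumes "AE x in X. P x"
  shows "AE z in M. P (fst z)"
proof -
  obtain N where "N \<in> null_sets X" "{x \<in> space X. \<not> P x} \<subseteq> N"
    using assms by (auto simp: eventually_ae_filter)
  then show ?thesis
    by (intro AE_I'[of "N \<times> space Y"]) (auto simp: space_pair_measure)
qed

lemma integral_snorm_le:
  assumes f: "f \<in> L2 M"
  shows "(LINT x|X. snorm f x) \<le> sqrt (measure X (space X)) * L2_norm M f"
proof -
  have "(\<lambda>_. 1) \<in> L2 X" by (simp add: L2_def)
  from L2_Cauchy_Schwarz[OF this snorm_L2[OF f]]
  have "(LINT x|X. snorm f x) \<le> L2_norm X (\<lambda>_. 1) * L2_norm X (snorm f)"
    by (simp add: L2_inner_def)
  also have "L2_norm X (snorm f) = L2_norm M f"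
    using integral_snorm_power2[OF f] by (simp add: L2_norm_def[of X])
  also have "L2_norm X (\<lambda>_. 1) = sqrt (measure X (space X))"
    by (simp add: L2_norm_def)
  finally show ?thesis .
qed

text \<open>A one-sided estimate is enough to pass to the limit in
  \<open>(w, v) \<le> \<mu> * DJ u v\<close> along strongly convergent directions. The square root
  is the norm of the constant \<open>1\<close> in Cauchy-Schwarz.\<close>

lemma DJ_lipschitz:
  assumes u: "u \<in> L2 M" and f: "f \<in> L2 M" and g: "g \<in> L2 M"
  shows "DJ u f \<le> DJ u g + sqrt (measure X (space X)) * L2_norm M (\<lambda>z. f z - g z)"
proof -
  have "DJ u f \<le> (LINT x|X. sderiv u g x + snorm (\<lambda>z. f z - g z) x)"
    unfolding DJ_def
  proof (rule integral_mono_AE)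
    show "AE x in X. sderiv u f x \<le> sderiv u g x + snorm (\<lambda>z. f z - g z) x"
      using slice_L2[OF u] slice_L2[OF f] slice_L2[OF g]
      by eventually_elim (rule L2_norm_deriv_lipschitz)
  qed (use assms in \<open>auto intro!: integrable_sderiv integrable_snorm L2_diff\<close>)
  also have "\<dots> = DJ u g + (LINT x|X. snorm (\<lambda>z. f z - g z) x)"
    unfolding DJ_def using assms
    by (intro Bochner_Integration.integral_add integrable_sderiv integrable_snorm L2_diff)
  finally show ?thesis using integral_snorm_le[OF L2_diff[OF f g]] by linarith
qed

end

section \<open>Subgradients under box constraints\<close>

text \<open>Outside the box the subgradient inequality is trivial, since the functional is infinite
  there; inside it is an inequality between reals. On a null space \<open>C\<close> may be negative,
  so \<open>\<bar>C\<bar>\<close> appears later.\<close>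

locale box_subgradient = finite_product X Y for X :: "'a measure" and Y :: "'b measure" +
  fixes \<alpha> \<beta> \<mu> C :: real and u w :: "'a \<times> 'b \<Rightarrow> real"
  assumes mu: "0 < \<mu>" and u: "u \<in> L2 M" and box: "AE z in M. \<alpha> \<le> u z \<and> u z \<le> \<beta>"
    and w: "w \<in> L2 M" and w_le: "AE z in M. \<bar>w z\<bar> \<le> C"
    and subgradient: "\<And>f. f \<in> L2 M \<Longrightarrow> AE z in M. \<alpha> \<le> f z \<and> f z \<le> \<beta> \<Longrightarrow>
      \<mu> * J u + L2_inner M w (\<lambda>z. f z - u z) \<le> \<mu> * J f"
begin

lemma u_measurable[measurable]: "u \<in> borel_measurable M"
  using u by (rule L2_measurable)

lemma w_measurable[measurable]: "w \<in> borel_measurable M"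
  using w by (rule L2_measurable)

definition feasible :: "real \<Rightarrow> ('a \<times> 'b \<Rightarrow> real) \<Rightarrow> bool" where
  "feasible t v \<longleftrightarrow> (AE z in M. \<alpha> \<le> u z + t * v z \<and> u z + t * v z \<le> \<beta>)"

definition tangent :: "('a \<times> 'b \<Rightarrow> real) \<Rightarrow> bool" where
  "tangent v \<longleftrightarrow> v \<in> L2 M \<and> (AE z in M. (u z = \<alpha> \<longrightarrow> 0 \<le> v z) \<and> (u z = \<beta> \<longrightarrow> v z \<le> 0))"

definition quot2 :: "real \<Rightarrow> ('a \<times> 'b \<Rightarrow> real) \<Rightarrow> real" where
  "quot2 t v = (\<mu> * (J (\<lambda>z. u z + t * v z) - J u) - t * L2_inner M w v) / (t\<^sup>2 / 2)"

lemma feasible_imp_tangent: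
  assumes "v \<in> L2 M" "feasible t v" "0 < t"
  shows "tangent v"
proof -
  have "AE z in M. (u z = \<alpha> \<longrightarrow> 0 \<le> v z) \<and> (u z = \<beta> \<longrightarrow> v z \<le> 0)"
    using assms(2) unfolding feasible_def
    by eventually_elim (use assms(3) in \<open>auto simp: zero_le_mult_iff mult_le_0_iff\<close>)
  then show ?thesis using assms(1) by (simp add: tangent_def)
qed

lemma feasible_mono:
  assumes "feasible t v" "0 \<le> s" "s \<le> t"
  shows "feasible s v"
proof (cases "t = 0")
  case False
  then have t: "0 < t" using assms by linarith
  define r where "r = s / t"
  have r: "0 \<le> r" "r \<le> 1" "s = r * t" using assms t by (auto simp: r_def)
  show ?thesis
    using assms(1) box unfolding feasible_def
  proof eventually_elim
    case (elim z)
    have eq: "u z + s * v z = (1 - r) * u z + r * (u z + t * v z)"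
      by (simp add: r(3) algebra_simps)
    have "(1 - r) * u z + r * (u z + t * v z) \<le> \<beta>"
      using elim r by (intro convex_bound_le) auto
    moreover have "(1 - r) * (- u z) + r * (- (u z + t * v z)) \<le> - \<alpha>"
      using elim r by (intro convex_bound_le) auto
    ultimately show ?case unfolding eq by linarith
  qed
qed (use assms in simp)

lemma feasible_inner_le:
  assumes v: "v \<in> L2 M" and feas: "feasible s v" and s: "0 < s"
  shows "L2_inner M w v \<le> \<mu> * DJ u v"
proof (rule tendsto_lowerbound)
  show "((\<lambda>h. \<mu> * ((J (\<lambda>z. u z + h * v z) - J u) / h)) \<longlongrightarrow> \<mu> * DJ u v) (at_right 0)"
    by (intro tendsto_mult tendsto_const J_has_dir_deriv u v)
  have "\<forall>\<^sub>F h in at_right 0. h \<in> {0<..<s}" by (rule eventually_at_right_real[OF s])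
  then show "\<forall>\<^sub>F h in at_right 0. L2_inner M w v \<le> \<mu> * ((J (\<lambda>z. u z + h * v z) - J u) / h)"
  proof eventually_elim
    case (elim h)
    then have "\<mu> * J u + L2_inner M w (\<lambda>z. h * v z) \<le> \<mu> * J (\<lambda>z. u z + h * v z)"
      using subgradient[OF L2_add_scale[OF u v, of h]] feasible_mono[OF feas, of h]
      by (simp add: feasible_def)
    then show ?case using elim by (simp add: L2_inner_scale_right field_simps)
  qed
qed simp

section \<open>Truncation of tangent directions and first-order optimality\<close>

definition truncation :: "real \<Rightarrow> ('a \<times> 'b \<Rightarrow> real) \<Rightarrow> ('a \<times> 'b) set" where
  "truncation t v = {z \<in> space M. \<alpha> \<le> u z + t * v z \<and> u z + t * v z \<le> \<beta>}"

lemma truncation_sets[measurable]: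
  assumes [measurable]: "v \<in> borel_measurable M"
  shows "truncation t v \<in> sets M"
  unfolding truncation_def by measurable

text \<open>Where \<open>u\<close> is strictly off a bound, \<open>t k * v\<close> is eventually too
  small to reach it; where \<open>u\<close> sits on a bound, the sign of \<open>v\<close> respects
  that bound for every step size.\<close>

lemma eventually_truncation:
  assumes v: "tangent v" and t: "\<And>k. 0 < t k" "t \<longlonglongrightarrow> 0"
  shows "AE z in M. \<forall>\<^sub>F k in sequentially. z \<in> truncation (t k) v"
  using v[unfolded tangent_def, THEN conjunct2] box AE_space
proof eventually_elim
  case (elim z)
  have lim: "(\<lambda>k. u z + t k * v z) \<longlonglongrightarrow> u z"
    using tendsto_add[OF tendsto_const tendsto_mult_left_zero[OF t(2)]] by simp
  have "\<forall>\<^sub>F k in sequentially. \<alpha> \<le> u z + t k * v z"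
  proof (cases "u z = \<alpha>")
    case True
    then show ?thesis using elim t(1) by (simp add: less_imp_le)
  next
    case False
    then show ?thesis
      using order_tendstoD(1)[OF lim, of \<alpha>] elim by (auto elim: eventually_mono)
  qed
  moreover have "\<forall>\<^sub>F k in sequentially. u z + t k * v z \<le> \<beta>"
  proof (cases "u z = \<beta>")
    case True
    then show ?thesis using elim t(1) by (simp add: mult_le_0_iff less_imp_le)
  next
    case False
    then show ?thesis
      using order_tendstoD(2)[OF lim, of \<beta>] elim by (auto elim: eventually_mono)
  qed
  ultimately show ?case
    by eventually_elim (use elim in \<open>simp add: truncation_def\<close>)
qed

text \<open>A tangent direction need not be feasible for any step size, because \<open>v\<close> may
  be large where \<open>u\<close> is close to a bound. The truncations are feasible and converge
  strongly to \<open>v\<close>.\<close>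

lemma tangent_inner_le:
  assumes v: "tangent v"
  shows "L2_inner M w v \<le> \<mu> * DJ u v"
proof -
  define t where "t k = inverse (real (Suc k))" for k
  have t: "0 < t k" "t \<longlonglongrightarrow> 0" for k
    using LIMSEQ_inverse_real_of_nat by (simp_all add: t_def[abs_def])
  have vL2: "v \<in> L2 M" using v by (simp add: tangent_def)
  have [measurable]: "v \<in> borel_measurable M" using vL2 by (rule L2_measurable)
  define vk where "vk k z = indicator (truncation (t k) v) z * v z" for k z
  have strong: "L2_strong_conv M vk v"
    unfolding vk_def by (intro L2_strong_conv_indicator vL2 eventually_truncation[OF v t]) measurable
  then have vk: "vk k \<in> L2 M" for k by (simp add: L2_strong_conv_def)
  have "feasible (t k) (vk k)" for k
    using box unfolding feasible_def
    by eventually_elim (auto simp: vk_def truncation_def indicator_def)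
  then have le: "L2_inner M w (vk k) \<le> \<mu> * DJ u (vk k)" for k
    by (rule feasible_inner_le[OF vk _ t(1)])
  have "L2_inner M w (vk k) \<le>
      \<mu> * (DJ u v + sqrt (measure X (space X)) * L2_norm M (\<lambda>z. vk k z - v z))" for k
    using le[of k] mult_left_mono[OF DJ_lipschitz[OF u vk vL2, of k], of \<mu>] mu by linarith
  moreover have "(\<lambda>k. L2_inner M w (vk k)) \<longlonglongrightarrow> L2_inner M w v"
    using L2_strong_imp_weak_conv[OF strong] w by (simp add: L2_weak_conv_def)
  moreover have "(\<lambda>k. \<mu> * (DJ u v + sqrt (measure X (space X)) * L2_norm M (\<lambda>z. vk k z - v z)))
      \<longlonglongrightarrow> \<mu> * (DJ u v + sqrt (measure X (space X)) * 0)"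
    using strong by (intro tendsto_intros) (simp add: L2_strong_conv_def)
  ultimately show ?thesis
    by (intro LIMSEQ_le[of "\<lambda>k. L2_inner M w (vk k)"]) auto
qed

lemma quot2_ge:
  assumes v: "tangent v" and t: "0 < t"
  shows "\<mu> * (LINT x|X. squot2 u t v x) \<le> quot2 t v"
proof -
  have vL2: "v \<in> L2 M" using v by (simp add: tangent_def)
  have "\<mu> * (LINT x|X. squot2 u t v x)
      = (\<mu> * (J (\<lambda>z. u z + t * v z) - J u) - t * (\<mu> * DJ u v)) / (t\<^sup>2 / 2)"
    unfolding J_quot2_eq[OF u vL2 less_imp_neq[OF t, symmetric], symmetric]
    by (simp add: algebra_simps diff_divide_distrib)
  also have "\<dots> \<le> quot2 t v"
    unfolding quot2_def using tangent_inner_le[OF v] t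
    by (intro divide_right_mono diff_left_mono mult_left_mono) auto
  finally show ?thesis .
qed

text \<open>On these slices the curvature is bounded by a power of \<open>r\<close>. As
  \<open>r\<close> grows they exhaust all slices on which \<open>u\<close> has nonzero norm.\<close>

definition core :: "real \<Rightarrow> ('a \<times> 'b \<Rightarrow> real) \<Rightarrow> 'a set" where
  "core r v = {x \<in> space X. inverse r \<le> snorm u x \<and> snorm v x \<le> r}"

lemma core_sets[measurable]:
  assumes [measurable]: "v \<in> borel_measurable M"
  shows "core r v \<in> sets X"
  unfolding core_def by measurable

lemma integrable_core_curv:
  assumes v: "v \<in> L2 M" and r: "0 < r"
  shows "integrable X (\<lambda>x. indicator (core r v) x * scurv u v x)"
proof (rule X.integrable_const_bound)
  have [measurable]: "v \<in> borel_measurable M" using v by (rule L2_measurable)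
  show "(\<lambda>x. indicator (core r v) x * scurv u v x) \<in> borel_measurable X" by measurable
  show "AE x in X. norm (indicator (core r v) x * scurv u v x) \<le> r\<^sup>2 / inverse r"
    using slice_L2[OF u] slice_L2[OF v]
  proof eventually_elim
    case (elim x)
    have "scurv u v x \<le> (snorm v x)\<^sup>2 / snorm u x" by (rule L2_norm_curv_le)
    also have "\<dots> \<le> r\<^sup>2 / inverse r" if "x \<in> core r v"
      using that r by (intro frac_le power_mono) (auto simp: core_def)
    finally show ?case
      using L2_norm_curv_nonneg[OF elim] r by (auto simp: indicator_def)
  qed
qed

text \<open>The minorant is claimed only at tangent \<open>vs k\<close>. That suffices for a
  \<open>liminf\<close>: a feasible \<open>vs k\<close> is tangent, and an infeasible one has an
  infinite quotient.\<close>

lemma quot2_core_lower_bound: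
  assumes t: "pos_null_seq t" and weak: "L2_weak_conv M vs v" and r: "0 < r"
  obtains q where "q \<longlonglongrightarrow> \<mu> * (LINT x|X. indicator (core r v) x * scurv u v x)"
    and "\<And>k. tangent (vs k) \<Longrightarrow> q k \<le> quot2 (t k) (vs k)"
proof -
  have vs: "\<And>k. vs k \<in> L2 M" and v: "v \<in> L2 M"
    and inner: "\<And>f. f \<in> L2 M \<Longrightarrow> (\<lambda>k. L2_inner M f (vs k)) \<longlonglongrightarrow> L2_inner M f v"
    using weak by (auto simp: L2_weak_conv_def)
  have tk: "\<And>k. 0 < t k" and t0: "t \<longlonglongrightarrow> 0" using t by (auto simp: pos_null_seq_def)
  have [measurable]: "v \<in> borel_measurable M" using v by (rule L2_measurable)
  obtain B where B: "\<And>k. L2_norm M (vs k) \<le> B" using L2_weak_conv_bounded[OF weak] by blast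
  define A where "A = core r v"
  have [measurable]: "A \<in> sets X" by (simp add: A_def)
  define c1 where "c1 x = indicator A x / snorm u x" for x
  define c2 where "c2 x = indicator A x * (sinner u v x / snorm u x) / (snorm u x)\<^sup>2" for x
  have [measurable]: "c1 \<in> borel_measurable X" "c2 \<in> borel_measurable X"
    unfolding c1_def[abs_def] c2_def[abs_def] by measurable
  \<comment> \<open>On each slice in \<open>A\<close>, \<open>\<phi>\<close> is the part of
    \<open>v\<close> orthogonal to \<open>u\<close>, divided by \<open>snorm u x\<close>. Thus
    \<open>2 * L2_inner M \<phi> y - K\<close> is the linearization at \<open>v\<close> of the
    integrated curvature form over \<open>A\<close>, and a single element of \<open>L2 M\<close>
    tests the weak convergence.\<close>
  define \<phi> where "\<phi> z = c1 (fst z) * v z - c2 (fst z) * u z" for z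
  have a_pos: "0 < snorm u x" and a_inv: "inverse (snorm u x) \<le> r" if "x \<in> A" for x
  proof -
    have a: "inverse r \<le> snorm u x" using that by (simp add: A_def core_def)
    then show "0 < snorm u x" using r by (meson inverse_positive_iff_positive less_le_trans)
    show "inverse (snorm u x) \<le> r" using le_imp_inverse_le[OF a] r by simp
  qed
  have c1_le: "\<bar>c1 x\<bar> \<le> r" for x
    using a_inv[of x] r by (auto simp: c1_def indicator_def divide_inverse)
  define K where "K = (LINT x|X. indicator A x * scurv u v x)"
  \<comment> \<open>The constant of \<open>affine_quotient_perturbation\<close>.\<close>
  define L where "L = r\<^sup>2 * (4 * r + r\<^sup>2)"
  have c2_bound: "AE x in X. \<bar>c2 x\<bar> \<le> r * r\<^sup>2"
    using slice_L2[OF u] slice_L2[OF v]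
  proof eventually_elim
    case (elim x)
    show ?case
    proof (cases "x \<in> A")
      case True
      have "\<bar>sinner u v x / snorm u x\<bar> * (inverse (snorm u x))\<^sup>2 \<le> r * r\<^sup>2"
        using L2_inner_div_norm_le[OF elim] a_inv[OF True] True r
        by (intro mult_mono power_mono) (auto simp: A_def core_def)
      then show ?thesis using True by (simp add: c2_def abs_mult divide_inverse power_inverse)
    qed (use r in \<open>simp add: c2_def\<close>)
  qed
  have "(\<lambda>z. c2 (fst z) * u z) \<in> L2 M"
  proof (rule L2_bound[OF L2_scale[OF u, of "r * r\<^sup>2"]])
    have "AE z in M. \<bar>c2 (fst z)\<bar> \<le> r * r\<^sup>2"
      by (rule AE_fst[OF c2_bound])
    then show "AE z in M. \<bar>c2 (fst z) * u z\<bar> \<le> \<bar>r * r\<^sup>2 * u z\<bar>"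
      by eventually_elim (use r in \<open>auto simp: abs_mult intro!: mult_right_mono\<close>)
  qed measurable
  then have \<phi>: "\<phi> \<in> L2 M"
    unfolding \<phi>_def[abs_def]
    by (intro L2_diff L2_bounded_mult[OF v, where C = r]) (auto simp: c1_le)
  have sinner_\<phi>: "sinner \<phi> y x = indicator A x *
      (sinner v y x - (sinner u y x / snorm u x) * (sinner u v x / snorm u x)) / snorm u x"
    if "slice u x \<in> L2 Y" "slice v x \<in> L2 Y" "slice y x \<in> L2 Y" for x y
  proof -
    have "sinner y \<phi> x = c1 x * sinner y v x - c2 x * sinner y u x"
      using that by (simp add: \<phi>_def L2_inner_diff_right L2_scale L2_inner_scale_right)
    then show ?thesis
      by (simp add: L2_inner_commute[of Y "slice y x" "slice v x"]
          L2_inner_commute[of Y "slice y x" "slice u x"]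
          L2_inner_commute[of Y "slice y x" "slice \<phi> x"] c1_def c2_def diff_divide_distrib right_diff_distrib power2_eq_square mult.commute)
  qed
  define q where "q k = \<mu> * (2 * L2_inner M \<phi> (vs k) - K
      - t k * L * (measure X (space X) + (L2_norm M (vs k))\<^sup>2))" for k
  have inner_K: "L2_inner M \<phi> v = K"
    unfolding K_def integral_sinner[OF \<phi> v, symmetric]
  proof (rule integral_cong_AE)
    show "AE x in X. sinner \<phi> v x = indicator A x * scurv u v x"
      using slice_L2[OF u] slice_L2[OF v]
    proof eventually_elim
      case (elim x)
      show ?case
        unfolding sinner_\<phi>[OF elim elim(2)] L2_inner_self L2_norm_curv_def
        by (simp add: power2_eq_square)
    qed
  qed (use \<phi> in \<open>auto dest: L2_measurable\<close>)
  \<comment> \<open>This is the slicewise perturbation error integrated over \<open>X\<close>; it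
    vanishes because weak convergence bounds the norms of \<open>vs k\<close>.\<close>
  have rem: "(\<lambda>k. t k * L * (measure X (space X) + (L2_norm M (vs k))\<^sup>2)) \<longlonglongrightarrow> 0"
  proof (rule Lim_null_comparison)
    show "(\<lambda>k. t k * (L * (measure X (space X) + B\<^sup>2))) \<longlonglongrightarrow> 0"
      using tendsto_mult_left_zero[OF t0] by simp
    have "t k * L * (measure X (space X) + (L2_norm M (vs k))\<^sup>2)
        \<le> t k * L * (measure X (space X) + B\<^sup>2)" for k
      using tk[of k] r B[of k] by (intro mult_left_mono add_left_mono power_mono) (auto simp: L_def)
    then show "\<forall>\<^sub>F k in sequentially. norm (t k * L * (measure X (space X) + (L2_norm M (vs k))\<^sup>2))
        \<le> t k * (L * (measure X (space X) + B\<^sup>2))"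
      using tk r by (auto simp: abs_mult L_def less_imp_le mult.assoc)
  qed
  have "q \<longlonglongrightarrow> \<mu> * (2 * L2_inner M \<phi> v - K - 0)"
    unfolding q_def by (intro tendsto_intros inner[OF \<phi>] rem)
  then have lim: "q \<longlonglongrightarrow> \<mu> * (LINT x|X. indicator (core r v) x * scurv u v x)"
    by (simp add: inner_K) (simp add: K_def A_def)
  have "q k \<le> quot2 (t k) (vs k)" if tan: "tangent (vs k)" for k
  proof -
    have int: "integrable X (\<lambda>x. 2 * sinner \<phi> (vs k) x - indicator A x * scurv u v x
        - t k * L * (1 + (snorm (vs k) x)\<^sup>2))"
      using integrable_sinner[OF \<phi> vs[of k]] integrable_core_curv[OF v r]
        L2_square_integrable[OF snorm_L2[OF vs[of k]]] by (simp add: A_def)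
    have "2 * L2_inner M \<phi> (vs k) - K - t k * L * (measure X (space X) + (L2_norm M (vs k))\<^sup>2)
        = (LINT x|X. 2 * sinner \<phi> (vs k) x - indicator A x * scurv u v x
        - t k * L * (1 + (snorm (vs k) x)\<^sup>2))"
      using integrable_sinner[OF \<phi> vs[of k]] integrable_core_curv[OF v r]
        L2_square_integrable[OF snorm_L2[OF vs[of k]]]
      by (simp add: A_def K_def integral_sinner[OF \<phi> vs] integral_snorm_power2[OF vs])
    also have "\<dots> \<le> (LINT x|X. squot2 u (t k) (vs k) x)"
    proof (rule integral_mono_AE[OF int integrable_squot2[OF u vs]])
      show "t k \<noteq> 0" using tk[of k] by simp
      show "AE x in X. 2 * sinner \<phi> (vs k) x - indicator A x * scurv u v x
          - t k * L * (1 + (snorm (vs k) x)\<^sup>2) \<le> squot2 u (t k) (vs k) x"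
        using slice_L2[OF u] slice_L2[OF v] slice_L2[OF vs[of k]]
      proof eventually_elim
        case (elim x)
        have L: "0 \<le> t k * L * (1 + (snorm (vs k) x)\<^sup>2)"
          using tk[of k] r by (simp add: L_def)
        show ?case
        proof (cases "x \<in> A")
          case False
          then show ?thesis
            using L L2_norm_quot2_nonneg[OF elim(1,3), of "t k"] tk[of k]
            by (simp add: sinner_\<phi>[OF elim])
        next
          case True
          define a g i b b' where "a = snorm u x" and "g = a * scurv u v x"
            and "i = sinner (vs k) v x" and "b = sinner u v x / a" and "b' = sinner u (vs k) x / a"
          have a: "0 < a" using a_pos[OF True] by (simp add: a_def)
          have "2 * sinner \<phi> (vs k) x - indicator A x * scurv u v x
              = (2 * (i - b' * b) - g) / a"
            using True a
            by (simp add: sinner_\<phi>[OF elim] a_def[symmetric] b_def[symmetric] b'_def[symmetric]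
                i_def L2_inner_commute[of Y "slice v x" "slice (vs k) x"] g_def diff_divide_distrib)
          also have "\<dots> - t k * L * (1 + (snorm (vs k) x)\<^sup>2) \<le>
              (2 * (i - b' * b) - g) / (a + t k * snorm (vs k) x)"
            unfolding L_def
          proof (rule affine_quotient_perturbation)
            show "inverse r \<le> a" "snorm v x \<le> r" using True by (auto simp: A_def core_def a_def)
            show "g \<le> (snorm v x)\<^sup>2"
              using L2_norm_curv_le[of Y "slice u x" "slice v x"] a
              by (simp add: g_def a_def field_simps)
            show "0 \<le> g" using L2_norm_curv_nonneg[OF elim(1,2)] a by (simp add: g_def)
            show "\<bar>i\<bar> \<le> snorm (vs k) x * snorm v x"
              unfolding i_def by (rule L2_Cauchy_Schwarz[OF elim(3,2)])
            show "\<bar>b\<bar> \<le> snorm v x" "\<bar>b'\<bar> \<le> snorm (vs k) x"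
              unfolding b_def b'_def a_def by (intro L2_inner_div_norm_le elim)+
          qed (use r tk in auto)
          also have "\<dots> \<le> a * scurv u (vs k) x / (a + t k * snorm (vs k) x)"
            using L2_norm_curv_ge_affine[OF elim] a tk[of k]
            by (intro divide_right_mono) (auto simp: a_def g_def i_def b_def b'_def add_nonneg_nonneg)
          also have "\<dots> \<le> squot2 u (t k) (vs k) x"
            using L2_norm_quot2_ge[OF elim(1,3) _ tk[of k]] a by (simp add: a_def)
          finally show ?thesis by simp
        qed
      qed
    qed
    finally have "q k \<le> \<mu> * (LINT x|X. squot2 u (t k) (vs k) x)"
      unfolding q_def using mu by (intro mult_left_mono) auto
    also have "\<dots> \<le> quot2 (t k) (vs k)" by (rule quot2_ge[OF tan tk])
    finally show ?thesis .
  qed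
  with lim show thesis by (rule that)
qed

section \<open>Critical directions\<close>

definition critical :: "('a \<times> 'b \<Rightarrow> real) \<Rightarrow> bool" where
  "critical v \<longleftrightarrow> tangent v \<and> L2_inner M w v = \<mu> * DJ u v"

text \<open>A bound \<open>B\<close> on the second-order quotient limits the first-order gap between
  \<open>\<mu> j'\<close> and \<open>w\<close> to \<open>t * B / 2\<close>, so the gap closes in the
  limit. The sign conditions of the tangent cone survive weak limits.\<close>

lemma critical_of_bounded_quotients:
  assumes t: "pos_null_seq t" and weak: "L2_weak_conv M vs v"
    and freq: "\<exists>\<^sub>F k in sequentially. feasible (t k) (vs k) \<and> quot2 (t k) (vs k) \<le> B"
  shows "critical v"
proof -
  have vs: "\<And>k. vs k \<in> L2 M" and v: "v \<in> L2 M"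
    and inner: "\<And>f. f \<in> L2 M \<Longrightarrow> (\<lambda>k. L2_inner M f (vs k)) \<longlonglongrightarrow> L2_inner M f v"
    using weak by (auto simp: L2_weak_conv_def)
  have tk: "\<And>k. 0 < t k" and t0: "t \<longlonglongrightarrow> 0" using t by (auto simp: pos_null_seq_def)
  have freq_tan: "\<exists>\<^sub>F k in sequentially. tangent (vs k)"
    using freq by (rule frequently_elim1) (use feasible_imp_tangent[OF vs _ tk] in blast)
  have "AE z in M. z \<in> {z \<in> space M. u z = \<alpha>} \<longrightarrow> 0 \<le> 1 * v z"
  proof (rule XY.L2_weak_conv_sign[OF weak])
    show "\<exists>\<^sub>F k in sequentially. AE z in M. z \<in> {z \<in> space M. u z = \<alpha>} \<longrightarrow> 0 \<le> 1 * vs k z"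
      using freq_tan by (rule frequently_elim1) (auto simp: tangent_def elim!: eventually_mono)
  qed measurable
  moreover have "AE z in M. z \<in> {z \<in> space M. u z = \<beta>} \<longrightarrow> 0 \<le> (-1) * v z"
  proof (rule XY.L2_weak_conv_sign[OF weak])
    show "\<exists>\<^sub>F k in sequentially. AE z in M. z \<in> {z \<in> space M. u z = \<beta>} \<longrightarrow> 0 \<le> (-1) * vs k z"
      using freq_tan by (rule frequently_elim1) (auto simp: tangent_def elim!: eventually_mono)
  qed measurable
  ultimately have "AE z in M. (u z = \<alpha> \<longrightarrow> 0 \<le> v z) \<and> (u z = \<beta> \<longrightarrow> v z \<le> 0)"
    using AE_space by eventually_elim simp
  then have tan: "tangent v" using v by (simp add: tangent_def)
  \<comment> \<open>\<open>DJ u\<close> is not weakly continuous. The linear functional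
    \<open>?p\<close> lies below it everywhere and agrees with it at the weak limit
    \<open>v\<close>.\<close>
  let ?p = "subgrad u v"
  have p: "?p \<in> L2 M" by (rule subgrad_L2[OF u v])
  have "\<mu> * L2_inner M ?p v - L2_inner M w v \<le> 0 * (B / 2)"
  proof (rule frequently_le_imp_lim_le)
    show "(\<lambda>k. \<mu> * L2_inner M ?p (vs k) - L2_inner M w (vs k))
        \<longlonglongrightarrow> \<mu> * L2_inner M ?p v - L2_inner M w v"
      by (intro tendsto_intros inner p w)
    show "(\<lambda>k. t k * (B / 2)) \<longlonglongrightarrow> 0 * (B / 2)" by (intro tendsto_intros t0)
    show "\<exists>\<^sub>F k in sequentially. \<mu> * L2_inner M ?p (vs k) - L2_inner M w (vs k) \<le> t k * (B / 2)"
      using freq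
    proof (rule frequently_elim1, elim conjE)
      fix k assume "quot2 (t k) (vs k) \<le> B"
      then have "\<mu> * (J (\<lambda>z. u z + t k * vs k z) - J u) - t k * L2_inner M w (vs k) \<le> B * ((t k)\<^sup>2 / 2)"
        using tk[of k] by (simp add: quot2_def divide_le_eq)
      moreover have "t k * L2_inner M ?p (vs k) \<le> J (\<lambda>z. u z + t k * vs k z) - J u"
        using J_ge_tangent[OF u vs tk, of k k]
          mult_left_mono[OF inner_subgrad_le[OF u v vs, of k] less_imp_le[OF tk[of k]]] by linarith
      then have "\<mu> * (t k * L2_inner M ?p (vs k)) \<le> \<mu> * (J (\<lambda>z. u z + t k * vs k z) - J u)"
        using mu by (intro mult_left_mono) auto
      ultimately have "t k * (\<mu> * L2_inner M ?p (vs k) - L2_inner M w (vs k)) \<le> t k * (t k * (B / 2))"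
        by (simp add: algebra_simps power2_eq_square)
      then show "\<mu> * L2_inner M ?p (vs k) - L2_inner M w (vs k) \<le> t k * (B / 2)"
        using tk[of k] by simp
    qed
  qed
  then have "\<mu> * DJ u v \<le> L2_inner M w v" by (simp add: inner_subgrad_self[OF u v])
  then show ?thesis
    using tan tangent_inner_le[OF tan] by (simp add: critical_def)
qed

lemma tangent_indicator:
  assumes "tangent v" "E \<in> sets M"
  shows "tangent (\<lambda>z. indicator E z * v z)" "tangent (\<lambda>z. v z - indicator E z * v z)"
proof -
  have v: "v \<in> L2 M" and ae: "AE z in M. (u z = \<alpha> \<longrightarrow> 0 \<le> v z) \<and> (u z = \<beta> \<longrightarrow> v z \<le> 0)"
    using assms by (auto simp: tangent_def)
  note f = L2_indicator_mult[OF v assms(2)]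
  show "tangent (\<lambda>z. indicator E z * v z)"
    unfolding tangent_def by (intro conjI f) (rule eventually_mono[OF ae], auto simp: indicator_def)
  show "tangent (\<lambda>z. v z - indicator E z * v z)"
    unfolding tangent_def by (intro conjI L2_diff[OF v f]) (rule eventually_mono[OF ae], auto simp: indicator_def)
qed

text \<open>Both pieces of a critical direction satisfy the tangent inequality, whereas their
  sum satisfies it with equality.\<close>

lemma critical_indicator_ge:
  assumes v: "critical v" and E: "E \<in> sets M"
  shows "\<mu> * (DJ u v - DJ u (\<lambda>z. v z - indicator E z * v z)) \<le> L2_inner M w (\<lambda>z. indicator E z * v z)"
proof -
  have tan: "tangent v" and eq: "L2_inner M w v = \<mu> * DJ u v" using v by (auto simp: critical_def)
  then have vL2: "v \<in> L2 M" by (simp add: tangent_def)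
  show ?thesis
    using tangent_inner_le[OF tangent_indicator(2)[OF tan E]] eq
    by (simp add: L2_inner_diff_right[OF w vL2 L2_indicator_mult[OF vL2 E]] right_diff_distrib)
qed

text \<open>The tangent inequalities of the two pieces can only add up to an equality if each is
  one, provided \<open>DJ u\<close> is additive on the splitting. On slices with nonzero
  \<open>u\<close> the derivative is linear; on the others it is the norm, which is additive here
  because \<open>full\<close> makes one piece vanish on the whole slice.\<close>

lemma critical_indicator_eq:
  assumes v: "critical v" and E: "E \<in> sets M"
    and full: "\<And>x. x \<in> space X \<Longrightarrow> snorm u x = 0 \<Longrightarrow>
      (\<forall>y\<in>space Y. (x, y) \<in> E) \<or> (\<forall>y\<in>space Y. (x, y) \<notin> E)"
  shows "L2_inner M w (\<lambda>z. indicator E z * v z) = \<mu> * DJ u (\<lambda>z. indicator E z * v z)"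
proof -
  have tan: "tangent v" using v by (auto simp: critical_def)
  then have vL2: "v \<in> L2 M" by (simp add: tangent_def)
  define f where "f z = indicator E z * v z" for z
  have f: "f \<in> L2 M" unfolding f_def[abs_def] by (rule L2_indicator_mult[OF vL2 E])
  note g = L2_diff[OF vL2 f]
  have "DJ u v = (LINT x|X. sderiv u f x + sderiv u (\<lambda>z. v z - f z) x)"
    unfolding DJ_def
  proof (rule integral_cong_AE)
    show "AE x in X. sderiv u v x = sderiv u f x + sderiv u (\<lambda>z. v z - f z) x"
      using slice_L2[OF u] slice_L2[OF vL2] slice_L2[OF f] AE_space
    proof eventually_elim
      case (elim x)
      show ?case
      proof (cases "snorm u x = 0")
        case False
        then show ?thesis
          by (simp add: L2_norm_deriv_def L2_inner_diff_right[OF elim(1-3)] diff_divide_distrib)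
      next
        case True
        consider "\<forall>y\<in>space Y. f (x, y) = v (x, y)" | "\<forall>y\<in>space Y. f (x, y) = 0"
          using full[OF elim(4) True] by (auto simp: f_def)
        then show ?thesis
        proof cases
          case 1
          then have "snorm f x = snorm v x" "snorm (\<lambda>z. v z - f z) x = 0"
            by (auto simp: L2_norm_def intro!: Bochner_Integration.integral_cong cong: Bochner_Integration.integral_cong)
          then show ?thesis using True by (simp add: L2_norm_deriv_def)
        next
          case 2
          then have "snorm f x = 0" "snorm (\<lambda>z. v z - f z) x = snorm v x"
            by (auto simp: L2_norm_def cong: Bochner_Integration.integral_cong)
          then show ?thesis using True by (simp add: L2_norm_deriv_def)
        qed
      qed
    qed
  qed (use vL2 f g in \<open>auto dest!: L2_measurable\<close>)
  also have "\<dots> = DJ u f + DJ u (\<lambda>z. v z - f z)"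
    unfolding DJ_def using integrable_sderiv[OF u f] integrable_sderiv[OF u g] by simp
  finally have "\<mu> * DJ u f \<le> L2_inner M w f"
    using critical_indicator_ge[OF v E] by (simp add: f_def[abs_def])
  moreover have "L2_inner M w f \<le> \<mu> * DJ u f"
    using tangent_inner_le[OF tangent_indicator(1)[OF tan E]] by (simp add: f_def[abs_def])
  ultimately show ?thesis by (simp add: f_def[abs_def])
qed

text \<open>Cutting off the set where \<open>v\<close> exceeds the bound gains, by the strict convexity of the
  Hilbert norm, more than the bounded multiplier \<open>w\<close> can lose.\<close>

lemma critical_bound_on_zero_slices:
  assumes v: "critical v"
  shows "AE z in M. snorm u (fst z) = 0 \<longrightarrow> \<bar>v z\<bar> \<le> 4 * \<bar>C\<bar> / \<mu> * snorm v (fst z)"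
proof -
  have tan: "tangent v" using v by (auto simp: critical_def)
  then have vL2: "v \<in> L2 M" by (simp add: tangent_def)
  then have [measurable]: "v \<in> borel_measurable M" by (rule L2_measurable)
  define E where
    "E = {z \<in> space M. snorm u (fst z) = 0 \<and> 4 * \<bar>C\<bar> / \<mu> * snorm v (fst z) < \<bar>v z\<bar>}"
  have E[measurable]: "E \<in> sets M" unfolding E_def by measurable
  define f where "f z = indicator E z * v z" for z
  have f: "f \<in> L2 M" unfolding f_def[abs_def] by (rule L2_indicator_mult[OF vL2 E])
  have [measurable]: "f \<in> borel_measurable M" using f by (rule L2_measurable)
  note g = L2_diff[OF vL2 f]
  \<comment> \<open>On a zero slice \<open>f\<close> and \<open>v - f\<close> have disjoint
    supports, so Pythagoras shows that removing \<open>f\<close> lowers the norm by at least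
    \<open>\<rho> x / 2\<close>. On \<open>E\<close> the threshold gives
    \<open>\<bar>w\<bar> \<le> \<mu> / (4 * snorm v x) * \<bar>v\<bar>\<close>, so \<open>w\<close>
    pays at most \<open>\<mu> * \<rho> x / 4\<close>. Both together force \<open>\<rho> = 0\<close>;
    any factor above \<open>2\<close> in place of \<open>4\<close> would do.\<close>
  define \<rho> where "\<rho> x = (snorm f x)\<^sup>2 / snorm v x" for x
  have [measurable]: "\<rho> \<in> borel_measurable X" unfolding \<rho>_def[abs_def] by measurable
  have snorm_f_le: "AE x in X. snorm f x \<le> snorm v x"
    using slice_L2[OF vL2] slice_L2[OF f]
  proof eventually_elim
    case (elim x)
    have "(snorm f x)\<^sup>2 \<le> (snorm v x)\<^sup>2"
      unfolding L2_norm_power2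
      by (intro integral_mono L2_square_integrable elim) (auto simp: f_def indicator_def)
    then show ?case by (rule power2_le_imp_le) simp
  qed
  have \<rho>_bounds: "AE x in X. 0 \<le> \<rho> x \<and> \<rho> x \<le> snorm v x"
    using snorm_f_le
  proof eventually_elim
    case (elim x)
    have "(snorm f x)\<^sup>2 \<le> (snorm v x)\<^sup>2" using elim by (intro power_mono) auto
    then show ?case by (cases "snorm v x = 0") (auto simp: \<rho>_def divide_le_eq power2_eq_square less_le)
  qed
  have \<rho>_int: "integrable X \<rho>"
    by (rule Bochner_Integration.integrable_bound[OF integrable_snorm[OF vL2]])
       (use \<rho>_bounds in auto)
  have "(LINT x|X. \<mu> * (\<rho> x / 2)) \<le> (LINT x|X. \<mu> * (sderiv u v x - sderiv u (\<lambda>z. v z - f z) x))"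
  proof (rule integral_mono_AE)
    show "integrable X (\<lambda>x. \<mu> * (sderiv u v x - sderiv u (\<lambda>z. v z - f z) x))"
      using integrable_sderiv[OF u vL2] integrable_sderiv[OF u g] by simp
    show "AE x in X. \<mu> * (\<rho> x / 2) \<le> \<mu> * (sderiv u v x - sderiv u (\<lambda>z. v z - f z) x)"
      using slice_L2[OF vL2] slice_L2[OF f] slice_L2[OF g]
    proof eventually_elim
      case (elim x)
      have "\<rho> x / 2 \<le> sderiv u v x - sderiv u (\<lambda>z. v z - f z) x"
      proof (cases "snorm u x = 0")
        case False
        then have "f (x, y) = 0" for y by (simp add: f_def E_def)
        then show ?thesis by (simp add: \<rho>_def)
      next
        case True
        define n m h where "n = snorm v x" and "m = snorm f x" and "h = snorm (\<lambda>z. v z - f z) x"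
        have "L2_inner Y (slice f x) (slice (\<lambda>z. v z - f z) x) = L2_inner Y (\<lambda>y. 0) (slice v x)"
          unfolding L2_inner_def by (intro Bochner_Integration.integral_cong) (auto simp: f_def indicator_def)
        then have "n\<^sup>2 = m\<^sup>2 + h\<^sup>2"
          using L2_norm_add_scale_power2[OF elim(2,3), of 1] by (simp add: n_def m_def h_def)
        moreover have nonneg: "0 \<le> n" "0 \<le> m" "0 \<le> h" by (auto simp: n_def m_def h_def)
        ultimately have "h \<le> n" by (intro power2_le_imp_le[of h n]) auto
        have "m\<^sup>2 / n / 2 \<le> n - h"
        proof (cases "n = 0")
          case False
          have "m\<^sup>2 = (n - h) * (n + h)" using \<open>n\<^sup>2 = m\<^sup>2 + h\<^sup>2\<close>
            by (simp add: power2_eq_square algebra_simps)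
          also have "\<dots> \<le> (n - h) * (2 * n)"
            using \<open>h \<le> n\<close> by (intro mult_left_mono) auto
          finally show ?thesis using False nonneg by (simp add: field_simps)
        qed (use \<open>h \<le> n\<close> in simp)
        then show ?thesis using True by (simp add: \<rho>_def L2_norm_deriv_def n_def m_def h_def)
      qed
      then show ?case using mu by (intro mult_left_mono) auto
    qed
  qed (use \<rho>_int in simp)
  also have "\<dots> = \<mu> * (DJ u v - DJ u (\<lambda>z. v z - f z))"
    unfolding DJ_def using integrable_sderiv[OF u vL2] integrable_sderiv[OF u g] by simp
  also have "\<dots> \<le> L2_inner M w f"
    using critical_indicator_ge[OF v E] by (simp add: f_def[abs_def])
  also have "\<dots> \<le> (LINT x|X. \<mu> * (\<rho> x / 4))"
    unfolding integral_sinner[OF w f, symmetric]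
  proof (rule integral_mono_AE[OF integrable_sinner[OF w f]])
    show "AE x in X. sinner w f x \<le> \<mu> * (\<rho> x / 4)"
      using slice_L2[OF w] slice_L2[OF f] AE_pair[OF w_le] snorm_f_le AE_space
    proof eventually_elim
      case (elim x)
      show ?case
      proof (cases "snorm v x = 0")
        case True
        then have "snorm f x = 0" using elim(4) by (metis L2_norm_nonneg order.antisym)
        then have "sinner w f x = 0"
          using L2_inner_norm_zero[OF elim(2,1)] by (simp add: L2_inner_commute[of Y "slice w x" "slice f x"])
        then show ?thesis using True by (simp add: \<rho>_def)
      next
        case False
        define n where "n = snorm v x"
        have n: "0 < n" using False L2_norm_nonneg[of Y "slice v x"] unfolding n_def by linarith
        have "sinner w f x \<le> (LINT y|Y. \<mu> / (4 * n) * (f (x, y))\<^sup>2)"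
          unfolding L2_inner_def
        proof (rule integral_mono_AE)
          show "integrable Y (\<lambda>y. w (x, y) * f (x, y))" by (rule L2_mult_integrable[OF elim(1,2)])
          show "integrable Y (\<lambda>y. \<mu> / (4 * n) * (f (x, y))\<^sup>2)"
            using L2_square_integrable[OF elim(2)] by simp
          show "AE y in Y. w (x, y) * f (x, y) \<le> \<mu> / (4 * n) * (f (x, y))\<^sup>2"
            using elim(3)
          proof eventually_elim
            case (elim y)
            show ?case
            proof (cases "(x, y) \<in> E")
              case True
              then have "4 * \<bar>C\<bar> / \<mu> * n < \<bar>v (x, y)\<bar>" by (simp add: E_def n_def)
              then have C: "\<bar>C\<bar> \<le> \<mu> / (4 * n) * \<bar>v (x, y)\<bar>"
                using n mu by (simp add: field_simps)
              have "w (x, y) * v (x, y) \<le> \<bar>w (x, y)\<bar> * \<bar>v (x, y)\<bar>"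
                by (simp flip: abs_mult)
              also have "\<dots> \<le> (\<mu> / (4 * n) * \<bar>v (x, y)\<bar>) * \<bar>v (x, y)\<bar>"
                using elim C by (intro mult_right_mono) auto
              also have "\<dots> = \<mu> / (4 * n) * (v (x, y))\<^sup>2"
                by (simp add: power2_eq_square)
              finally show ?thesis using True by (simp add: f_def)
            qed (simp add: f_def)
          qed
        qed
        also have "\<dots> = \<mu> * (\<rho> x / 4)"
          using n by (simp add: \<rho>_def L2_norm_power2 n_def)
        finally show ?thesis .
      qed
    qed
  qed (use \<rho>_int in simp)
  finally have "(LINT x|X. \<rho> x) \<le> 0" using mu by (simp add: field_simps)
  moreover have "0 \<le> (LINT x|X. \<rho> x)" using \<rho>_bounds by (intro integral_nonneg_AE) auto
  ultimately have "(LINT x|X. \<rho> x) = 0" by simp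
  then have "AE x in X. \<rho> x = 0"
    using integral_nonneg_eq_0_iff_AE[OF \<rho>_int] \<rho>_bounds by auto
  then have "AE x in X. (snorm f x)\<^sup>2 = 0"
    using snorm_f_le
  proof eventually_elim
    case (elim x)
    \<comment> \<open>For \<open>snorm v x = 0\<close> the value \<open>\<rho> x = 0\<close> is only
      the convention for division by zero, so this case needs the comparison of the norms.\<close>
    then have "snorm v x = 0 \<Longrightarrow> snorm f x = 0"
      by (metis L2_norm_nonneg order.antisym)
    then show ?case using elim(1) by (auto simp: \<rho>_def)
  qed
  then have "(L2_norm M f)\<^sup>2 = 0"
    unfolding integral_snorm_power2[OF f, symmetric] by (subst integral_cong_AE[where g = "\<lambda>_. 0"]) auto
  then have "AE z in M. f z = 0" using L2_norm_zero_imp_AE[OF f] by simp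
  with AE_space show ?thesis
  proof eventually_elim
    case (elim z)
    have "z \<notin> E"
    proof
      assume "z \<in> E"
      then have "v z = 0" using elim by (simp add: f_def)
      with \<open>z \<in> E\<close> have "4 * \<bar>C\<bar> / \<mu> * snorm v (fst z) < 0" by (simp add: E_def)
      moreover have "0 \<le> 4 * \<bar>C\<bar> / \<mu> * snorm v (fst z)" using mu by simp
      ultimately show False by simp
    qed
    then show ?case using elim by (auto simp: E_def)
  qed
qed

section \<open>Recovery sequences\<close>

text \<open>The cap on \<open>snorm v\<close> turns the slicewise bound on a critical
  \<open>v\<close> into one constant, so that one step size serves all these slices.\<close>

definition zero_core :: "real \<Rightarrow> ('a \<times> 'b \<Rightarrow> real) \<Rightarrow> 'a set" where
  "zero_core r v = {x \<in> space X. snorm u x = 0 \<and> snorm v x \<le> r}"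

lemma zero_core_sets[measurable]:
  assumes [measurable]: "v \<in> borel_measurable M"
  shows "zero_core r v \<in> sets X"
  unfolding zero_core_def by measurable

text \<open>Zero slices are kept whole, which preserves the critical equality; pointwise truncation
  is confined to slices where the derivative of the norm is linear.\<close>

definition cut_set :: "real \<Rightarrow> real \<Rightarrow> ('a \<times> 'b \<Rightarrow> real) \<Rightarrow> ('a \<times> 'b) set" where
  "cut_set r t v = {z \<in> space M. fst z \<in> zero_core r v \<or> fst z \<in> core r v \<and> z \<in> truncation t v}"

lemma cut_set_sets[measurable]:
  assumes [measurable]: "v \<in> borel_measurable M"
  shows "cut_set r t v \<in> sets M"
  unfolding cut_set_def by measurable

abbreviation cut :: "real \<Rightarrow> real \<Rightarrow> ('a \<times> 'b \<Rightarrow> real) \<Rightarrow> 'a \<times> 'b \<Rightarrow> real" where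
  "cut r t v \<equiv> \<lambda>z. indicator (cut_set r t v) z * v z"

lemma core_snorm_pos:
  assumes "0 < r" "x \<in> core r v"
  shows "0 < snorm u x"
  using assms by (auto simp: core_def intro: less_le_trans[of 0 "inverse r"])

text \<open>Outside the zero slices the truncation enforces the box. On a zero slice
  \<open>u = 0\<close>, hence \<open>\<alpha> \<le> 0 \<le> \<beta>\<close>: a bound different from
  \<open>0\<close> is eventually beyond the reach of \<open>t k * R\<close>, and a bound equal to
  \<open>0\<close> is active, so the sign of the tangent direction \<open>v\<close> takes care of
  it.\<close>

lemma eventually_feasible_cut:
  assumes v: "critical v" and t: "\<And>k. 0 < t k" "t \<longlonglongrightarrow> 0"
  shows "\<forall>\<^sub>F k in sequentially. feasible (t k) (cut r (t k) v)"
proof -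
  have tan: "AE z in M. (u z = \<alpha> \<longrightarrow> 0 \<le> v z) \<and> (u z = \<beta> \<longrightarrow> v z \<le> 0)"
    using v by (simp add: critical_def tangent_def)
  define R where "R = 4 * \<bar>C\<bar> / \<mu> * r"
  have u0: "AE z in M. snorm u (fst z) = 0 \<longrightarrow> u z = 0"
  proof -
    have "AE x in X. AE y in Y. snorm u x = 0 \<longrightarrow> u (x, y) = 0"
      using slice_L2[OF u]
    proof eventually_elim
      case (elim x)
      show ?case using L2_norm_zero_imp_AE[OF elim] by (cases "snorm u x = 0") auto
    qed
    then show ?thesis by (intro AE_pair_measure) auto
  qed
  have lim: "(\<lambda>k. t k * R) \<longlonglongrightarrow> 0" using tendsto_mult_left_zero[OF t(2)] by simp
  have "\<forall>\<^sub>F k in sequentially. \<alpha> < 0 \<longrightarrow> t k * R \<le> - \<alpha>"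
    using order_tendstoD(2)[OF lim, of "- \<alpha>"] by (cases "\<alpha> < 0") (auto elim: eventually_mono)
  moreover have "\<forall>\<^sub>F k in sequentially. 0 < \<beta> \<longrightarrow> t k * R \<le> \<beta>"
    using order_tendstoD(2)[OF lim, of \<beta>] by (cases "0 < \<beta>") (auto elim: eventually_mono)
  ultimately show ?thesis
  proof eventually_elim
    case (elim k)
    note small = elim
    show ?case
      unfolding feasible_def using box tan u0 critical_bound_on_zero_slices[OF v]
    proof eventually_elim
      case (elim z)
      show ?case
      proof (cases "z \<in> cut_set r (t k) v \<and> fst z \<in> zero_core r v")
        case False
        then have "z \<notin> cut_set r (t k) v \<or> z \<in> truncation (t k) v" by (auto simp: cut_set_def)
        then show ?thesis
          using elim(1) by (auto simp: truncation_def indicator_def)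
      next
        case True
        then have z: "snorm u (fst z) = 0" "snorm v (fst z) \<le> r" by (auto simp: zero_core_def)
        then have u: "u z = 0" using elim by simp
        have "\<bar>v z\<bar> \<le> 4 * \<bar>C\<bar> / \<mu> * snorm v (fst z)" using elim z by simp
        also have "\<dots> \<le> R" unfolding R_def using z mu by (intro mult_left_mono) auto
        finally have "\<bar>v z\<bar> \<le> R" .
        then have "\<bar>t k * v z\<bar> \<le> t k * R" using t(1)[of k] by (simp add: abs_mult)
        then have tv: "t k * v z \<le> t k * R" "- (t k * R) \<le> t k * v z" by (auto simp: abs_le_iff)
        have "\<alpha> \<le> t k * v z"
        proof (cases "\<alpha> < 0")
          case True
          then show ?thesis using small tv by simp
        next
          case False
          then have "\<alpha> = 0" using elim(1) u by simp
          then show ?thesis using elim(2) u t(1)[of k] by simp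
        qed
        moreover have "t k * v z \<le> \<beta>"
        proof (cases "0 < \<beta>")
          case True
          then show ?thesis using small tv by simp
        next
          case False
          then have "\<beta> = 0" using elim(1) u by simp
          then show ?thesis using elim(2) u t(1)[of k] by (simp add: mult_le_0_iff)
        qed
        ultimately show ?thesis using True u by simp
      qed
    qed
  qed
qed

text \<open>In general the two sides differ by \<open>2 / t\<close> times the gap between
  \<open>\<mu> * DJ u\<close> and the inner product with \<open>w\<close>. The cut direction
  inherits equality from \<open>v\<close>, so nothing is left to blow up.\<close>

lemma quot2_cut_eq:
  assumes v: "critical v" and t: "t \<noteq> 0" and r: "0 < r"
  shows "quot2 t (cut r s v) = \<mu> * (LINT x|X. squot2 u t (cut r s v) x)"
proof -
  have vL2: "v \<in> L2 M" using v by (simp add: critical_def tangent_def)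
  then have [measurable]: "v \<in> borel_measurable M" by (rule L2_measurable)
  have y: "cut r s v \<in> L2 M" by (rule L2_indicator_mult[OF vL2]) measurable
  have "L2_inner M w (cut r s v) = \<mu> * DJ u (cut r s v)"
  proof (rule critical_indicator_eq[OF v])
    fix x assume "x \<in> space X" "snorm u x = 0"
    then show "(\<forall>y\<in>space Y. (x, y) \<in> cut_set r s v) \<or> (\<forall>y\<in>space Y. (x, y) \<notin> cut_set r s v)"
      using core_snorm_pos[OF r, of x v] by (auto simp: cut_set_def space_pair_measure)
  qed measurable
  then show ?thesis
    unfolding J_quot2_eq[OF u y t, symmetric] by (simp add: quot2_def algebra_simps diff_divide_distrib)
qed

text \<open>Off the core the quotient is \<open>0\<close>: either \<open>u\<close> vanishes on the
  slice, where the norm is positively homogeneous, or the cut direction does. On the core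
  \<open>small\<close> yields the constant majorant of \<open>L2_norm_quot2_le\<close>, and each
  truncated slice converges strongly to that of \<open>v\<close>.\<close>

lemma integral_squot2_cut_tendsto_small:
  assumes v: "tangent v" and t: "\<And>k. 0 < t k" "t \<longlonglongrightarrow> 0" and r: "0 < r"
    and small: "\<And>k. t k * r \<le> inverse r / 2"
  shows "(\<lambda>k. LINT x|X. squot2 u (t k) (cut r (t k) v) x)
    \<longlonglongrightarrow> (LINT x|X. indicator (core r v) x * scurv u v x)"
proof -
  have vL2: "v \<in> L2 M" using v by (simp add: tangent_def)
  then have [measurable]: "v \<in> borel_measurable M" by (rule L2_measurable)
  define y where "y k = cut r (t k) v" for k
  have y: "y k \<in> L2 M" for k
    unfolding y_def by (rule L2_indicator_mult[OF vL2]) measurable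
  have [measurable]: "y k \<in> borel_measurable M" for k by (rule L2_measurable[OF y])
  have snorm_y: "AE x in X. snorm (y k) x \<le> snorm v x" for k
    using slice_L2[OF vL2] slice_L2[OF y[of k]]
  proof eventually_elim
    case (elim x)
    have "(snorm (y k) x)\<^sup>2 \<le> (snorm v x)\<^sup>2"
      unfolding L2_norm_power2
      by (intro integral_mono L2_square_integrable elim) (auto simp: y_def indicator_def)
    then show ?case by (rule power2_le_imp_le) simp
  qed
  have outside: "squot2 u (t k) (y k) x = 0"
    if L2: "slice u x \<in> L2 Y" "slice (y k) x \<in> L2 Y" and "x \<notin> core r v" for k x
  proof (cases "snorm u x = 0")
    case True
    then show ?thesis using L2_norm_quot2_zero[OF L2] t(1)[of k] by simp
  next
    case False
    with \<open>x \<notin> core r v\<close> have "y k (x, s) = 0" for s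
      by (auto simp: y_def cut_set_def zero_core_def)
    then show ?thesis by (simp add: L2_norm_quot2_def L2_norm_deriv_def)
  qed
  have all_slices: "AE x in X. \<forall>k. slice (y k) x \<in> L2 Y"
    using slice_L2[OF y] by (simp add: AE_all_countable)
  have "(\<lambda>k. LINT x|X. squot2 u (t k) (y k) x)
    \<longlonglongrightarrow> (LINT x|X. indicator (core r v) x * scurv u v x)"
  proof (rule integral_dominated_convergence[where w = "\<lambda>_. 4 * r\<^sup>2 / inverse r"])
    show "AE x in X. (\<lambda>k. squot2 u (t k) (y k) x) \<longlonglongrightarrow> indicator (core r v) x * scurv u v x"
      using slice_L2[OF u] slice_L2[OF vL2] all_slices
        AE_pair[OF eventually_truncation[OF v t]] AE_space
    proof eventually_elim
      case (elim x)
      show ?case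
      proof (cases "x \<in> core r v")
        case False
        then show ?thesis using outside elim by simp
      next
        case True
        define E where "E k = {s \<in> space Y. (x, s) \<in> cut_set r (t k) v}" for k
        have E: "E k \<in> sets Y" for k
          unfolding E_def using elim(5) by measurable
        have "AE s in Y. \<forall>\<^sub>F k in sequentially. s \<in> E k"
          using elim(4) AE_space
        proof eventually_elim
          case (elim s)
          from elim(1) show ?case
            by eventually_elim
              (use True elim \<open>x \<in> space X\<close> in \<open>auto simp: E_def cut_set_def space_pair_measure\<close>)
        qed
        from L2_strong_conv_indicator[OF elim(2) E this]
        have strong: "L2_strong_conv Y (\<lambda>k s. indicator (E k) s * v (x, s)) (slice v x)" .
        have eq: "L2_norm Y (\<lambda>s. indicator (E k) s * v (x, s)) = snorm (y k) x"
          "L2_inner Y f (\<lambda>s. indicator (E k) s * v (x, s)) = L2_inner Y f (slice (y k) x)" for k f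
          unfolding L2_norm_def L2_inner_def y_def
          by (auto simp: E_def indicator_def intro!: arg_cong[of _ _ sqrt] Bochner_Integration.integral_cong)
        have "(\<lambda>k. squot2 u (t k) (y k) x) \<longlonglongrightarrow> scurv u v x"
        proof (rule L2_norm_quot2_tendsto[OF elim(1) _ t])
          show "slice (y k) x \<in> L2 Y" for k using elim(3) by blast
          show "(\<lambda>k. snorm (y k) x) \<longlonglongrightarrow> snorm v x"
            using L2_strong_conv_norm[OF strong] by (simp add: eq)
          show "(\<lambda>k. sinner u (y k) x) \<longlonglongrightarrow> sinner u v x"
            using L2_strong_imp_weak_conv[OF strong] elim(1) by (simp add: L2_weak_conv_def eq)
        qed
        then show ?thesis using True by simp
      qed
    qed
    show "AE x in X. norm (squot2 u (t k) (y k) x) \<le> 4 * r\<^sup>2 / inverse r" for k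
      using slice_L2[OF u] slice_L2[OF y[of k]] snorm_y[of k]
    proof eventually_elim
      case (elim x)
      show ?case
      proof (cases "x \<in> core r v")
        case False
        then show ?thesis using outside[OF elim(1,2)] r by simp
      next
        case True
        then have le: "snorm (y k) x \<le> r" "inverse r \<le> snorm u x"
          using elim(3) by (auto simp: core_def)
        have "t k * snorm (y k) x \<le> t k * r" using le t(1)[of k] by (intro mult_left_mono) auto
        also have "\<dots> \<le> snorm u x / 2" using small[of k] le by simp
        finally have "squot2 u (t k) (y k) x \<le> 4 * (snorm (y k) x)\<^sup>2 / snorm u x"
          by (rule L2_norm_quot2_le[OF elim(1,2) t(1)])
        also have "\<dots> \<le> 4 * r\<^sup>2 / inverse r"
          using le r by (intro frac_le mult_left_mono power_mono) auto
        finally show ?thesis using L2_norm_quot2_nonneg[OF elim(1,2)] t(1)[of k] by simp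
      qed
    qed
  qed (use u in \<open>auto dest: L2_measurable\<close>)
  then show ?thesis by (simp add: y_def)
qed

lemma integral_squot2_cut_tendsto:
  assumes v: "tangent v" and t: "\<And>k. 0 < t k" "t \<longlonglongrightarrow> 0" and r: "0 < r"
  shows "(\<lambda>k. LINT x|X. squot2 u (t k) (cut r (t k) v) x)
    \<longlonglongrightarrow> (LINT x|X. indicator (core r v) x * scurv u v x)"
proof -
  have "(\<lambda>k. t k * r) \<longlonglongrightarrow> 0" using tendsto_mult_left_zero[OF t(2)] by simp
  from order_tendstoD(2)[OF this, of "inverse r / 2"] r
  obtain K where K: "\<And>k. K \<le> k \<Longrightarrow> t k * r < inverse r / 2"
    by (auto simp: eventually_sequentially)
  show ?thesis
    by (rule LIMSEQ_offset[where k = K], rule integral_squot2_cut_tendsto_small)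
       (use v t r K in \<open>auto intro: LIMSEQ_ignore_initial_segment less_imp_le\<close>)
qed

text \<open>Cutting in space at level \<open>n\<close> keeps the curvature integrable, cutting at the scale \<open>t\<close> makes
  the direction feasible; a diagonal sequence removes both cuts.\<close>

lemma critical_recovery_sequence:
  assumes v: "critical v" and t: "pos_null_seq t"
    and K: "(\<lambda>n. LINT x|X. indicator (core (real (Suc n)) v) x * scurv u v x) \<longlonglongrightarrow> K"
  obtains vs where "L2_strong_conv M vs v" "\<forall>\<^sub>F k in sequentially. feasible (t k) (vs k)"
    "(\<lambda>k. quot2 (t k) (vs k)) \<longlonglongrightarrow> \<mu> * K"
proof -
  have tan: "tangent v" using v by (simp add: critical_def)
  then have vL2: "v \<in> L2 M" by (simp add: tangent_def)
  then have [measurable]: "v \<in> borel_measurable M" by (rule L2_measurable)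
  have tk: "\<And>k. 0 < t k" and t0: "t \<longlonglongrightarrow> 0" using t by (auto simp: pos_null_seq_def)
  define y where "y n k = cut (real (Suc n)) (t k) v" for n k
  have y: "y n k \<in> L2 M" for n k
    unfolding y_def by (rule L2_indicator_mult[OF vL2]) measurable
  define Kn where "Kn n = (LINT x|X. indicator (core (real (Suc n)) v) x * scurv u v x)" for n
  \<comment> \<open>For fixed \<open>n\<close> only the spatial cut survives as \<open>k\<close>
    grows, so \<open>vn n\<close> is the limit of \<open>y n k\<close>.\<close>
  define S where "S n = {z \<in> space M. fst z \<in> core (real (Suc n)) v \<union> zero_core (real (Suc n)) v}" for n
  have [measurable]: "S n \<in> sets M" for n unfolding S_def by measurable
  define vn where "vn n z = indicator (S n) z * v z" for n z
  have vn: "vn n \<in> L2 M" for n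
    unfolding vn_def[abs_def] by (rule L2_indicator_mult[OF vL2]) measurable
  have vn_conv: "L2_strong_conv M vn v"
    unfolding vn_def[abs_def]
  proof (rule L2_strong_conv_indicator[OF vL2])
    show "AE z in M. \<forall>\<^sub>F n in sequentially. z \<in> S n"
    proof (rule AE_I2)
      fix z assume z: "z \<in> space M"
      then have x: "fst z \<in> space X" by (auto simp: space_pair_measure)
      have ev: "\<forall>\<^sub>F n in sequentially. c \<le> real (Suc n)" for c
        using eventually_ge_at_top[of "nat \<lceil>c\<rceil>"] by eventually_elim linarith
      have "\<forall>\<^sub>F n in sequentially. snorm u (fst z) = 0 \<or> inverse (real (Suc n)) \<le> snorm u (fst z)"
      proof (cases "snorm u (fst z) = 0")
        case False
        then have "0 < snorm u (fst z)" by (metis L2_norm_nonneg order.not_eq_order_implies_strict)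
        then show ?thesis
          using ev[of "inverse (snorm u (fst z))"]
          by (auto elim!: eventually_mono simp: field_simps)
      qed simp
      then show "\<forall>\<^sub>F n in sequentially. z \<in> S n"
        using ev[of "snorm v (fst z)"]
        by eventually_elim (use x z in \<open>auto simp: S_def core_def zero_core_def\<close>)
    qed
  qed measurable
  have y_conv: "L2_strong_conv M (y n) (vn n)" for n
  proof -
    \<comment> \<open>Adding the complement of \<open>S n\<close>, where \<open>vn n\<close> is
      \<open>0\<close>, leaves the product unchanged and makes almost every point eventually belong
      to \<open>E k\<close>.\<close>
    define E where "E k = cut_set (real (Suc n)) (t k) v \<union> (space M - S n)" for k
    have "L2_strong_conv M (\<lambda>k z. indicator (E k) z * vn n z) (vn n)"
    proof (rule L2_strong_conv_indicator[OF vn])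
      show "AE z in M. \<forall>\<^sub>F k in sequentially. z \<in> E k"
        using eventually_truncation[OF tan tk t0] AE_space
      proof eventually_elim
        case (elim z)
        from elim(1) show ?case
          by eventually_elim (use elim in \<open>auto simp: E_def S_def cut_set_def\<close>)
      qed
    qed (simp add: E_def)
    moreover have "(\<lambda>z. indicator (E k) z * vn n z) = y n k" for k
      by (auto simp: fun_eq_iff E_def S_def cut_set_def vn_def y_def indicator_def)
    ultimately show ?thesis by simp
  qed
  define P where "P n k \<longleftrightarrow> feasible (t k) (y n k) \<and>
      \<bar>quot2 (t k) (y n k) - \<mu> * Kn n\<bar> < inverse (real (Suc n)) \<and>
      L2_norm M (\<lambda>z. y n k z - vn n z) < inverse (real (Suc n))" for n k
  have "\<forall>\<^sub>F k in sequentially. P n k" for n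
  proof -
    have "(\<lambda>k. \<mu> * (LINT x|X. squot2 u (t k) (y n k) x)) \<longlonglongrightarrow> \<mu> * Kn n"
      unfolding y_def Kn_def
      by (intro tendsto_mult tendsto_const integral_squot2_cut_tendsto tan tk t0) simp
    moreover have "quot2 (t k) (y n k) = \<mu> * (LINT x|X. squot2 u (t k) (y n k) x)" for k
      unfolding y_def by (rule quot2_cut_eq[OF v]) (use tk[of k] in auto)
    ultimately have "(\<lambda>k. quot2 (t k) (y n k)) \<longlonglongrightarrow> \<mu> * Kn n" by simp
    from tendstoD[OF this, of "inverse (real (Suc n))"]
    have "\<forall>\<^sub>F k in sequentially. \<bar>quot2 (t k) (y n k) - \<mu> * Kn n\<bar> < inverse (real (Suc n))"
      by (simp add: dist_real_def)
    moreover have "\<forall>\<^sub>F k in sequentially. L2_norm M (\<lambda>z. y n k z - vn n z) < inverse (real (Suc n))"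
      using y_conv[of n] by (intro order_tendstoD(2)) (auto simp: L2_strong_conv_def)
    moreover have "\<forall>\<^sub>F k in sequentially. feasible (t k) (y n k)"
      unfolding y_def by (rule eventually_feasible_cut[OF v tk t0])
    ultimately show ?thesis by eventually_elim (simp add: P_def)
  qed
  from eventually_sequentially_diagonal[of P, OF this] obtain \<sigma>
    where \<sigma>: "filterlim \<sigma> at_top sequentially" and P: "\<forall>\<^sub>F k in sequentially. P (\<sigma> k) k"
    by blast
  define vs where "vs k = y (\<sigma> k) k" for k
  have inv0: "(\<lambda>k. inverse (real (Suc (\<sigma> k)))) \<longlonglongrightarrow> 0"
    using filterlim_compose[OF LIMSEQ_inverse_real_of_nat \<sigma>] by simp
  have "(\<lambda>k. L2_norm M (\<lambda>z. vs k z - v z)) \<longlonglongrightarrow> 0"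
  proof (rule Lim_null_comparison)
    have "(\<lambda>k. L2_norm M (\<lambda>z. vn (\<sigma> k) z - v z)) \<longlonglongrightarrow> 0"
      using filterlim_compose[of "\<lambda>n. L2_norm M (\<lambda>z. vn n z - v z)", OF _ \<sigma>] vn_conv
      by (simp add: L2_strong_conv_def)
    from tendsto_add[OF inv0 this]
    show "(\<lambda>k. inverse (real (Suc (\<sigma> k))) + L2_norm M (\<lambda>z. vn (\<sigma> k) z - v z)) \<longlonglongrightarrow> 0" by simp
    show "\<forall>\<^sub>F k in sequentially. norm (L2_norm M (\<lambda>z. vs k z - v z)) \<le>
        inverse (real (Suc (\<sigma> k))) + L2_norm M (\<lambda>z. vn (\<sigma> k) z - v z)"
      using P
    proof eventually_elim
      case (elim k)
      then show ?case
        using L2_norm_triangle_diff[OF y vn vL2, of "\<sigma> k" k "\<sigma> k"] by (simp add: P_def vs_def)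
    qed
  qed
  then have "L2_strong_conv M vs v" using y vL2 by (simp add: L2_strong_conv_def vs_def)
  moreover have "\<forall>\<^sub>F k in sequentially. feasible (t k) (vs k)"
    using P by eventually_elim (simp add: P_def vs_def)
  moreover have "(\<lambda>k. quot2 (t k) (vs k)) \<longlonglongrightarrow> \<mu> * K"
  proof -
    have lim: "(\<lambda>k. \<mu> * Kn (\<sigma> k)) \<longlonglongrightarrow> \<mu> * K"
      using filterlim_compose[OF K \<sigma>] by (intro tendsto_mult tendsto_const) (simp add: Kn_def)
    have "(\<lambda>k. quot2 (t k) (vs k) - \<mu> * Kn (\<sigma> k)) \<longlonglongrightarrow> 0"
      by (rule Lim_null_comparison[OF _ inv0])
         (use P in eventually_elim, simp add: P_def vs_def)
    from tendsto_add[OF this lim] show ?thesis by simp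
  qed
  ultimately show thesis by (rule that)
qed

section \<open>The second subderivative\<close>

definition G :: "('a \<times> 'b \<Rightarrow> real) \<Rightarrow> ereal" where
  "G f = indicator_fun {f \<in> L2 M. AE z in M. \<alpha> \<le> f z \<and> f z \<le> \<beta>} f + ereal (\<mu> * J f)"

text \<open>Integrating over all of \<open>X\<close> adds nothing to the integral over the nonzero
  slices, because \<open>scurv\<close> is \<open>0\<close> on the others.\<close>

definition curv :: "('a \<times> 'b \<Rightarrow> real) \<Rightarrow> ennreal" where
  "curv v = (\<integral>\<^sup>+x. ennreal (\<mu> * scurv u v x) \<partial>X)"

lemma second_diff_quot_G:
  assumes v: "v \<in> L2 M" and t: "0 < t"
  shows "second_diff_quot M G u w t v = (if feasible t v then ereal (quot2 t v) else \<infinity>)"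
proof -
  have "G u = ereal (\<mu> * J u)" using u box by (simp add: G_def indicator_fun_def)
  moreover have "G (\<lambda>z. u z + t * v z) =
      (if feasible t v then ereal (\<mu> * J (\<lambda>z. u z + t * v z)) else \<infinity>)"
    using L2_add_scale[OF u v] by (simp add: G_def indicator_fun_def feasible_def)
  ultimately show ?thesis
    using t by (simp add: second_diff_quot_def quot2_def right_diff_distrib)
qed

text \<open>Monotone convergence along the cores connects the real integrals of the limit arguments
  with the possibly infinite curvature.\<close>

lemma curv_SUP:
  assumes v: "v \<in> L2 M"
  defines "K \<equiv> \<lambda>n. LINT x|X. indicator (core (real (Suc n)) v) x * scurv u v x"
  shows "incseq K" "curv v = (SUP n. ennreal (\<mu> * K n))"
proof -
  have [measurable]: "v \<in> borel_measurable M" using v by (rule L2_measurable)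
  have curv_nonneg: "AE x in X. 0 \<le> scurv u v x"
    using slice_L2[OF u] slice_L2[OF v] by eventually_elim (rule L2_norm_curv_nonneg)
  have core_mono: "core (real (Suc m)) v \<subseteq> core (real (Suc n)) v" if "m \<le> n" for m n
  proof -
    have le: "real (Suc m) \<le> real (Suc n)" using that by simp
    then have inv: "inverse (real (Suc n)) \<le> inverse (real (Suc m))"
      by (intro le_imp_inverse_le) auto
    show ?thesis
      unfolding core_def using order_trans[OF inv] order_trans[OF _ le] by blast
  qed
  show inc: "incseq K"
    unfolding K_def
  proof (intro incseq_SucI integral_mono_AE integrable_core_curv v)
    show "AE x in X. indicator (core (real (Suc n)) v) x * scurv u v x
        \<le> indicator (core (real (Suc (Suc n))) v) x * scurv u v x" for n
      using curv_nonneg by eventually_elim (use core_mono[of n "Suc n"] in \<open>auto simp: indicator_def\<close>)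
  qed simp_all
  define f where "f n x = ennreal (\<mu> * (indicator (core (real (Suc n)) v) x * scurv u v x))" for n x
  have [measurable]: "f n \<in> borel_measurable X" for n unfolding f_def[abs_def] by measurable
  have f_eq: "f n x = (if x \<in> core (real (Suc n)) v then ennreal (\<mu> * scurv u v x) else 0)" for n x
    by (simp add: f_def)
  have f_inc: "incseq f"
    unfolding incseq_def le_fun_def f_eq using core_mono by auto
  have "(SUP n. f n x) = ennreal (\<mu> * scurv u v x)" if x: "x \<in> space X" for x
  proof (cases "snorm u x = 0")
    case True
    then have "scurv u v x = 0" by (simp add: L2_norm_curv_def)
    then show ?thesis by (simp add: f_def)
  next
    case False
    then have pos: "0 < snorm u x" by (metis L2_norm_nonneg order.not_eq_order_implies_strict)
    obtain n where "max (snorm v x) (inverse (snorm u x)) \<le> real n" using real_arch_simple by blast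
    then have "snorm v x \<le> real (Suc n)" "inverse (snorm u x) \<le> real (Suc n)" by auto
    then have "x \<in> core (real (Suc n)) v" using x pos by (simp add: core_def field_simps)
    then have "ennreal (\<mu> * scurv u v x) \<le> f n x" by (simp add: f_eq)
    then show ?thesis
      by (intro antisym SUP_least SUP_upper2[of n]) (auto simp: f_eq)
  qed
  then have "curv v = (\<integral>\<^sup>+x. (SUP n. f n x) \<partial>X)"
    unfolding curv_def by (intro nn_integral_cong) simp
  also have "\<dots> = (SUP n. \<integral>\<^sup>+x. f n x \<partial>X)"
    by (rule nn_integral_monotone_convergence_SUP[OF f_inc]) measurable
  finally have "curv v = (SUP n. \<integral>\<^sup>+x. f n x \<partial>X)" .
  moreover have "(\<integral>\<^sup>+x. f n x \<partial>X) = ennreal (\<mu> * K n)" for n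
  proof -
    have "(\<integral>\<^sup>+x. f n x \<partial>X) =
        ennreal (LINT x|X. \<mu> * (indicator (core (real (Suc n)) v) x * scurv u v x))"
      unfolding f_def
    proof (rule nn_integral_eq_integral)
      show "AE x in X. 0 \<le> \<mu> * (indicator (core (real (Suc n)) v) x * scurv u v x)"
        using curv_nonneg by eventually_elim (use mu in simp)
    qed (use integrable_core_curv[OF v] in simp)
    then show ?thesis by (simp add: K_def)
  qed
  ultimately show "curv v = (SUP n. ennreal (\<mu> * K n))" by simp
qed

lemma curv_le_liminf:
  assumes t: "pos_null_seq t" and weak: "L2_weak_conv M vs v"
  shows "enn2ereal (curv v) \<le> liminf (\<lambda>k. second_diff_quot M G u w (t k) (vs k))"
    (is "_ \<le> ?L")
proof -
  have vs: "\<And>k. vs k \<in> L2 M" and v: "v \<in> L2 M" using weak by (auto simp: L2_weak_conv_def)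
  have tk: "\<And>k. 0 < t k" using t by (auto simp: pos_null_seq_def)
  define K where "K n = (LINT x|X. indicator (core (real (Suc n)) v) x * scurv u v x)" for n
  have le: "ereal (\<mu> * K n) \<le> ?L" for n
  proof -
    obtain q where lim: "q \<longlonglongrightarrow> \<mu> * K n" and q: "\<And>k. tangent (vs k) \<Longrightarrow> q k \<le> quot2 (t k) (vs k)"
      unfolding K_def using quot2_core_lower_bound[OF t weak, of "real (Suc n)"] by auto
    have "ereal (\<mu> * K n) = liminf (\<lambda>k. ereal (q k))"
      using lim by (intro lim_imp_Liminf[symmetric]) auto
    also have "\<dots> \<le> ?L"
      using q feasible_imp_tangent[OF vs _ tk]
      by (intro Liminf_mono always_eventually allI) (auto simp: second_diff_quot_G[OF vs tk])
    finally show ?thesis .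
  qed
  have "0 \<le> ereal (\<mu> * K n)" for n
  proof -
    have "0 \<le> K n"
      unfolding K_def
    proof (rule integral_nonneg_AE)
      show "AE x in X. 0 \<le> indicator (core (real (Suc n)) v) x * scurv u v x"
        using slice_L2[OF u] slice_L2[OF v] by eventually_elim (simp add: L2_norm_curv_nonneg)
    qed
    then show ?thesis using mu by simp
  qed
  \<comment> \<open>The supremum is taken in \<open>ennreal\<close>; nonnegativity lets
    \<open>?L\<close> survive the round trip through \<open>e2ennreal\<close>.\<close>
  from order_trans[OF this le] have L: "0 \<le> ?L" .
  have "curv v \<le> e2ennreal ?L"
    unfolding curv_SUP(2)[OF v]
  proof (rule SUP_least)
    fix n
    show "ennreal (\<mu> * (LINT x|X. indicator (core (real (Suc n)) v) x * scurv u v x)) \<le> e2ennreal ?L"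
      using e2ennreal_mono[OF le[of n]] by (simp add: K_def)
  qed
  then have "enn2ereal (curv v) \<le> enn2ereal (e2ennreal ?L)"
    by (simp add: less_eq_ennreal.rep_eq)
  then show ?thesis using L by (simp add: enn2ereal_e2ennreal)
qed

lemma curv_le_weak_second_subderiv: "enn2ereal (curv v) \<le> weak_second_subderiv M G u w v"
  unfolding weak_second_subderiv_def by (rule Inf_greatest) (auto intro: curv_le_liminf)

text \<open>Finite curvature bounds the increasing integrals over the cores, so they have the real
  limit that the diagonal construction asks for.\<close>

lemma critical_recovery_sequence_curv:
  assumes v: "critical v" and fin: "curv v < \<infinity>" and t: "pos_null_seq t"
  obtains vs where "L2_strong_conv M vs v"
    "(\<lambda>k. second_diff_quot M G u w (t k) (vs k)) \<longlonglongrightarrow> enn2ereal (curv v)"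
proof -
  have vL2: "v \<in> L2 M" using v by (simp add: critical_def tangent_def)
  define K where "K n = (LINT x|X. indicator (core (real (Suc n)) v) x * scurv u v x)" for n
  have inc: "incseq K" and SUP: "curv v = (SUP n. ennreal (\<mu> * K n))"
    using curv_SUP[OF vL2] by (simp_all add: K_def[abs_def])
  have K0: "0 \<le> K n" for n
    unfolding K_def
  proof (rule integral_nonneg_AE)
    show "AE x in X. 0 \<le> indicator (core (real (Suc n)) v) x * scurv u v x"
      using slice_L2[OF u] slice_L2[OF vL2] by eventually_elim (simp add: L2_norm_curv_nonneg)
  qed
  have "K n \<le> enn2real (curv v) / \<mu>" for n
  proof -
    have "ennreal (\<mu> * K n) \<le> curv v" unfolding SUP by (rule SUP_upper) simp
    then have "enn2real (ennreal (\<mu> * K n)) \<le> enn2real (curv v)"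
      using fin by (intro enn2real_mono) auto
    then show ?thesis using mu K0[of n] by (simp add: field_simps)
  qed
  then obtain L where L: "K \<longlonglongrightarrow> L" using incseq_convergent[OF inc] by blast
  have "(\<lambda>n. ennreal (\<mu> * K n)) \<longlonglongrightarrow> curv v"
    unfolding SUP using inc mu
    by (intro LIMSEQ_SUP) (auto simp: incseq_def intro!: ennreal_leI mult_left_mono)
  moreover have "(\<lambda>n. ennreal (\<mu> * K n)) \<longlonglongrightarrow> ennreal (\<mu> * L)"
    by (intro tendsto_ennrealI tendsto_mult tendsto_const L)
  ultimately have curv: "curv v = ennreal (\<mu> * L)" by (rule LIMSEQ_unique)
  have L0: "0 \<le> \<mu> * L" using mu LIMSEQ_le_const[OF L] K0 by auto
  obtain vs where vs: "L2_strong_conv M vs v" "\<forall>\<^sub>F k in sequentially. feasible (t k) (vs k)"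
    "(\<lambda>k. quot2 (t k) (vs k)) \<longlonglongrightarrow> \<mu> * L"
    using critical_recovery_sequence[OF v t, of L] L unfolding K_def[abs_def] by blast
  have "(\<lambda>k. ereal (quot2 (t k) (vs k))) \<longlonglongrightarrow> enn2ereal (curv v)"
    using vs(3) L0 by (simp add: curv enn2ereal_ennreal)
  moreover have "\<forall>\<^sub>F k in sequentially. ereal (quot2 (t k) (vs k)) = second_diff_quot M G u w (t k) (vs k)"
    using vs(2)
  proof eventually_elim
    case (elim k)
    have "vs k \<in> L2 M" "0 < t k" using vs(1) t by (auto simp: L2_strong_conv_def pos_null_seq_def)
    then show ?case using elim by (simp add: second_diff_quot_G)
  qed
  ultimately have "(\<lambda>k. second_diff_quot M G u w (t k) (vs k)) \<longlonglongrightarrow> enn2ereal (curv v)"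
    by (rule Lim_transform_eventually)
  with vs(1) show thesis by (rule that)
qed

lemma weak_second_subderiv_critical:
  assumes v: "critical v"
  shows "weak_second_subderiv M G u w v = enn2ereal (curv v)"
proof (cases "curv v = \<infinity>")
  case True
  then show ?thesis using curv_le_weak_second_subderiv[of v] by (simp add: top_ereal_def)
next
  case False
  define t where "t k = inverse (real (Suc k))" for k
  have t: "pos_null_seq t"
    using LIMSEQ_inverse_real_of_nat by (simp add: pos_null_seq_def t_def[abs_def])
  obtain vs where vs: "L2_strong_conv M vs v"
      "(\<lambda>k. second_diff_quot M G u w (t k) (vs k)) \<longlonglongrightarrow> enn2ereal (curv v)"
    using critical_recovery_sequence_curv[OF v _ t] False by (auto simp: less_top)
  have "weak_second_subderiv M G u w v \<le> liminf (\<lambda>k. second_diff_quot M G u w (t k) (vs k))"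
    unfolding weak_second_subderiv_def
    using t L2_strong_imp_weak_conv[OF vs(1)] by (intro Inf_lower) blast
  also have "\<dots> = enn2ereal (curv v)" by (intro lim_imp_Liminf vs) simp
  finally show ?thesis using curv_le_weak_second_subderiv[of v] by (intro antisym)
qed

text \<open>A finite infimum supplies a weakly convergent sequence whose quotients lie below some
  real \<open>B\<close> infinitely often, which is what \<open>critical_of_bounded_quotients\<close>
  expects.\<close>

lemma weak_second_subderiv_finite_imp_critical:
  assumes "weak_second_subderiv M G u w v < \<infinity>"
  shows "critical v"
proof -
  obtain t vs where t: "pos_null_seq t" and weak: "L2_weak_conv M vs v"
    and fin: "liminf (\<lambda>k. second_diff_quot M G u w (t k) (vs k)) < \<infinity>"
    using assms unfolding weak_second_subderiv_def Inf_less_iff by blast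
  obtain B where B: "liminf (\<lambda>k. second_diff_quot M G u w (t k) (vs k)) < ereal B"
    using less_PInf_Ex_of_nat fin by auto
  have "\<exists>\<^sub>F k in sequentially. \<not> ereal B \<le> second_diff_quot M G u w (t k) (vs k)"
    using B Liminf_bounded[of "ereal B" _ sequentially] by (auto simp: frequently_def not_less[symmetric])
  then have "\<exists>\<^sub>F k in sequentially. feasible (t k) (vs k) \<and> quot2 (t k) (vs k) \<le> B"
  proof (rule frequently_elim1)
    fix k assume less: "\<not> ereal B \<le> second_diff_quot M G u w (t k) (vs k)"
    have "vs k \<in> L2 M" "0 < t k" using weak t by (auto simp: L2_weak_conv_def pos_null_seq_def)
    then show "feasible (t k) (vs k) \<and> quot2 (t k) (vs k) \<le> B"
      using less by (auto simp: second_diff_quot_G split: if_splits)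
  qed
  then show ?thesis by (rule critical_of_bounded_quotients[OF t weak])
qed

text \<open>If the second subderivative is infinite at \<open>v\<close>, the constant sequence
  works, its \<open>liminf\<close> being bounded below by the infimum. Otherwise \<open>v\<close> is
  critical with finite curvature and the recovery sequence applies.\<close>

lemma strongly_twice_epi_diff_G: "strongly_twice_epi_diff M G u w"
  unfolding strongly_twice_epi_diff_def
proof (intro ballI allI impI)
  fix v and t :: "nat \<Rightarrow> real"
  assume v: "v \<in> L2 M" and t: "pos_null_seq t"
  show "\<exists>vs. L2_strong_conv M vs v \<and>
      (\<lambda>k. second_diff_quot M G u w (t k) (vs k)) \<longlonglongrightarrow> weak_second_subderiv M G u w v"
  proof (cases "weak_second_subderiv M G u w v = \<infinity>")
    case True
    have const: "L2_strong_conv M (\<lambda>_. v) v" by (rule L2_strong_conv_const[OF v])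
    have "weak_second_subderiv M G u w v \<le> liminf (\<lambda>k. second_diff_quot M G u w (t k) v)"
      unfolding weak_second_subderiv_def
      by (intro Inf_lower CollectI exI[of _ t] exI[of _ "\<lambda>_. v"])
         (use t L2_strong_imp_weak_conv[OF const] in simp)
    then have "liminf (\<lambda>k. second_diff_quot M G u w (t k) v) = \<infinity>" using True by simp
    then have "(\<lambda>k. second_diff_quot M G u w (t k) v) \<longlonglongrightarrow> \<infinity>"
      using Liminf_PInfty[of sequentially] by simp
    then show ?thesis using const True by (intro exI[of _ "\<lambda>_. v"]) simp
  next
    case False
    then have crit: "critical v" by (intro weak_second_subderiv_finite_imp_critical) (simp add: less_top[symmetric] top_ereal_def)
    then have "curv v < \<infinity>"
      using False weak_second_subderiv_critical by (auto simp: less_top)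
    then obtain vs where "L2_strong_conv M vs v"
        "(\<lambda>k. second_diff_quot M G u w (t k) (vs k)) \<longlonglongrightarrow> enn2ereal (curv v)"
      using critical_recovery_sequence_curv[OF crit _ t] by blast
    then show ?thesis
      by (intro exI[of _ vs]) (simp add: weak_second_subderiv_critical[OF crit])
  qed
qed

end

section \<open>The space-time cylinder\<close>

lemma sets_pair_restrict_space:
  "sets (restrict_space M A \<Otimes>\<^sub>M restrict_space N B) = sets (restrict_space (M \<Otimes>\<^sub>M N) (A \<times> B))"
proof (rule antisym)
  show "sets (restrict_space M A \<Otimes>\<^sub>M restrict_space N B) \<subseteq> sets (restrict_space (M \<Otimes>\<^sub>M N) (A \<times> B))"
  proof (rule sets_pair_in_sets)
    fix a b assume "a \<in> sets (restrict_space M A)" "b \<in> sets (restrict_space N B)"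
    then obtain a' b' where "a' \<in> sets M" "a = A \<inter> a'" "b' \<in> sets N" "b = B \<inter> b'"
      by (auto simp: sets_restrict_space)
    then have "a' \<times> b' \<in> sets (M \<Otimes>\<^sub>M N)" "a \<times> b = (A \<times> B) \<inter> (a' \<times> b')" by auto
    then show "a \<times> b \<in> sets (restrict_space (M \<Otimes>\<^sub>M N) (A \<times> B))"
      unfolding sets_restrict_space by blast
  qed
next
  let ?P = "restrict_space M A \<Otimes>\<^sub>M restrict_space N B"
  have "fst \<in> measurable ?P M" "snd \<in> measurable ?P N"
    using measurable_fst[of "restrict_space M A" "restrict_space N B"]
      measurable_snd[of "restrict_space M A" "restrict_space N B"]
    by (simp_all only: measurable_restrict_space2_iff)
  then have id: "(\<lambda>z. z) \<in> measurable ?P (M \<Otimes>\<^sub>M N)"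
    using measurable_Pair[of fst ?P M snd N] by (simp only: prod.collapse)
  show "sets (restrict_space (M \<Otimes>\<^sub>M N) (A \<times> B)) \<subseteq> sets ?P"
  proof
    fix S assume "S \<in> sets (restrict_space (M \<Otimes>\<^sub>M N) (A \<times> B))"
    then obtain S' where S': "S' \<in> sets (M \<Otimes>\<^sub>M N)" "S = (A \<times> B) \<inter> S'"
      by (auto simp: sets_restrict_space)
    have "S = S' \<inter> space ?P"
      using sets.sets_into_space[OF S'(1)] S'(2) by (auto simp: space_pair_measure space_restrict_space)
    then show "S \<in> sets ?P" using measurable_sets[OF id S'(1)] by (simp add: vimage_def Int_def)
  qed
qed

lemma finite_measure_restrict_lborel:
  fixes A :: "'a::euclidean_space set"
  assumes "bounded A" "A \<in> sets borel"
  shows "finite_measure (restrict_space lborel A)"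
  using emeasure_bounded_finite[OF assms(1)] assms(2)
  by (intro finite_measureI) (simp add: space_restrict_space emeasure_restrict_space)

text \<open>The cylinder carries restricted Lebesgue measure on the joint space, while the argument
  above slices a product. Openness makes \<open>\<Omega>\<close> Borel and boundedness makes its
  measure finite.\<close>

lemma cyl_measure_eq_pair:
  fixes \<Omega> :: "'a::euclidean_space set"
  assumes "open \<Omega>" "bounded \<Omega>"
  shows "cyl_measure \<Omega> T = restrict_space lborel \<Omega> \<Otimes>\<^sub>M restrict_space lborel {0<..<T}"
  unfolding cyl_measure_def
proof (rule pair_measure_eqI[symmetric])
  have [measurable]: "\<Omega> \<in> sets borel" using assms(1) by simp
  show "sigma_finite_measure (restrict_space lborel \<Omega>)"
    using finite_measure_restrict_lborel[OF assms(2)] by (simp add: finite_measure_def)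
  show "sigma_finite_measure (restrict_space lborel {0<..<T})"
    using finite_measure_restrict_lborel[of "{0<..<T}"] by (simp add: finite_measure_def)
  show "sets (restrict_space lborel \<Omega> \<Otimes>\<^sub>M restrict_space lborel {0<..<T}) =
      sets (restrict_space lborel (\<Omega> \<times> {0<..<T}))"
    unfolding sets_pair_restrict_space lborel_prod ..
  fix A B assume A: "A \<in> sets (restrict_space lborel \<Omega>)"
    and B: "B \<in> sets (restrict_space lborel {0<..<T})"
  then have sub: "A \<subseteq> \<Omega>" "B \<subseteq> {0<..<T}" "A \<in> sets borel" "B \<in> sets borel"
    by (auto simp: sets_restrict_space_iff)
  have "\<Omega> \<times> {0<..<T} \<in> sets (lborel \<Otimes>\<^sub>M lborel)" by simp
  then have "\<Omega> \<times> {0<..<T} \<in> sets (lborel :: ('a \<times> real) measure)" by (simp only: lborel_prod)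
  then have "emeasure (restrict_space lborel (\<Omega> \<times> {0<..<T})) (A \<times> B) = emeasure lborel (A \<times> B)"
    using sub by (subst emeasure_restrict_space) auto
  also have "\<dots> = emeasure (lborel \<Otimes>\<^sub>M lborel) (A \<times> B)" by (simp only: lborel_prod)
  also have "\<dots> = emeasure lborel A * emeasure lborel B"
    using sub by (intro lborel.emeasure_pair_measure_Times) auto
  finally show "emeasure (restrict_space lborel \<Omega>) A * emeasure (restrict_space lborel {0<..<T}) B =
      emeasure (restrict_space lborel (\<Omega> \<times> {0<..<T})) (A \<times> B)"
    using sub by (simp add: emeasure_restrict_space)
qed

theorem theorem3p21:
  fixes \<Omega> :: "'a::euclidean_space set" and T \<alpha> \<beta> \<mu> :: real
    and ubar dF :: "'a \<times> real \<Rightarrow> real"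
    and F :: "('a \<times> real \<Rightarrow> real) \<Rightarrow> real"
    and d2F :: "('a \<times> real \<Rightarrow> real) \<Rightarrow> ('a \<times> real \<Rightarrow> real) \<Rightarrow> real"
  assumes "\<Omega> \<noteq> {}" and "open \<Omega>" and "bounded \<Omega>" and "T > 0" and "\<alpha> < \<beta>" and "\<mu> > 0"
    and "ubar \<in> Uad \<Omega> T \<alpha> \<beta>"
    and F_well_defined: "\<And>u u'. u \<in> Uad \<Omega> T \<alpha> \<beta> \<Longrightarrow> u' \<in> Uad \<Omega> T \<alpha> \<beta> \<Longrightarrow>
           (AE z in cyl_measure \<Omega> T. u z = u' z) \<Longrightarrow> F u = F u'"
    and "dF \<in> L2 (cyl_measure \<Omega> T)"
    and "bounded_bilinear_form_L2 (cyl_measure \<Omega> T) d2F"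
    and "second_order_expansion (cyl_measure \<Omega> T) (Uad \<Omega> T \<alpha> \<beta>) F ubar dF d2F"
    and "(\<lambda>z. - dF z) \<in> convex_subdiff (cyl_measure \<Omega> T) (G3 \<Omega> T \<alpha> \<beta> \<mu>) ubar
           \<inter> Linfty (cyl_measure \<Omega> T)"
  shows "(\<forall>v \<in> critical_cone \<Omega> T \<alpha> \<beta> \<mu> ubar dF.
            weak_second_subderiv (cyl_measure \<Omega> T) (G3 \<Omega> T \<alpha> \<beta> \<mu>) ubar (\<lambda>z. - dF z) v =
              (if \<not> (AE z in cyl_measure \<Omega> T. ubar z = 0)
               then enn2ereal (curvature_j3 \<Omega> T \<mu> ubar v) else 0))
         \<and> strongly_twice_epi_diff (cyl_measure \<Omega> T) (G3 \<Omega> T \<alpha> \<beta> \<mu>) ubar (\<lambda>z. - dF z)"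
proof -
  define X where "X = restrict_space lborel \<Omega>"
  define Y where "Y = restrict_space lborel {0<..<T}"
  have \<Omega>[measurable]: "\<Omega> \<in> sets borel" using assms(2) by simp
  have M: "cyl_measure \<Omega> T = X \<Otimes>\<^sub>M Y"
    unfolding X_def Y_def by (rule cyl_measure_eq_pair[OF assms(2,3)])
  interpret X: finite_measure X
    unfolding X_def using finite_measure_restrict_lborel[OF assms(3)] by simp
  interpret Y: finite_measure Y
    unfolding Y_def using finite_measure_restrict_lborel[of "{0<..<T}"] by simp
  interpret P: finite_product X Y ..
  have slice_norm: "slice_norm T f x = L2_norm Y (\<lambda>t. f (x, t))" for f and x :: 'a
    by (simp add: slice_norm_def Y_def)
  have j3: "j3 \<Omega> T = P.J"
  proof
    fix f
    show "j3 \<Omega> T f = P.J f"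
      unfolding j3_def P.J_def set_lebesgue_integral_def slice_norm
      by (simp add: X_def integral_restrict_space)
  qed
  obtain C where C: "AE z in X \<Otimes>\<^sub>M Y. \<bar>- dF z\<bar> \<le> C"
    using assms(12) by (auto simp: Linfty_def M)
  have U: "f \<in> Uad \<Omega> T \<alpha> \<beta> \<longleftrightarrow> f \<in> L2 (X \<Otimes>\<^sub>M Y) \<and> (AE z in X \<Otimes>\<^sub>M Y. \<alpha> \<le> f z \<and> f z \<le> \<beta>)" for f
    unfolding Uad_def M by simp
  interpret B: box_subgradient X Y \<alpha> \<beta> \<mu> C ubar "\<lambda>z. - dF z"
  proof
    show "(\<lambda>z. - dF z) \<in> L2 (X \<Otimes>\<^sub>M Y)" using assms(9) by (simp add: M L2_uminus)
    fix f assume f: "f \<in> L2 (X \<Otimes>\<^sub>M Y)" "AE z in X \<Otimes>\<^sub>M Y. \<alpha> \<le> f z \<and> f z \<le> \<beta>"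
    then have "G3 \<Omega> T \<alpha> \<beta> \<mu> ubar + ereal (L2_inner (X \<Otimes>\<^sub>M Y) (\<lambda>z. - dF z) (\<lambda>z. f z - ubar z))
        \<le> G3 \<Omega> T \<alpha> \<beta> \<mu> f"
      using assms(12) by (auto simp: convex_subdiff_def M)
    then show "\<mu> * P.J ubar + L2_inner (X \<Otimes>\<^sub>M Y) (\<lambda>z. - dF z) (\<lambda>z. f z - ubar z) \<le> \<mu> * P.J f"
      using assms(7) f by (simp add: G3_def indicator_fun_def U j3)
  qed (use assms(6,7) C in \<open>auto simp: U\<close>)
  have G: "G3 \<Omega> T \<alpha> \<beta> \<mu> = B.G"
    unfolding G3_def[abs_def] B.G_def[abs_def] j3 Uad_def M ..
  \<comment> \<open>The cone mentions some one-sided derivative \<open>D\<close>; uniqueness of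
    limits identifies it with \<open>P.DJ ubar v\<close>, and the sign change from \<open>dF\<close>
    to the multiplier turns the vanishing sum into the critical equality.\<close>
  have crit: "B.critical v" if v: "v \<in> critical_cone \<Omega> T \<alpha> \<beta> \<mu> ubar dF" for v
  proof -
    have tan: "B.tangent v"
      using v unfolding critical_cone_def tangent_cone_def B.tangent_def M by simp
    then have vL2: "v \<in> L2 (X \<Otimes>\<^sub>M Y)" by (simp add: B.tangent_def)
    obtain D where D: "has_dir_deriv P.J ubar v D" "L2_inner (X \<Otimes>\<^sub>M Y) dF v + \<mu> * D = 0"
      using v by (auto simp: critical_cone_def M j3)
    have "D = P.DJ ubar v"
      using D(1) P.J_has_dir_deriv[OF B.u vL2] unfolding has_dir_deriv_def
      by (intro tendsto_unique[of "at_right (0::real)"]) auto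
    moreover have "L2_inner (X \<Otimes>\<^sub>M Y) (\<lambda>z. - dF z) v = - L2_inner (X \<Otimes>\<^sub>M Y) dF v"
      by (simp add: L2_inner_def)
    ultimately show ?thesis using D(2) tan by (simp add: B.critical_def)
  qed
  \<comment> \<open>On slices of norm \<open>0\<close> the left integrand vanishes by division by
    zero, the right one by the indicator of \<open>nonzero_slices\<close>.\<close>
  have curv: "B.curv v = curvature_j3 \<Omega> T \<mu> ubar v" for v
  proof -
    have "B.curv v = (\<integral>\<^sup>+x. ennreal (\<mu> * P.scurv ubar v x) * indicator \<Omega> x \<partial>lborel)"
      unfolding B.curv_def unfolding X_def by (rule nn_integral_restrict_space) simp
    also have "\<dots> = curvature_j3 \<Omega> T \<mu> ubar v"
      unfolding curvature_j3_def
    proof (rule nn_integral_cong)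
      fix x :: 'a
      have "(LINT t:{0<..<T}|lborel. h t) = (LINT t|Y. h t)" for h :: "real \<Rightarrow> real"
        by (simp add: Y_def set_lebesgue_integral_def integral_restrict_space)
      then show "ennreal (\<mu> * P.scurv ubar v x) * indicator \<Omega> x =
        ennreal (\<mu> / slice_norm T ubar x * ((LINT t:{0<..<T}|lborel. (v (x, t))\<^sup>2)
           - (LINT t:{0<..<T}|lborel. ubar (x, t) * v (x, t) / slice_norm T ubar x)\<^sup>2))
          * indicator (nonzero_slices \<Omega> T ubar) x"
        by (auto simp: slice_norm nonzero_slices_def indicator_def L2_norm_curv_def L2_norm_power2 L2_inner_def)
    qed
    finally show ?thesis .
  qed
  \<comment> \<open>The separate case of the formula: almost every slice of \<open>ubar\<close> then
    has norm \<open>0\<close>, so the general value already equals \<open>0\<close>.\<close>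
  have curv0: "B.curv v = 0" if "AE z in X \<Otimes>\<^sub>M Y. ubar z = 0" for v
  proof -
    have "AE x in X. AE y in Y. ubar (x, y) = 0" using P.AE_pair[OF that] .
    then have "AE x in X. ennreal (\<mu> * P.scurv ubar v x) = 0"
    proof eventually_elim
      case (elim x)
      then have "(LINT y|Y. (ubar (x, y))\<^sup>2) = 0"
        by (intro integral_eq_zero_AE) auto
      then have "L2_norm Y (\<lambda>y. ubar (x, y)) = 0" by (simp add: L2_norm_def)
      then show ?case by (simp add: L2_norm_curv_def)
    qed
    then have "B.curv v = (\<integral>\<^sup>+x. 0 \<partial>X)" unfolding B.curv_def by (rule nn_integral_cong_AE)
    then show ?thesis by simp
  qed
  show ?thesis
    unfolding M G
    using B.strongly_twice_epi_diff_G B.weak_second_subderiv_critical[OF crit] curv0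
    by (auto simp: curv zero_ennreal.rep_eq)
qed

end
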